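(* Let $1<p,q<N$, $\delta,\mu>0$ with $D:=\delta\mu-(p-1)(q-1)>0$, and let $a,b\in\mathbb{R}$ with $a>-p$, $b>-q$. Assume that $\mathcal{A}_p$ is S-$p$-C and $\mathcal{A}_q$ is S-$q$-C (on $B_1'$), with constants $K_{1,p},K_{2,p}$ and $K_{1,q},K_{2,q}$ respectively. Let $u\in W^{1,p}_{loc}(B_1')\cap C(B_1')$ and $v\in W^{1,q}_{loc}(B_1')\cap C(B_1')$ be nonnegative solutions of $$-\mathcal{A}_p u+|x|^{a}v^{\delta}\le 0,\qquad -\mathcal{A}_q v+|x|^{b}u^{\mu}\le 0\qquad\text{in }B_1'.$$ Then there exists $C=C(N,p,q,a,b,\delta,\mu,K_{1,p},K_{2,p},K_{1,q},K_{2,q})>0$ such that $$u(x)\le C|x|^{-\gamma_{a,b}},\qquad v(x)\le C|x|^{-\xi_{a,b}}\qquad\text{in }B_{1/2}',$$ where $$\gamma_{a,b}=\frac{(p+a)(q-1)+(q+b)\delta}{D},\qquad \xi_{a,b}=\frac{(q+b)(p-1)+(p+a)\mu}{D}.$$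
   Context: $B_r=\{x\in\mathbb{R}^N:|x|<r\}$ and $B_r'=B_r\setminus\{0\}$. With $\Omega=B_1'$: $\mathcal{A}_p u:=\operatorname{div}[\mathrm{A}_p(x,u,\nabla u)]$ and $\mathcal{A}_q v:=\operatorname{div}[\mathrm{A}_q(x,v,\nabla v)]$, where $\mathrm{A}_p,\mathrm{A}_q:\Omega\times\mathbb{R}^+\times\mathbb{R}^N\to\mathbb{R}^N$ are Carathéodory functions ($\mathbb{R}^+=[0,\infty)$). $\mathcal{A}_p$ is S-$p$-C (strongly $p$-coercive) if there are constants $K_{1,p},K_{2,p}>0$ with $$\mathrm{A}_p(x,u,\eta)\cdot\eta\ge K_{1,p}|\eta|^p\ge K_{2,p}|\mathrm{A}_p(x,u,\eta)|^{p'}\qquad\forall (x,u,\eta)\in\Omega\times\mathbb{R}^+\times\mathbb{R}^N,$$ $p'=p/(p-1)$; similarly for $\mathcal{A}_q$ being S-$q$-C with $K_{1,q},K_{2,q}$. For $g\in L^1_{loc}(\Omega)$, a nonnegative $w\in W^{1,p}_{loc}(\Omega)$ satisfies $-\mathcal{A}_p w\ge g$ (resp. $\le$, $=$) in $\Omega$ if $\mathrm{A}_p(x,w,\nabla w)\in L^{p'}_{loc}(\Omega)$ and $\int_\Omega \mathrm{A}_p(x,w,\nabla w)\cdot\nabla\phi\ge\int_\Omega g\phi$ (resp. $\le$, $=$) for all nonnegative $\phi\in W^{1,\infty}(\Omega)$ with compact support in $\Omega$; similarly for $\mathcal{A}_q$. *)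

theory Defs
  imports "HOL-Analysis.Analysis"
begin

definition punctured_ball :: "real \<Rightarrow> (real^'n) set" where
  "punctured_ball r = ball 0 r - {0}"

subsection \<open>Lebesgue and Sobolev spaces\<close>

definition Lp_loc :: "(real^'n) set \<Rightarrow> real \<Rightarrow> (real^'n \<Rightarrow> 'b::euclidean_space) \<Rightarrow> bool" where
  "Lp_loc \<Omega> p f \<longleftrightarrow>
     f \<in> borel_measurable (lebesgue_on \<Omega>) \<and>
     (\<forall>K. compact K \<and> K \<subseteq> \<Omega> \<longrightarrow> integrable (lebesgue_on K) (\<lambda>x. norm (f x) powr p))"

definition Linfty :: "(real^'n) set \<Rightarrow> (real^'n \<Rightarrow> 'b::euclidean_space) \<Rightarrow> bool" where
  "Linfty \<Omega> f \<longleftrightarrow>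
     f \<in> borel_measurable (lebesgue_on \<Omega>) \<and>
     (\<exists>M. AE x in lebesgue_on \<Omega>. norm (f x) \<le> M)"

definition partial :: "'n \<Rightarrow> (real^'n \<Rightarrow> real) \<Rightarrow> real^'n \<Rightarrow> real" where
  "partial i f x = frechet_derivative f (at x) (axis i 1)"

text \<open>Since differentiability entails continuity, \<open>Ck k f\<close> says that all partial derivatives
  of \<open>f\<close> of order at most \<open>k\<close> exist and are continuous.\<close>

primrec Ck :: "nat \<Rightarrow> (real^'n \<Rightarrow> real) \<Rightarrow> bool" where
  "Ck 0 f \<longleftrightarrow> continuous_on UNIV f"
| "Ck (Suc k) f \<longleftrightarrow> (\<forall>x. f differentiable (at x)) \<and> (\<forall>i. Ck k (partial i f))"

text \<open>Elements of \<open>C\<^sub>c\<^sup>\<infinity>(\<Omega>)\<close> are represented by their extensions by zero.\<close>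

definition test_function :: "(real^'n) set \<Rightarrow> (real^'n \<Rightarrow> real) \<Rightarrow> bool" where
  "test_function \<Omega> \<phi> \<longleftrightarrow>
     (\<forall>k. Ck k \<phi>) \<and> compact (closure {x. \<phi> x \<noteq> 0}) \<and> closure {x. \<phi> x \<noteq> 0} \<subseteq> \<Omega>"

definition has_weak_gradient ::
    "(real^'n) set \<Rightarrow> (real^'n \<Rightarrow> real) \<Rightarrow> (real^'n \<Rightarrow> real^'n) \<Rightarrow> bool" where
  "has_weak_gradient \<Omega> u G \<longleftrightarrow>
     Lp_loc \<Omega> 1 u \<and> Lp_loc \<Omega> 1 G \<and>
     (\<forall>\<phi> i. test_function \<Omega> \<phi> \<longrightarrow>
        (\<integral>x. u x * partial i \<phi> x \<partial>lebesgue_on \<Omega>) = - (\<integral>x. G x $ i * \<phi> x \<partial>lebesgue_on \<Omega>))"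

text \<open>The weak gradient is determined only almost everywhere on \<open>\<Omega>\<close>; \<open>weak_gradient\<close> picks a
  representative. It is meaningful only if a weak gradient exists, and is used only below
  conditions that ensure this.\<close>

definition weak_gradient :: "(real^'n) set \<Rightarrow> (real^'n \<Rightarrow> real) \<Rightarrow> real^'n \<Rightarrow> real^'n" where
  "weak_gradient \<Omega> u = (SOME G. has_weak_gradient \<Omega> u G)"

definition W1p_loc :: "(real^'n) set \<Rightarrow> real \<Rightarrow> (real^'n \<Rightarrow> real) \<Rightarrow> bool" where
  "W1p_loc \<Omega> p u \<longleftrightarrow> Lp_loc \<Omega> p u \<and> (\<exists>G. has_weak_gradient \<Omega> u G \<and> Lp_loc \<Omega> p G)"

definition W1infty :: "(real^'n) set \<Rightarrow> (real^'n \<Rightarrow> real) \<Rightarrow> bool" where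
  "W1infty \<Omega> u \<longleftrightarrow> Linfty \<Omega> u \<and> (\<exists>G. has_weak_gradient \<Omega> u G \<and> Linfty \<Omega> G)"

definition compactly_supported_in :: "(real^'n) set \<Rightarrow> (real^'n \<Rightarrow> real) \<Rightarrow> bool" where
  "compactly_supported_in \<Omega> \<phi> \<longleftrightarrow>
     (\<exists>K. compact K \<and> K \<subseteq> \<Omega> \<and> (AE x in lebesgue_on \<Omega>. x \<notin> K \<longrightarrow> \<phi> x = 0))"

subsection \<open>Quasilinear operators in divergence form\<close>

text \<open>The operator \<open>u \<mapsto> div (A(x, u, \<nabla>u))\<close> is represented by \<open>A\<close>. The domain of \<open>A\<close> is
  \<open>\<Omega> \<times> [0, \<infinity>) \<times> \<real>\<^sup>N\<close>; its values elsewhere are irrelevant.\<close>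

type_synonym 'n flux = "real^'n \<Rightarrow> real \<Rightarrow> real^'n \<Rightarrow> real^'n"

definition caratheodory :: "(real^'n) set \<Rightarrow> 'n flux \<Rightarrow> bool" where
  "caratheodory \<Omega> A \<longleftrightarrow>
     (\<forall>t\<ge>0. \<forall>\<eta>. (\<lambda>x. A x t \<eta>) \<in> borel_measurable (lebesgue_on \<Omega>)) \<and>
     (AE x in lebesgue_on \<Omega>. continuous_on ({0..} \<times> UNIV) (\<lambda>(t, \<eta>). A x t \<eta>))"

definition strongly_coercive ::
    "(real^'n) set \<Rightarrow> real \<Rightarrow> real \<Rightarrow> real \<Rightarrow> 'n flux \<Rightarrow> bool" where
  "strongly_coercive \<Omega> p K1 K2 A \<longleftrightarrow>
     0 < K1 \<and> 0 < K2 \<and>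
     (\<forall>x\<in>\<Omega>. \<forall>t\<ge>0. \<forall>\<eta>.
        A x t \<eta> \<bullet> \<eta> \<ge> K1 * norm \<eta> powr p \<and>
        K1 * norm \<eta> powr p \<ge> K2 * norm (A x t \<eta>) powr (p / (p - 1)))"

text \<open>\<open>weakly_le \<Omega> p A w g\<close> is the weak form of \<open>- div (A(x, w, \<nabla>w)) \<le> g\<close> in \<open>\<Omega>\<close>.\<close>

definition weakly_le ::
    "(real^'n) set \<Rightarrow> real \<Rightarrow> 'n flux \<Rightarrow> (real^'n \<Rightarrow> real) \<Rightarrow> (real^'n \<Rightarrow> real) \<Rightarrow> bool" where
  "weakly_le \<Omega> p A w g \<longleftrightarrow>
     Lp_loc \<Omega> 1 g \<and> W1p_loc \<Omega> p w \<and> (AE x in lebesgue_on \<Omega>. 0 \<le> w x) \<and>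
     Lp_loc \<Omega> (p / (p - 1)) (\<lambda>x. A x (w x) (weak_gradient \<Omega> w x)) \<and>
     (\<forall>\<phi>. W1infty \<Omega> \<phi> \<and> compactly_supported_in \<Omega> \<phi> \<and> (AE x in lebesgue_on \<Omega>. 0 \<le> \<phi> x) \<longrightarrow>
        (\<integral>x. A x (w x) (weak_gradient \<Omega> w x) \<bullet> weak_gradient \<Omega> \<phi> x \<partial>lebesgue_on \<Omega>)
          \<le> (\<integral>x. g x * \<phi> x \<partial>lebesgue_on \<Omega>))"

end

theory Submission
  imports Defs "HOL-Real_Asymp.Real_Asymp"
begin

text \<open>Testing the inequality for \<open>u\<close> with a function that is bounded below on a ball \<open>B(y, d)\<close>
  shows that the mean of \<open>|x|\<^sup>a v\<^sup>\<delta>\<close> on \<open>B(y, d)\<close> is at most \<open>C d\<^sup>-\<^sup>p (sup u)\<^sup>p\<^sup>-\<^sup>1\<close>, the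
  supremum being over \<open>B(y, 2d)\<close>. Conversely, a De Giorgi iteration bounds \<open>v(y)\<^sup>\<delta>\<close> by the mean
  of \<open>v\<^sup>\<delta>\<close> on \<open>B(y, d)\<close> whenever \<open>v \<le> \<Lambda> v(y)\<close> there. The latter condition holds at a maximum
  point of the weighted function \<open>(R - |x - x\<^sub>0|)\<^sup>\<beta> v\<close> on \<open>B(x\<^sub>0, R)\<close>, \<open>R = |x\<^sub>0| / 2\<close>. With
  \<open>\<alpha>\<close> and \<open>\<beta>\<close> the exponents of the scale-invariant case \<open>a = b
      = 0\<close>, the powers of \<open>d\<close> cancel and the
  weighted maxima \<open>G\<close> and \<open>H\<close> of \<open>u\<close> and \<open>v\<close> satisfy \<open>H\<^sup>\<delta> \<le> C R\<^sup>-\<^sup>a G\<^sup>p\<^sup>-\<^sup>1\<close> and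
  \<open>G\<^sup>\<mu> \<le> C R\<^sup>-\<^sup>b H\<^sup>q\<^sup>-\<^sup>1\<close>; since \<open>D > 0\<close>, this bounds both.\<close>

subsection \<open>Smooth bump functions\<close>

text \<open>The inequalities may only be tested with bounded functions having bounded weak
  gradients, while the natural test function is a power of a truncation of the solution, which is
  merely of class W^{1,p}. Hence the solution is mollified and shifted below itself, and every
  estimate arises in a limit. Moreover \<open>weak_gradient\<close> is an arbitrary choice, so
  uniqueness a.e. is needed to exchange it for the explicit gradient of a test function. The
  iteration rests on no Sobolev inequality: an L^1 estimate in terms of the measure of the support,
  applied to a power of the truncation, already yields the superlinear exponent 1 + 1/N. The bound
  for the mean involves a supremum over a larger ball, and no growth control of u or v is available
  beforehand. Weighted maxima repair this: around the maximum point the weight stays comparable to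
  its value there, so the larger ball costs only a constant factor.\<close>

lemma partial_eq:
  assumes "(f has_derivative (\<lambda>v. g \<bullet> v)) (at x)"
  shows "partial i f x = g $ i"
  using frechet_derivative_at[OF assms, symmetric]
  by (simp add: partial_def cart_eq_inner_axis)

lemma partial_add:
  assumes "f differentiable at x" "g differentiable at x"
  shows "partial i (\<lambda>x. f x + g x) x = partial i f x + partial i g x"
proof -
  have "((\<lambda>x. f x + g x) has_derivative
      (\<lambda>v. frechet_derivative f (at x) v + frechet_derivative g (at x) v)) (at x)"
    using assms by (intro has_derivative_add) (simp_all add: frechet_derivative_works[symmetric])
  then show ?thesis
    unfolding partial_def by (subst frechet_derivative_at[symmetric]) simp_all
qed

lemma partial_mult:
  assumes "f differentiable at x" "g differentiable at x"
  shows "partial i (\<lambda>x. f x * g x) x = f x * partial i g x + partial i f x * g x"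
proof -
  have "((\<lambda>x. f x * g x) has_derivative
      (\<lambda>v. f x * frechet_derivative g (at x) v + frechet_derivative f (at x) v * g x)) (at x)"
    using assms by (intro has_derivative_mult) (simp_all add: frechet_derivative_works[symmetric])
  then show ?thesis
    unfolding partial_def by (subst frechet_derivative_at[symmetric]) simp_all
qed

lemma Ck_Suc_imp_Ck: "Ck (Suc k) f \<Longrightarrow> Ck k f"
proof (induction k arbitrary: f)
  case 0
  then show ?case
    by (simp add: continuous_at_imp_continuous_on differentiable_imp_continuous_within)
qed simp

lemma Ck_add: "Ck k f \<Longrightarrow> Ck k g \<Longrightarrow> Ck k (\<lambda>x. f x + g x)"
proof (induction k arbitrary: f g)
  case (Suc k)
  have "partial i (\<lambda>x. f x + g x) = (\<lambda>x. partial i f x + partial i g x)" for i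
    using Suc.prems by (auto simp: fun_eq_iff partial_add)
  with Suc show ?case
    by auto
qed (auto intro: continuous_intros)

lemma Ck_const [simp]: "Ck k (\<lambda>x. c)"
proof (induction k arbitrary: c)
  case (Suc k)
  have "partial i (\<lambda>x. c) = (\<lambda>x. 0)" for i
    by (auto simp: partial_def fun_eq_iff frechet_derivative_const)
  with Suc show ?case
    by (simp add: \<open>\<And>i. partial i (\<lambda>x. c) = (\<lambda>x. 0)\<close>)
qed (auto intro: continuous_intros)

lemma Ck_mult: "Ck k f \<Longrightarrow> Ck k g \<Longrightarrow> Ck k (\<lambda>x. f x * g x)"
proof (induction k arbitrary: f g)
  case (Suc k)
  have "partial i (\<lambda>x. f x * g x) = (\<lambda>x. f x * partial i g x + partial i f x * g x)" for i
    using Suc.prems by (auto simp: fun_eq_iff partial_mult)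
  moreover have "Ck k (\<lambda>x. f x * partial i g x)" for i
    using Suc.prems by (intro Suc.IH Ck_Suc_imp_Ck[of k f]) simp_all
  moreover have "Ck k (\<lambda>x. partial i f x * g x)" for i
    using Suc.prems by (intro Suc.IH Ck_Suc_imp_Ck[of k g]) simp_all
  ultimately show ?case
    using Suc.prems by (auto intro!: Ck_add)
qed (auto intro: continuous_intros)

lemma Ck_component: "Ck k (\<lambda>x::real^'n. x $ i)"
proof (cases k)
  case (Suc k)
  have d: "((\<lambda>x. x $ i) has_derivative (\<lambda>v. axis i 1 \<bullet> v)) (at x)" for x :: "real^'n"
    by (simp add: inner_axis' bounded_linear_imp_has_derivative bounded_linear_vec_nth)
  have "partial j (\<lambda>x. x $ i) = (\<lambda>x::real^'n. axis i 1 $ j)" for j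
    using partial_eq[OF d] by auto
  then show ?thesis
    using Suc d by (auto simp: differentiable_def)
qed (auto intro: continuous_intros)

lemma Ck_minus: "Ck k f \<Longrightarrow> Ck k (\<lambda>x. - f x)"
  using Ck_mult[of k "\<lambda>_. -1" f] by simp

text \<open>The flat function exp(-1/t) extended by zero. The factors t^-m are carried along so that
  the family is closed under differentiation up to linear combinations.\<close>

definition exp_flat :: "nat \<Rightarrow> real \<Rightarrow> real" where
  "exp_flat m t = (if 0 < t then exp (- (1/t)) / t ^ m else 0)"

lemma exp_flat_pos: "0 < t \<Longrightarrow> 0 < exp_flat m t"
  and exp_flat_nonpos [simp]: "t \<le> 0 \<Longrightarrow> exp_flat m t = 0"
  and exp_flat_nonneg [simp]: "0 \<le> exp_flat m t"
  by (auto simp: exp_flat_def)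

text \<open>Away from the origin this is calculus; at the origin the right difference quotient is
  \<open>exp_flat (m + 1)\<close>, which tends to zero.\<close>

lemma exp_flat_has_derivative:
  "(exp_flat m has_real_derivative exp_flat (m + 2) t - real m * exp_flat (m + 1) t) (at t)"
proof (cases t "0::real" rule: linorder_cases)
  case less
  have "((\<lambda>_. 0) has_real_derivative 0) (at t)" by simp
  moreover have "eventually (\<lambda>s. s < 0) (nhds t)"
    using less order_tendstoD(2) tendsto_ident_at eventually_nhds_conv_at by blast
  ultimately have "(exp_flat m has_real_derivative 0) (at t)"
    by (subst DERIV_cong_ev[of t t _ "\<lambda>_. 0"]) (auto elim!: eventually_mono)
  then show ?thesis using less by simp
next
  case greater
  have "((\<lambda>t. exp (- (1/t)) / t ^ m) has_real_derivative
      exp_flat (m + 2) t - real m * exp_flat (m + 1) t) (at t)"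
    using greater
    by (auto intro!: derivative_eq_intros simp: exp_flat_def field_simps power2_eq_square)
       (cases m; cases "m - 1"; simp add: field_simps)+
  moreover have "eventually (\<lambda>s. s > 0) (nhds t)"
    using greater order_tendstoD(1) tendsto_ident_at eventually_nhds_conv_at by blast
  ultimately show ?thesis
    by (subst DERIV_cong_ev[of t t _ "\<lambda>t. exp (- (1/t)) / t ^ m"])
       (auto elim!: eventually_mono simp: exp_flat_def)
next
  case equal
  have "((\<lambda>s::real. exp (- (1/s)) / s ^ m / s) \<longlongrightarrow> 0) (at_right 0)"
    by real_asymp
  then have r: "((\<lambda>s. exp_flat m s / s) \<longlongrightarrow> 0) (at_right 0)"
    by (rule Lim_transform_eventually)
       (auto simp: exp_flat_def eventually_at_right_less eventually_at_filter)
  have "((\<lambda>s. 0::real) \<longlongrightarrow> 0) (at_left 0)" by simp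
  then have "((\<lambda>s. exp_flat m s / s) \<longlongrightarrow> 0) (at_left 0)"
    by (rule Lim_transform_eventually) (auto simp: eventually_at_filter)
  then have "((\<lambda>s. exp_flat m s / s) \<longlongrightarrow> 0) (at 0)"
    using r by (simp add: filterlim_split_at)
  then show ?thesis
    using equal by (simp add: DERIV_def)
qed

lemma continuous_on_exp_flat [continuous_intros]:
  "continuous_on S f \<Longrightarrow> continuous_on S (\<lambda>x. exp_flat m (f x))"
  by (rule continuous_on_compose2[of UNIV "exp_flat m"])
     (auto intro!: continuous_at_imp_continuous_on DERIV_isCont exp_flat_has_derivative)

text \<open>The squared distance is a polynomial, so smoothness at the centre requires no separate
  argument, in contrast to a function of the norm itself.\<close>

definition bump :: "nat \<Rightarrow> real \<Rightarrow> real^'n \<Rightarrow> real^'n \<Rightarrow> real" where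
  "bump m e c y = exp_flat m (e\<^sup>2 - (norm (y - c))\<^sup>2)"

definition bump_grad :: "nat \<Rightarrow> real \<Rightarrow> real^'n \<Rightarrow> real^'n \<Rightarrow> real^'n" where
  "bump_grad m e c y = (-2 * (bump (m + 2) e c y - real m * bump (m + 1) e c y)) *\<^sub>R (y - c)"

lemma bump_has_derivative:
  "(bump m e c has_derivative (\<lambda>v. bump_grad m e c y \<bullet> v)) (at y)"
proof -
  have "((\<lambda>y. e\<^sup>2 - (y - c) \<bullet> (y - c)) has_derivative (\<lambda>v. (-2 *\<^sub>R (y - c)) \<bullet> v)) (at y)"
    by (auto intro!: derivative_eq_intros simp: inner_commute algebra_simps)
  from exp_flat_has_derivative[of m "e\<^sup>2 - (y - c) \<bullet> (y - c)", THEN DERIV_compose_FDERIV[OF _ this]]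
  show ?thesis
    unfolding bump_def[abs_def] bump_grad_def
    by (simp add: power2_norm_eq_inner algebra_simps)
qed

lemma partial_bump:
  "partial i (bump m e c) y = -2 * (bump (m + 2) e c y - real m * bump (m + 1) e c y) * (y $ i
      - c $ i)"
  using partial_eq[OF bump_has_derivative] by (simp add: bump_grad_def)

lemma continuous_on_bump [continuous_intros]:
  "continuous_on S f \<Longrightarrow> continuous_on S g \<Longrightarrow> continuous_on S (\<lambda>x. bump m e (f x) (g x))"
  unfolding bump_def by (intro continuous_intros)

text \<open>Differentiation raises the index \<open>m\<close>, so the induction on \<open>k\<close>
  must keep \<open>m\<close> arbitrary.\<close>

lemma Ck_bump: "Ck k (bump m e c)"
proof (induction k arbitrary: m)
  case 0
  then show ?case by (auto intro!: continuous_intros)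
next
  case (Suc k)
  have eq: "partial i (bump m e c) =
    (\<lambda>y. -2 * (bump (m + 2) e c y + - (real m * bump (m + 1) e c y)) * (y $ i + - c $ i))" for i
    by (simp add: partial_bump fun_eq_iff)
  have "Ck k (partial i (bump m e c))" for i
    unfolding eq by (intro Ck_mult Ck_add Ck_minus Ck_const Suc.IH Ck_component)
  moreover have "bump m e c differentiable (at y)" for y
    using bump_has_derivative differentiable_def by blast
  ultimately show ?case
    unfolding Ck.simps by blast
qed

lemma bump_eq_0: "0 \<le> e \<Longrightarrow> e \<le> norm (y - c) \<Longrightarrow> bump m e c y = 0"
  by (simp add: bump_def)

lemma bump_nonneg [simp]: "0 \<le> bump m e c y"
  by (simp add: bump_def)

lemma bump_pos: "0 \<le> e \<Longrightarrow> norm (y - c) < e \<Longrightarrow> 0 < bump m e c y"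
  by (simp add: bump_def exp_flat_pos power_strict_mono)

text \<open>These are the test functions that turn the definition of the weak gradient into
  information about mollifications.\<close>

lemma test_function_bump:
  assumes "0 \<le> e" "cball c e \<subseteq> \<Omega>"
  shows "test_function \<Omega> (bump m e c)"
proof -
  have "{x. bump m e c x \<noteq> 0} \<subseteq> cball c e"
    using bump_eq_0[OF assms(1), of _ c m] by (force simp: dist_norm norm_minus_commute)
  then have "closure {x. bump m e c x \<noteq> 0} \<subseteq> cball c e"
    by (simp add: closure_minimal)
  then show ?thesis
    unfolding test_function_def using assms Ck_bump
    by (auto simp: compact_eq_bounded_closed intro: bounded_subset[OF bounded_cball])
qed

subsection \<open>Continuity of translations in \<open>L\<^sup>p\<close>\<close>

text \<open>A supporting line of the convex function s^p at l. For p > 1 Young's inequality supplies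
  it without differentiation, which keeps l = 0 inside the argument.\<close>

lemma tangent_powr:
  fixes s l p :: real
  assumes "1 \<le> p" "0 \<le> s" "0 \<le> l"
  shows "l powr p + p * l powr (p - 1) * (s - l) \<le> s powr p"
proof (cases "p = 1")
  case True
  then show ?thesis using assms by (cases "l = 0") auto
next
  case False
  with assms have p: "1 < p" by simp
  have "s * l powr (p - 1) \<le> s powr p / p + (l powr (p - 1)) powr (p / (p - 1)) / (p / (p - 1))"
    using p assms by (intro Youngs_inequality) (auto simp: field_simps)
  also have "(l powr (p - 1)) powr (p / (p - 1)) = l powr p"
    using p by (simp add: powr_powr)
  finally have "p * (s * l powr (p - 1)) \<le> p * (s powr p / p + l powr p / (p / (p - 1)))"
    using p by (intro mult_left_mono) auto
  also have "\<dots> = s powr p + (p - 1) * l powr p"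
    using p by (simp add: distrib_left)
  finally have "p * l powr (p - 1) * s \<le> s powr p + (p - 1) * l powr p"
    by (simp add: mult_ac)
  moreover have "l powr (p - 1) * l = l powr p"
    using assms p powr_mult_base[of l "p - 1"] by (simp add: mult.commute)
  ultimately show ?thesis
    by (simp add: algebra_simps)
qed

text \<open>The supporting line at the mean value is integrated against the density
  \<open>k\<close>. The right-hand side is an extended real because integrability of the p-th power
  is not assumed.\<close>

lemma jensen_powr:
  fixes k g :: "'a \<Rightarrow> real"
  assumes p: "1 \<le> p" and k: "integrable M k" "\<And>x. 0 \<le> k x" "(\<integral>x. k x \<partial>M) = 1"
    and g: "g \<in> borel_measurable M" "\<And>x. 0 \<le> g x" "integrable M (\<lambda>x. k x * g x)"
  shows "ennreal ((\<integral>x. k x * g x \<partial>M) powr p) \<le> (\<integral>\<^sup>+x. ennreal (k x * g x powr p) \<partial>M)"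
proof (cases "integrable M (\<lambda>x. k x * g x powr p)")
  case True
  define l where "l = (\<integral>x. k x * g x \<partial>M)"
  have l: "0 \<le> l"
    unfolding l_def using k g by (intro integral_nonneg_AE) auto
  have "l powr p = (\<integral>x. l powr p * k x + p * l powr (p - 1) * (k x * g x - l * k x) \<partial>M)"
    using k g by (simp add: l_def)
  also have "\<dots> \<le> (\<integral>x. k x * g x powr p \<partial>M)"
  proof (rule integral_mono)
    fix x
    show "l powr p * k x + p * l powr (p - 1) * (k x * g x - l * k x) \<le> k x * g x powr p"
      using mult_left_mono[OF tangent_powr[OF p g(2)[of x] l] k(2)[of x]]
      by (simp add: algebra_simps)
  qed (use True k g in auto)
  finally show ?thesis
    unfolding l_def[symmetric]
    using nn_integral_eq_integral[OF True] k(2) by (simp add: ennreal_leI)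
next
  case False
  have "(\<integral>\<^sup>+x. ennreal (k x * g x powr p) \<partial>M) = \<infinity>"
    using False g(1) borel_measurable_integrable[OF k(1)] k(2)
    by (auto simp: integrable_iff_bounded less_top[symmetric])
  then show ?thesis by simp
qed

lemma nn_integral_translation:
  fixes f :: "'a::euclidean_space \<Rightarrow> ennreal"
  assumes "f \<in> borel_measurable borel"
  shows "(\<integral>\<^sup>+x. f (x + h) \<partial>lborel) = (\<integral>\<^sup>+x. f x \<partial>lborel)"
proof -
  have "(\<integral>\<^sup>+x. f x \<partial>lborel) = (\<integral>\<^sup>+x. f x \<partial>distr lborel borel ((+) h))"
    by (simp add: lborel_distr_plus)
  also have "\<dots> = (\<integral>\<^sup>+x. f (x + h) \<partial>lborel)"
    using assms by (subst nn_integral_distr) (auto simp: add.commute)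
  finally show ?thesis by simp
qed

lemma integrable_translation_iff:
  fixes f :: "'a::euclidean_space \<Rightarrow> 'b::euclidean_space"
  assumes "f \<in> borel_measurable borel"
  shows "integrable lborel (\<lambda>x. f (h + x)) \<longleftrightarrow> integrable lborel f"
  using assms by (subst (2) lborel_distr_plus[of h, symmetric], subst integrable_distr_eq) auto

lemma integral_translation:
  fixes f :: "'a::euclidean_space \<Rightarrow> 'b::euclidean_space"
  assumes "f \<in> borel_measurable borel"
  shows "(\<integral>x. f (h + x) \<partial>lborel) = (\<integral>x. f x \<partial>lborel)"
  using assms by (subst (2) lborel_distr_plus[of h, symmetric], subst integral_distr) auto

definition translation_L1_continuous :: "('a::euclidean_space \<Rightarrow> 'b::euclidean_space) \<Rightarrow> bool" where
  "translation_L1_continuous f \<longleftrightarrow> (\<forall>\<eta>>0. \<exists>d>0. \<forall>h. norm h < d \<longrightarrow>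
     (\<integral>\<^sup>+x. ennreal (norm (f (x + h) - f x)) \<partial>lborel) \<le> ennreal \<eta>)"

lemma translation_L1_continuousE:
  assumes "translation_L1_continuous f" "0 < \<eta>"
  obtains d where "0 < d"
    "\<And>h. norm h < d \<Longrightarrow> (\<integral>\<^sup>+x. ennreal (norm (f (x + h) - f x)) \<partial>lborel) \<le> ennreal \<eta>"
  using assms unfolding translation_L1_continuous_def by blast

lemma translation_L1_continuous_indicator:
  fixes A :: "'a::euclidean_space set" and c :: "'b::euclidean_space"
  assumes A: "A \<in> sets borel" "bounded A"
  shows "translation_L1_continuous (\<lambda>x. indicator A x *\<^sub>R c)"
  unfolding translation_L1_continuous_def
proof (intro allI impI)
  fix \<eta> :: real assume \<eta>: "0 < \<eta>"
  define e where "e = \<eta> / (4 * (norm c + 1))"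
  have e: "0 < e" using \<eta> by (auto simp: e_def intro!: divide_pos_pos add_nonneg_pos)
  have Al: "A \<in> sets lebesgue" using A by simp
  obtain U where U: "open U" "A \<subseteq> U" "emeasure lebesgue (U - A) < ennreal e"
    using sets_lebesgue_outer_open[OF Al e] .
  obtain K where K: "closed K" "K \<subseteq> A" "emeasure lebesgue (A - K) < ennreal e"
    using sets_lebesgue_inner_closed[OF Al e] .
  have cK: "compact K"
    using K A bounded_subset compact_eq_bounded_closed by blast
  have "closed (- U)" "K \<inter> - U = {}" using U K by auto
  then obtain d where d: "0 < d" "\<And>x y. x \<in> K \<Longrightarrow> y \<in> - U \<Longrightarrow> d \<le> dist x y"
    using separate_compact_closed[OF cK, of "- U"] by blast
  have UK: "U - K \<in> sets borel" using U K by (simp add: borel_closed borel_open sets.Diff)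
  have "emeasure lborel (U - K) = emeasure lebesgue ((U - A) \<union> (A - K))"
  proof -
    have "U - K = (U - A) \<union> (A - K)" using U(2) K(2) by auto
    have "emeasure lebesgue (U - K) = emeasure lborel (U - K)" using UK by simp
    with \<open>U - K = _\<close> show ?thesis by simp
  qed
  also have "\<dots> \<le> emeasure lebesgue (U - A) + emeasure lebesgue (A - K)"
    using U K A by (intro emeasure_subadditive) auto
  also have "\<dots> \<le> ennreal e + ennreal e"
    using U K by (intro add_mono) auto
  finally have m: "emeasure lborel (U - K) \<le> ennreal (2 * e)"
    using e by (simp flip: ennreal_plus)
  show "\<exists>d>0. \<forall>h. norm h < d \<longrightarrow>
     (\<integral>\<^sup>+x. ennreal (norm (indicator A (x + h) *\<^sub>R c - indicator A x *\<^sub>R c)) \<partial>lborel) \<le> ennreal \<eta>"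
  proof (intro exI[of _ d] conjI allI impI d(1))
    fix h :: 'a assume h: "norm h < d"
    \<comment> \<open>The distance \<open>d\<close> separates \<open>K\<close> from the complement
      of \<open>U\<close>, so a shift by \<open>h\<close> moves points of \<open>K\<close> into
      \<open>U\<close>. Hence if membership in \<open>A\<close> differs at x and x + h, at least one
      of these points lies in \<open>U - K\<close>.\<close>
    have pt: "norm (indicator A (x + h) *\<^sub>R c - indicator A x *\<^sub>R c)
        \<le> norm c * (indicator (U - K) (x + h) + indicator (U - K) x)" for x
    proof -
      have "x \<in> K \<Longrightarrow> x + h \<in> U" "x + h \<in> K \<Longrightarrow> x \<in> U"
        using d(2)[of x "x + h"] d(2)[of "x + h" x] h by (auto simp: dist_norm)
      then show ?thesis
        using U(2) K(2) by (auto simp: indicator_def)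
    qed
    have "(\<integral>\<^sup>+x. ennreal (norm (indicator A (x + h) *\<^sub>R c - indicator A x *\<^sub>R c)) \<partial>lborel)
        \<le> (\<integral>\<^sup>+x. ennreal (norm c) * (indicator (U - K) (x + h) + indicator (U - K) x) \<partial>lborel)"
    proof (rule nn_integral_mono)
      fix x
      show "ennreal (norm (indicator A (x + h) *\<^sub>R c - indicator A x *\<^sub>R c))
          \<le> ennreal (norm c) * (indicator (U - K) (x + h) + indicator (U - K) x)"
        using ennreal_leI[OF pt[of x]]
        by (simp add: ennreal_mult ennreal_plus ennreal_indicator)
    qed
    also have "\<dots> = ennreal (norm c) * ((\<integral>\<^sup>+x. indicator (U - K) (x + h) \<partial>lborel)
        + (\<integral>\<^sup>+x. indicator (U - K) x \<partial>lborel))"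
      using UK by (simp add: nn_integral_cmult nn_integral_add del: nn_integral_indicator)
    also have "\<dots> = ennreal (norm c) * (emeasure lborel (U - K) + emeasure lborel (U - K))"
      using UK by (subst nn_integral_translation) (auto simp: nn_integral_indicator)
    also have "\<dots> \<le> ennreal (norm c) * (ennreal (2 * e) + ennreal (2 * e))"
      using m by (intro mult_left_mono add_mono) auto
    also have "\<dots> = ennreal (norm c * (4 * e))"
    proof -
      have "ennreal (2 * e) + ennreal (2 * e) = ennreal (4 * e)"
        using e by (subst ennreal_plus[symmetric]) auto
      then show ?thesis using e by (simp add: ennreal_mult)
    qed
    also have "norm c * (4 * e) \<le> (norm c + 1) * (4 * e)"
      using e by (intro mult_right_mono) auto
    also have "\<dots> = \<eta>"
    proof -
      have "norm c + 1 \<noteq> 0"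
        using norm_ge_zero[of c] by linarith
      then show ?thesis
        unfolding e_def by (simp add: divide_simps del: distrib_left_numeral distrib_right_numeral)
    qed
    finally show "(\<integral>\<^sup>+x. ennreal (norm (indicator A (x + h) *\<^sub>R c - indicator A x *\<^sub>R c)) \<partial>lborel)
        \<le> ennreal \<eta>"
      by (simp add: ennreal_leI)
  qed
qed

lemma translation_L1_continuous_add:
  fixes f g :: "'a::euclidean_space \<Rightarrow> 'b::euclidean_space"
  assumes "f \<in> borel_measurable borel" "g \<in> borel_measurable borel"
    "translation_L1_continuous f" "translation_L1_continuous g"
  shows "translation_L1_continuous (\<lambda>x. f x + g x)"
  unfolding translation_L1_continuous_def
proof (intro allI impI)
  note [measurable] = assms(1,2)
  fix \<eta> :: real assume \<eta>: "0 < \<eta>"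
  then have "0 < \<eta> / 2" by simp
  obtain d1 where d1: "0 < d1"
    "\<And>h. norm h < d1 \<Longrightarrow> (\<integral>\<^sup>+x. ennreal (norm (f (x + h) - f x)) \<partial>lborel) \<le> ennreal (\<eta> / 2)"
    using translation_L1_continuousE[OF assms(3) \<open>0 < \<eta> / 2\<close>] by blast
  obtain d2 where d2: "0 < d2"
    "\<And>h. norm h < d2 \<Longrightarrow> (\<integral>\<^sup>+x. ennreal (norm (g (x + h) - g x)) \<partial>lborel) \<le> ennreal (\<eta> / 2)"
    using translation_L1_continuousE[OF assms(4) \<open>0 < \<eta> / 2\<close>] by blast
  show "\<exists>d>0. \<forall>h. norm h < d \<longrightarrow>
     (\<integral>\<^sup>+x. ennreal (norm (f (x + h) + g (x + h) - (f x + g x))) \<partial>lborel) \<le> ennreal \<eta>"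
  proof (intro exI[of _ "min d1 d2"] conjI allI impI)
    fix h :: 'a assume h: "norm h < min d1 d2"
    have "(\<integral>\<^sup>+x. ennreal (norm (f (x + h) + g (x + h) - (f x + g x))) \<partial>lborel)
      \<le> (\<integral>\<^sup>+x. ennreal (norm (f (x + h) - f x)) + ennreal (norm (g (x + h) - g x)) \<partial>lborel)"
      by (intro nn_integral_mono)
         (simp add: norm_diff_triangle_ineq flip: ennreal_plus)
    also have "\<dots> = (\<integral>\<^sup>+x. ennreal (norm (f (x + h) - f x)) \<partial>lborel)
        + (\<integral>\<^sup>+x. ennreal (norm (g (x + h) - g x)) \<partial>lborel)"
      by (intro nn_integral_add) measurable
    also have "\<dots> \<le> ennreal (\<eta> / 2) + ennreal (\<eta> / 2)"
      using d1 d2 h by (intro add_mono) auto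
    finally show "(\<integral>\<^sup>+x. ennreal (norm (f (x + h) + g (x + h) - (f x + g x))) \<partial>lborel) \<le> ennreal \<eta>"
      using \<eta> by (simp flip: ennreal_plus)
  qed (use d1 d2 in auto)
qed

text \<open>Closedness under L^1 limits: by translation invariance the shifted error has the same
  norm as the error itself.\<close>

lemma translation_L1_continuous_approx:
  fixes f :: "'a::euclidean_space \<Rightarrow> 'b::euclidean_space"
  assumes [measurable]: "f \<in> borel_measurable borel"
    and ap: "\<And>\<eta>. 0 < \<eta> \<Longrightarrow> \<exists>g\<in>borel_measurable borel. translation_L1_continuous g \<and>
          (\<integral>\<^sup>+x. ennreal (norm (f x - g x)) \<partial>lborel) \<le> ennreal \<eta>"
  shows "translation_L1_continuous f"
  unfolding translation_L1_continuous_def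
proof (intro allI impI)
  fix \<eta> :: real assume \<eta>: "0 < \<eta>"
  then have "0 < \<eta> / 3" by simp
  from ap[OF this] obtain g where [measurable]: "g \<in> borel_measurable borel"
    and g: "translation_L1_continuous g" "(\<integral>\<^sup>+x. ennreal (norm (f x - g x)) \<partial>lborel)
        \<le> ennreal (\<eta> / 3)"
    by auto
  obtain d where d: "0 < d"
    "\<And>h. norm h < d \<Longrightarrow> (\<integral>\<^sup>+x. ennreal (norm (g (x + h) - g x)) \<partial>lborel) \<le> ennreal (\<eta> / 3)"
    using translation_L1_continuousE[OF g(1) \<open>0 < \<eta> / 3\<close>] by blast
  show "\<exists>d>0. \<forall>h. norm h < d \<longrightarrow> (\<integral>\<^sup>+x. ennreal (norm (f (x + h) - f x)) \<partial>lborel) \<le> ennreal \<eta>"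
  proof (intro exI[of _ d] conjI allI impI d(1))
    fix h :: 'a assume h: "norm h < d"
    have tri: "norm (f (x + h) - f x)
      \<le> norm (f (x + h) - g (x + h)) + norm (g (x + h) - g x) + norm (f x - g x)" for x
      by norm
    have "(\<integral>\<^sup>+x. ennreal (norm (f (x + h) - f x)) \<partial>lborel)
      \<le> (\<integral>\<^sup>+x. ennreal (norm (f (x + h) - g (x + h))) + ennreal (norm (g (x + h) - g x))
          + ennreal (norm (f x - g x)) \<partial>lborel)"
      using tri by (intro nn_integral_mono) (simp flip: ennreal_plus)
    also have "\<dots> = (\<integral>\<^sup>+x. ennreal (norm (f (x + h) - g (x + h))) \<partial>lborel)
        + (\<integral>\<^sup>+x. ennreal (norm (g (x + h) - g x)) \<partial>lborel)
        + (\<integral>\<^sup>+x. ennreal (norm (f x - g x)) \<partial>lborel)"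
      by (simp add: nn_integral_add)
    also have "(\<integral>\<^sup>+x. ennreal (norm (f (x + h) - g (x + h))) \<partial>lborel)
        = (\<integral>\<^sup>+x. ennreal (norm (f x - g x)) \<partial>lborel)"
      by (intro nn_integral_translation) measurable
    also have "(\<integral>\<^sup>+x. ennreal (norm (f x - g x)) \<partial>lborel)
        + (\<integral>\<^sup>+x. ennreal (norm (g (x + h) - g x)) \<partial>lborel)
        + (\<integral>\<^sup>+x. ennreal (norm (f x - g x)) \<partial>lborel)
            \<le> ennreal (\<eta>/3) + ennreal (\<eta>/3) + ennreal (\<eta>/3)"
      using d h g by (intro add_mono) auto
    finally show "(\<integral>\<^sup>+x. ennreal (norm (f (x + h) - f x)) \<partial>lborel) \<le> ennreal \<eta>"
      using \<eta> by (simp flip: ennreal_plus)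
  qed
qed

text \<open>Induction over integrable functions starts from sets of finite measure, possibly
  unbounded, while the compact inner approximation used for indicators requires boundedness. Cutting
  off by a ball throughout reconciles the two.\<close>

lemma translation_L1_continuous_cutoff:
  fixes f :: "'a::euclidean_space \<Rightarrow> 'b::euclidean_space"
  assumes "integrable lborel f"
  shows "translation_L1_continuous (\<lambda>x. indicator (ball 0 R) x *\<^sub>R f x)"
  using assms
proof (induction rule: integrable_induct)
  case (base A c)
  have "translation_L1_continuous (\<lambda>x. indicator (A \<inter> ball 0 R) x *\<^sub>R c)"
    using base bounded_ball bounded_subset
    by (intro translation_L1_continuous_indicator) (auto intro: bounded_subset[OF bounded_ball])
  then show ?case
    by (simp add: indicator_inter_arith mult.commute)
next
  case (add f g)
  then have "f \<in> borel_measurable borel" "g \<in> borel_measurable borel"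
    by (auto dest: borel_measurable_integrable)
  then show ?case
    unfolding scaleR_add_right by (intro translation_L1_continuous_add add(3,4))
      (auto intro!: borel_measurable_scaleR borel_measurable_indicator)
next
  case (lim f s)
  then have fm: "f \<in> borel_measurable borel" and [measurable]: "f \<in> borel_measurable borel"
      "\<And>i. s i \<in> borel_measurable borel"
    and sm: "s i \<in> borel_measurable borel" for i
    by (auto dest: borel_measurable_integrable)
  have "integrable lborel (\<lambda>x. 2 * norm (f x))"
    using lim by simp
  then have "(\<integral>\<^sup>+x. ennreal (2 * norm (f x)) \<partial>lborel) < \<infinity>"
    by (subst nn_integral_eq_integral) auto
  then have conv: "(\<lambda>i. \<integral>\<^sup>+x. ennreal (norm (f x - s i x)) \<partial>lborel) \<longlonglongrightarrow> 0"
    using lim by (intro nn_integral_dominated_convergence_norm[where w = "\<lambda>x. 2 * norm (f x)"]) auto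
  show ?case
  proof (rule translation_L1_continuous_approx)
    fix \<eta> :: real assume "0 < \<eta>"
    then have "\<forall>\<^sub>F i in sequentially. (\<integral>\<^sup>+x. ennreal (norm (f x - s i x)) \<partial>lborel) < ennreal \<eta>"
      by (intro order_tendstoD(2)[OF conv]) auto
    then obtain i where i: "(\<integral>\<^sup>+x. ennreal (norm (f x - s i x)) \<partial>lborel) < ennreal \<eta>"
      using eventually_happens'[OF sequentially_bot] by blast
    have "(\<integral>\<^sup>+x. ennreal (norm (indicator (ball 0 R) x *\<^sub>R f x
        - indicator (ball 0 R) x *\<^sub>R s i x)) \<partial>lborel)
      \<le> (\<integral>\<^sup>+x. ennreal (norm (f x - s i x)) \<partial>lborel)"
      by (intro nn_integral_mono) (auto simp: indicator_def)
    with i sm[of i] lim.IH[of i] show "\<exists>g\<in>borel_measurable borel. translation_L1_continuous g \<and>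
        (\<integral>\<^sup>+x. ennreal (norm (indicator (ball 0 R) x *\<^sub>R f x - g x)) \<partial>lborel) \<le> ennreal \<eta>"
      by (intro bexI[of _ "\<lambda>x. indicator (ball 0 R) x *\<^sub>R s i x"])
        (auto intro!: borel_measurable_scaleR borel_measurable_indicator)
  qed (use fm in \<open>auto intro!: borel_measurable_scaleR borel_measurable_indicator\<close>)
qed

lemma powr_add3_le:
  fixes a b c p :: real
  assumes "0 \<le> a" "0 \<le> b" "0 \<le> c" "0 \<le> p"
  shows "(a + b + c) powr p \<le> 3 powr p * (a powr p + b powr p + c powr p)"
proof -
  let ?m = "max a (max b c)"
  have "(a + b + c) powr p \<le> (3 * ?m) powr p"
    using assms by (intro powr_mono2) auto
  also have "\<dots> = 3 powr p * ?m powr p"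
    using assms by (simp add: powr_mult)
  also have "?m powr p \<le> a powr p + b powr p + c powr p"
    by (simp add: max_def)
  finally show ?thesis by (simp add: mult_left_mono)
qed

text \<open>Reduction to p = 1: \<open>f\<close> is replaced by 0 where its norm exceeds m, with
  small error in L^p by dominated convergence. For the remaining bounded part, the p-th power of an
  increment is at most (2m)^(p-1) times the increment.\<close>

lemma translation_Lp_continuous:
  fixes f :: "'a::euclidean_space \<Rightarrow> 'b::euclidean_space"
  assumes [measurable]: "f \<in> borel_measurable borel"
    and p: "1 \<le> p" and int: "integrable lborel (\<lambda>x. norm (f x) powr p)"
    and supp: "\<And>x. x \<notin> ball 0 R \<Longrightarrow> f x = 0" and \<eta>: "0 < \<eta>"
  shows "\<exists>d>0. \<forall>h. norm h < d \<longrightarrow>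
     (\<integral>\<^sup>+x. ennreal (norm (f (x + h) - f x) powr p) \<partial>lborel) \<le> ennreal \<eta>"
proof -
  define g where "g m x = (if norm (f x) \<le> real m then f x else 0)" for m x
  have g_meas[measurable]: "g m \<in> borel_measurable borel" for m
    unfolding g_def by measurable
  define e where "e = \<eta> / (3 * 3 powr p)"
  have e: "0 < e" using \<eta> by (simp add: e_def)
  have conv: "(\<lambda>m. \<integral>x. norm (f x - g m x) powr p \<partial>lborel) \<longlonglongrightarrow> (\<integral>x. 0 \<partial>(lborel :: 'a measure))"
  proof (rule integral_dominated_convergence[OF _ _ int])
    show "AE x in lborel. (\<lambda>m. norm (f x - g m x) powr p) \<longlonglongrightarrow> 0"
    proof (rule AE_I2)
      fix x
      obtain m0 where "norm (f x) \<le> real m0" using real_arch_simple by blast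
      then have "\<forall>\<^sub>F m in sequentially. norm (f x - g m x) powr p = 0"
        unfolding eventually_sequentially by (intro exI[of _ m0]) (auto simp: g_def)
      then show "(\<lambda>m. norm (f x - g m x) powr p) \<longlonglongrightarrow> 0"
        by (rule tendsto_eventually)
    qed
  qed (auto simp: g_def)
  then have "\<forall>\<^sub>F m in sequentially. (\<integral>x. norm (f x - g m x) powr p \<partial>lborel) < e"
    using e by (intro order_tendstoD(2)) auto
  then obtain m where m: "(\<integral>x. norm (f x - g m x) powr p \<partial>lborel) < e"
    using eventually_happens'[OF sequentially_bot] by blast
  have intr: "integrable lborel (\<lambda>x. norm (f x - g m x) powr p)"
    using int by (rule Bochner_Integration.integrable_bound) (auto simp: g_def)
  have r: "(\<integral>\<^sup>+x. ennreal (norm (f x - g m x) powr p) \<partial>lborel) \<le> ennreal e"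
    using m by (subst nn_integral_eq_integral[OF intr]) (auto intro: ennreal_leI)
  have "integrable lborel (\<lambda>x. indicator (ball 0 R) x *\<^sub>R real m)"
    by (intro integrable_scaleR_left integrable_real_indicator) (auto
        simp: emeasure_lborel_ball_finite[unfolded infinity_ennreal_def])
  then have "integrable lborel (g m)"
    by (rule Bochner_Integration.integrable_bound) (use supp in \<open>auto simp: g_def indicator_def\<close>)
  then have "translation_L1_continuous (\<lambda>x. indicator (ball 0 R) x *\<^sub>R g m x)"
    by (rule translation_L1_continuous_cutoff)
  moreover have "(\<lambda>x. indicator (ball 0 R) x *\<^sub>R g m x) = g m"
    using supp by (auto simp: g_def indicator_def fun_eq_iff)
  ultimately have tg: "translation_L1_continuous (g m)" by simp
  \<comment> \<open>The summand 1 keeps \<open>B\<close> positive even for m = 0, so that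
    \<open>e / B\<close> is an admissible accuracy.\<close>
  define B where "B = (2 * real m) powr (p - 1) + 1"
  have B: "0 < B" by (simp add: B_def add_nonneg_pos)
  have "0 < e / B" using e B by simp
  obtain d where d: "0 < d"
    "\<And>h. norm h < d \<Longrightarrow> (\<integral>\<^sup>+x. ennreal (norm (g m (x + h) - g m x)) \<partial>lborel) \<le> ennreal (e / B)"
    using translation_L1_continuousE[OF tg \<open>0 < e / B\<close>] by blast
  show ?thesis
  proof (intro exI[of _ d] conjI allI impI d(1))
    fix h :: 'a assume h: "norm h < d"
    have gp: "norm (g m (x + h) - g m x) powr p \<le> B * norm (g m (x + h) - g m x)" for x
    proof -
      have "norm (g m (x + h) - g m x) \<le> norm (g m (x + h)) + norm (g m x)"
        by (rule norm_triangle_ineq4)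
      also have "\<dots> \<le> 2 * real m" by (auto simp: g_def)
      finally have "norm (g m (x + h) - g m x) powr (p - 1) \<le> B"
        using p by (auto simp: B_def intro!: add_increasing2 powr_mono2)
      then have "norm (g m (x + h) - g m x) * norm (g m (x + h) - g m x) powr (p - 1)
          \<le> norm (g m (x + h) - g m x) * B"
        by (rule mult_left_mono) simp
      then show ?thesis
        by (simp add: powr_mult_base mult.commute)
    qed
    have pt: "norm (f (x + h) - f x) powr p \<le> 3 powr p * (norm (f (x + h) - g m (x + h)) powr p
        + B * norm (g m (x + h) - g m x) + norm (f x - g m x) powr p)" for x
    proof -
      have "norm (f (x + h) - f x) \<le> norm (f (x + h) - g m (x + h)) + norm (g m (x + h) - g m x)
          + norm (f x - g m x)"
        by norm
      then have "norm (f (x + h) - f x) powr p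
        \<le> (norm (f (x + h) - g m (x + h)) + norm (g m (x + h) - g m x) + norm (f x - g m x)) powr p"
        using p by (intro powr_mono2) auto
      also have "\<dots> \<le> 3 powr p * (norm (f (x + h) - g m (x + h)) powr p
          + norm (g m (x + h) - g m x) powr p + norm (f x - g m x) powr p)"
        using p by (intro powr_add3_le) auto
      also have "\<dots> \<le> 3 powr p * (norm (f (x + h) - g m (x + h)) powr p
        + B * norm (g m (x + h) - g m x) + norm (f x - g m x) powr p)"
        using gp by (intro mult_left_mono add_mono) auto
      finally show ?thesis .
    qed
    have "(\<integral>\<^sup>+x. ennreal (norm (f (x + h) - f x) powr p) \<partial>lborel)
      \<le> (\<integral>\<^sup>+x. ennreal (3 powr p) * (ennreal (norm (f (x + h) - g m (x + h)) powr p)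
        + ennreal B * ennreal (norm (g m (x + h) - g m x)) + ennreal (norm (f x
            - g m x) powr p)) \<partial>lborel)"
      using pt B by (intro nn_integral_mono) (simp add: ennreal_leI flip: ennreal_plus ennreal_mult)
    also have "\<dots> = ennreal (3 powr p) * ((\<integral>\<^sup>+x. ennreal (norm (f (x + h) - g m (x
        + h)) powr p) \<partial>lborel)
        + ennreal B * (\<integral>\<^sup>+x. ennreal (norm (g m (x + h) - g m x)) \<partial>lborel)
        + (\<integral>\<^sup>+x. ennreal (norm (f x - g m x) powr p) \<partial>lborel))"
      by (simp add: nn_integral_cmult nn_integral_add)
    also have "(\<integral>\<^sup>+x. ennreal (norm (f (x + h) - g m (x + h)) powr p) \<partial>lborel)
        = (\<integral>\<^sup>+x. ennreal (norm (f x - g m x) powr p) \<partial>lborel)"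
      by (intro nn_integral_translation) measurable
    also have "ennreal (3 powr p) * ((\<integral>\<^sup>+x. ennreal (norm (f x - g m x) powr p) \<partial>lborel)
        + ennreal B * (\<integral>\<^sup>+x. ennreal (norm (g m (x + h) - g m x)) \<partial>lborel)
        + (\<integral>\<^sup>+x. ennreal (norm (f x - g m x) powr p) \<partial>lborel))
      \<le> ennreal (3 powr p) * (ennreal e + ennreal B * ennreal (e / B) + ennreal e)"
      using d h r by (intro mult_left_mono add_mono) auto
    also have "\<dots> = ennreal (3 powr p * (e + e + e))"
      using e B by (simp flip: ennreal_plus ennreal_mult)
    also have "3 powr p * (e + e + e) = \<eta>"
      by (simp add: e_def)
    finally show "(\<integral>\<^sup>+x. ennreal (norm (f (x + h) - f x) powr p) \<partial>lborel) \<le> ennreal \<eta>" .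
  qed
qed

subsection \<open>Continuously differentiable functions of compact support\<close>

lemma C1_increment_bound:
  fixes f :: "'a::euclidean_space \<Rightarrow> real"
  assumes d: "\<And>x. (f has_derivative (\<lambda>v. g x \<bullet> v)) (at x)" and c: "continuous_on UNIV g"
  shows "ennreal \<bar>f (x + h) - f x\<bar> \<le> (\<integral>\<^sup>+s. ennreal (indicator {0..1} s * (norm h * norm (g (x
      + s *\<^sub>R h)))) \<partial>lborel)"
proof -
  define F where "F s = f (x + s *\<^sub>R h)" for s
  have cg: "continuous_on S (\<lambda>s. g (x + s *\<^sub>R h) \<bullet> h)" for S
    by (intro continuous_intros continuous_on_compose2[OF c]) auto
  have F: "(F has_vector_derivative (g (x + s *\<^sub>R h) \<bullet> h)) (at s within {0..1})" for s
  proof -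
    have "((\<lambda>s. x + s *\<^sub>R h) has_derivative (\<lambda>t. t *\<^sub>R h)) (at s within {0..1})"
      by (auto intro!: derivative_eq_intros)
    from has_derivative_compose[OF this d] show ?thesis
      by (simp add: F_def[abs_def] has_vector_derivative_def mult.commute)
  qed
  have "(\<integral>s. indicator {0..1} s *\<^sub>R (g (x + s *\<^sub>R h) \<bullet> h) \<partial>lborel) = F 1 - F 0"
    using integral_FTC_Icc[of 0 1 F, OF _ F cg] by simp
  moreover have int: "integrable lborel (\<lambda>s. indicator {0..1} s *\<^sub>R (g (x + s *\<^sub>R h) \<bullet> h))"
    by (intro borel_integrable_compact cg) simp
  ultimately have "ennreal \<bar>f (x + h) - f x\<bar>
      \<le> (\<integral>\<^sup>+s. ennreal (norm (indicator {0..1} s *\<^sub>R (g (x + s *\<^sub>R h) \<bullet> h))) \<partial>lborel)"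
    using integral_norm_bound_ennreal[OF int] by (simp add: F_def)
  also have "\<dots> \<le> (\<integral>\<^sup>+s. ennreal (indicator {0..1} s * (norm h * norm (g (x + s *\<^sub>R h)))) \<partial>lborel)"
    using Cauchy_Schwarz_ineq2[of _ h]
    by (intro nn_integral_mono ennreal_leI) (simp add: indicator_def mult.commute[of "norm h"])
  finally show ?thesis .
qed

text \<open>The increment is written as an integral along the segment; after exchanging the
  integrals, translation invariance removes the dependence on the position s on the segment.\<close>

lemma nn_integral_increment_le:
  fixes f :: "'a::euclidean_space \<Rightarrow> real"
  assumes d: "\<And>x. (f has_derivative (\<lambda>v. g x \<bullet> v)) (at x)" and c: "continuous_on UNIV g"
  shows "(\<integral>\<^sup>+x. ennreal \<bar>f (x + h) - f x\<bar> \<partial>lborel)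
      \<le> ennreal (norm h) * (\<integral>\<^sup>+x. ennreal (norm (g x)) \<partial>lborel)"
proof -
  have [measurable]: "g \<in> borel_measurable borel" using c by (rule borel_measurable_continuous_onI)
  have "(\<integral>\<^sup>+x. ennreal \<bar>f (x + h) - f x\<bar> \<partial>lborel)
    \<le> (\<integral>\<^sup>+x. (\<integral>\<^sup>+s. ennreal (indicator {0..1} s * (norm h * norm (g (x
        + s *\<^sub>R h)))) \<partial>lborel) \<partial>lborel)"
    by (intro nn_integral_mono C1_increment_bound[OF d c])
  also have "\<dots> = (\<integral>\<^sup>+s. (\<integral>\<^sup>+x. ennreal (indicator {0..1} s * (norm h * norm (g (x
      + s *\<^sub>R h)))) \<partial>lborel) \<partial>lborel)"
    by (intro lborel_pair.Fubini'[symmetric]) measurable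
  also have "\<dots> = (\<integral>\<^sup>+(s::real). indicator {0..1} s * (ennreal (norm h)
      * (\<integral>\<^sup>+x. ennreal (norm (g x)) \<partial>lborel)) \<partial>lborel)"
  proof (rule nn_integral_cong)
    fix s :: real
    have "(\<integral>\<^sup>+x. ennreal (norm (g (x + s *\<^sub>R h))) \<partial>lborel) = (\<integral>\<^sup>+x. ennreal (norm (g x)) \<partial>lborel)"
      by (intro nn_integral_translation) measurable
    then show "(\<integral>\<^sup>+x. ennreal (indicator {0..1} s * (norm h * norm (g (x + s *\<^sub>R h)))) \<partial>lborel)
        = indicator {0..1} s * (ennreal (norm h) * (\<integral>\<^sup>+x. ennreal (norm (g x)) \<partial>lborel))"
      by (simp add: ennreal_mult nn_integral_cmult ennreal_indicator)
  qed
  also have "\<dots> = (\<integral>\<^sup>+s. indicator {0..1::real} s \<partial>lborel) * (ennreal (norm h)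
      * (\<integral>\<^sup>+x. ennreal (norm (g x)) \<partial>lborel))"
    by (intro nn_integral_multc) measurable
  also have "\<dots> = ennreal (norm h) * (\<integral>\<^sup>+x. ennreal (norm (g x)) \<partial>lborel)"
    by (simp add: nn_integral_indicator)
  finally show ?thesis .
qed

text \<open>Every ball of twice the volume of the support of \<open>f\<close> meets the complement of the support in
  at least half of its volume, so \<open>\<bar>f x\<bar>\<close> is dominated by the mean of \<open>\<bar>f (x + h) - f x\<bar>\<close>
  over the \<open>h\<close> in such a ball.\<close>

lemma faber_krahn_L1:
  fixes f :: "'a::euclidean_space \<Rightarrow> real"
  assumes d: "\<And>x. (f has_derivative (\<lambda>v. g x \<bullet> v)) (at x)" and c: "continuous_on UNIV g"
    and A: "A \<in> sets borel" "emeasure lborel A = ennreal m" "0 < m" and supp: "\<And>x. x \<notin> A \<Longrightarrow> f x = 0"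
    and r: "0 < r" "emeasure lborel (ball (0::'a) r) = ennreal (2 * m)"
  shows "(\<integral>\<^sup>+x. ennreal \<bar>f x\<bar> \<partial>lborel) \<le> ennreal (2 * r) * (\<integral>\<^sup>+x. ennreal (norm (g x)) \<partial>lborel)"
proof -
  have cf: "continuous_on UNIV f"
    using d has_derivative_continuous by (intro continuous_at_imp_continuous_on) blast
  have [measurable]: "f \<in> borel_measurable borel" using cf by (rule borel_measurable_continuous_onI)
  note [measurable] = A(1)
  have [measurable]: "ball (0::'a) r \<in> sets borel" by simp
  let ?I = "\<integral>\<^sup>+x. ennreal (norm (g x)) \<partial>lborel"
  have "ennreal m * (\<integral>\<^sup>+x. ennreal \<bar>f x\<bar> \<partial>lborel) = (\<integral>\<^sup>+x. ennreal m * ennreal \<bar>f x\<bar> \<partial>lborel)"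
    by (simp add: nn_integral_cmult)
  also have "\<dots> \<le> (\<integral>\<^sup>+x. (\<integral>\<^sup>+h. indicator (ball 0 r) h * ennreal \<bar>f (x + h) - f x\<bar> \<partial>lborel) \<partial>lborel)"
  proof (rule nn_integral_mono)
    fix x
    define B where "B = {h. x + h \<in> A}"
    define H where "H = ball 0 r - B"
    have B[measurable]: "B \<in> sets borel" unfolding B_def by measurable
    have H[measurable]: "H \<in> sets borel" unfolding H_def by simp
    have "emeasure lborel B = (\<integral>\<^sup>+h. indicator A (h + x) \<partial>lborel)"
    proof -
      have "(\<lambda>h. indicator A (h + x)) = (indicator B :: 'a \<Rightarrow> ennreal)"
        by (auto simp: B_def indicator_def add.commute fun_eq_iff)
      then show ?thesis using B by (simp add: nn_integral_indicator)
    qed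
    also have "\<dots> = (\<integral>\<^sup>+h. indicator A h \<partial>lborel)"
      by (rule nn_integral_translation) measurable
    finally have mB: "emeasure lborel B = ennreal m" using A by simp
    have "ennreal m + ennreal m = emeasure lborel (ball (0::'a) r)"
      using A r by (simp flip: ennreal_plus)
    also have "\<dots> \<le> emeasure lborel (H \<union> B)"
      by (intro emeasure_mono) (auto simp: H_def)
    also have "\<dots> \<le> emeasure lborel H + ennreal m"
      using emeasure_subadditive[of H lborel B] mB by simp
    finally have mH: "ennreal m \<le> emeasure lborel H"
      by (simp add: add.commute ennreal_add_left_cancel_le)
    show "ennreal m * ennreal \<bar>f x\<bar> \<le> (\<integral>\<^sup>+h. indicator (ball 0 r) h * ennreal \<bar>f (x + h)
        - f x\<bar> \<partial>lborel)"
    proof -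
      have "ennreal m * ennreal \<bar>f x\<bar> \<le> emeasure lborel H * ennreal \<bar>f x\<bar>"
        using mH by (intro mult_right_mono) auto
      also have "\<dots> = (\<integral>\<^sup>+h. indicator H h * ennreal \<bar>f x\<bar> \<partial>lborel)"
        by (subst nn_integral_multc) auto
      also have "\<dots> \<le> (\<integral>\<^sup>+h. indicator (ball 0 r) h * ennreal \<bar>f (x + h) - f x\<bar> \<partial>lborel)"
        using supp by (intro nn_integral_mono) (auto simp: indicator_def H_def B_def)
      finally show ?thesis .
    qed
  qed
  also have "\<dots> = (\<integral>\<^sup>+h. (\<integral>\<^sup>+x. indicator (ball 0 r) h * ennreal \<bar>f (x + h) - f x\<bar> \<partial>lborel) \<partial>lborel)"
    by (intro lborel_pair.Fubini'[symmetric]) measurable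
  also have "\<dots> \<le> (\<integral>\<^sup>+h. indicator (ball (0::'a) r) h * (ennreal r * ?I) \<partial>lborel)"
  proof (rule nn_integral_mono)
    fix h :: 'a
    have "(\<integral>\<^sup>+x. indicator (ball 0 r) h * ennreal \<bar>f (x + h) - f x\<bar> \<partial>lborel)
      = indicator (ball 0 r) h * (\<integral>\<^sup>+x. ennreal \<bar>f (x + h) - f x\<bar> \<partial>lborel)"
      by (intro nn_integral_cmult) measurable
    also have "\<dots> \<le> indicator (ball 0 r) h * (ennreal (norm h) * ?I)"
      by (intro mult_left_mono nn_integral_increment_le[OF d c]) auto
    also have "\<dots> \<le> indicator (ball 0 r) h * (ennreal r * ?I)"
      by (auto simp: indicator_def intro!: mult_right_mono ennreal_leI)
    finally show "(\<integral>\<^sup>+x. indicator (ball 0 r) h * ennreal \<bar>f (x + h) - f x\<bar> \<partial>lborel)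
      \<le> indicator (ball 0 r) h * (ennreal r * ?I)" .
  qed
  also have "\<dots> = ennreal (2 * m) * (ennreal r * ?I)"
    using r by (subst nn_integral_multc) auto
  also have "\<dots> = ennreal m * (ennreal (2 * r) * ?I)"
    using A r by (simp add: mult_ac ennreal_mult)
  finally have "ennreal m * (\<integral>\<^sup>+x. ennreal \<bar>f x\<bar> \<partial>lborel) \<le> ennreal m * (ennreal (2 * r) * ?I)" .
  then show ?thesis
    using A by (subst (asm) ennreal_mult_le_mult_iff) auto
qed

lemma has_derivative_grad:
  fixes f :: "real^'n \<Rightarrow> real"
  assumes "f differentiable (at x)"
  shows "(f has_derivative (\<lambda>v. (\<chi> i. partial i f x) \<bullet> v)) (at x)"
proof -
  interpret linear "frechet_derivative f (at x)"
    using assms by (rule linear_frechet_derivative)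
  have "frechet_derivative f (at x) v = (\<chi> i. partial i f x) \<bullet> v" for v
  proof -
    have "frechet_derivative f (at x) v = frechet_derivative f (at x) (\<Sum>i\<in>UNIV. v $ i *\<^sub>R axis i 1)"
      by (simp add: basis_expansion flip: scalar_mult_eq_scaleR)
    also have "\<dots> = (\<Sum>i\<in>UNIV. v $ i * partial i f x)"
      by (simp add: sum scale partial_def)
    also have "\<dots> = (\<chi> i. partial i f x) \<bullet> v"
      by (simp add: inner_vec_def mult.commute)
    finally show ?thesis .
  qed
  then have "frechet_derivative f (at x) = (\<lambda>v. (\<chi> i. partial i f x) \<bullet> v)" by auto
  then show ?thesis
    using assms frechet_derivative_works by metis
qed

lemma integrable_continuous_compact_support:
  fixes f :: "'a::euclidean_space \<Rightarrow> 'b::euclidean_space"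
  assumes c: "continuous_on UNIV f" and K: "compact K" and z: "\<And>x. x \<notin> K \<Longrightarrow> f x = 0"
  shows "integrable lborel f"
proof -
  have "integrable lborel (\<lambda>x. indicator K x *\<^sub>R f x)"
    using c K by (intro borel_integrable_compact) (auto intro: continuous_on_subset)
  moreover have "(\<lambda>x. indicator K x *\<^sub>R f x) = f"
    using z by (auto simp: indicator_def)
  ultimately show ?thesis by simp
qed

text \<open>By translation invariance every difference quotient of \<open>f\<close> in direction
  \<open>v\<close> has integral zero. The quotients converge to \<open>g x \<bullet> v\<close> under
  a common bound supported in a ball, so no boundary terms have to be discussed.\<close>

lemma integral_gradient_eq_0:
  fixes f :: "'a::euclidean_space \<Rightarrow> real"
  assumes d: "\<And>x. (f has_derivative (\<lambda>v. g x \<bullet> v)) (at x)" and c: "continuous_on UNIV g"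
    and K: "compact K" and z: "\<And>x. x \<notin> K \<Longrightarrow> f x = 0" "\<And>x. x \<notin> K \<Longrightarrow> g x = 0"
  shows "(\<integral>x. g x \<bullet> v \<partial>lborel) = 0"
proof -
  have cf: "continuous_on UNIV f"
    using d has_derivative_continuous by (intro continuous_at_imp_continuous_on) blast
  have [measurable]: "f \<in> borel_measurable borel" using cf by (rule borel_measurable_continuous_onI)
  have [measurable]: "g \<in> borel_measurable borel" using c by (rule borel_measurable_continuous_onI)
  have fi: "integrable lborel f"
    using cf K z by (intro integrable_continuous_compact_support)
  have "compact (g ` K)" using c K by (intro compact_continuous_image)
      (auto intro: continuous_on_subset)
  then obtain B where B: "\<And>x. x \<in> K \<Longrightarrow> norm (g x) \<le> B"
    using compact_imp_bounded bounded_iff by (metis imageI)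
  have B': "norm (g x) \<le> \<bar>B\<bar>" for x
    using B[of x] z(2)[of x] by (cases "x \<in> K") auto
  have lip: "\<bar>f y - f x\<bar> \<le> \<bar>B\<bar> * norm (y - x)" for x y
  proof -
    have "norm (f y - f x) \<le> \<bar>B\<bar> * norm (y - x)"
    proof (rule differentiable_bound[where S = UNIV and f' = "\<lambda>x v. g x \<bullet> v"])
      fix x
      show "onorm (\<lambda>v. g x \<bullet> v) \<le> \<bar>B\<bar>"
      proof (rule onorm_le)
        fix v
        have "norm (g x \<bullet> v) \<le> norm (g x) * norm v"
          using Cauchy_Schwarz_ineq2 by simp
        also have "\<dots> \<le> \<bar>B\<bar> * norm v" using B' by (intro mult_right_mono) auto
        finally show "norm (g x \<bullet> v) \<le> \<bar>B\<bar> * norm v" .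
      qed
    qed (auto intro!: d)
    then show ?thesis by simp
  qed
  obtain R where R: "\<And>x. x \<in> K \<Longrightarrow> norm x \<le> R"
    using compact_imp_bounded[OF K] bounded_iff by metis
  define q where "q n x = real (Suc n) * (f (x + (1 / real (Suc n)) *\<^sub>R v) - f x)" for n x
  have q_meas: "q n \<in> borel_measurable lborel" for n
    unfolding q_def by measurable
  have q0: "(\<integral>x. q n x \<partial>lborel) = 0" for n
  proof -
    have "integrable lborel (\<lambda>x. f ((1 / real (Suc n)) *\<^sub>R v + x))"
      using fi by (subst integrable_translation_iff) auto
    moreover have "(\<integral>x. f ((1 / real (Suc n)) *\<^sub>R v + x) \<partial>lborel) = (\<integral>x. f x \<partial>lborel)"
      by (rule integral_translation) measurable
    ultimately show ?thesis
      using fi by (simp add: q_def add.commute)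
  qed
  have "(\<lambda>n. \<integral>x. q n x \<partial>lborel) \<longlonglongrightarrow> (\<integral>x. g x \<bullet> v \<partial>lborel)"
  proof (rule integral_dominated_convergence[where w
      = "\<lambda>x. indicator (cball 0 (R + norm v)) x *\<^sub>R (\<bar>B\<bar> * norm v)"])
    show "integrable lborel (\<lambda>x::'a. indicator (cball 0 (R + norm v)) x *\<^sub>R (\<bar>B\<bar> * norm v))"
      by (intro integrable_scaleR_left integrable_real_indicator)
         (auto simp: emeasure_lborel_cball_finite[unfolded infinity_ennreal_def])
    show "AE x in lborel. (\<lambda>n. q n x) \<longlonglongrightarrow> g x \<bullet> v"
    proof (rule AE_I2)
      fix x
      have "((\<lambda>t. x + t *\<^sub>R v) has_derivative (\<lambda>t. t *\<^sub>R v)) (at 0)"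
        by (auto intro!: derivative_eq_intros)
      from has_derivative_compose[OF this, of f "\<lambda>v. g x \<bullet> v"] d[of x]
      have "((\<lambda>t. f (x + t *\<^sub>R v)) has_real_derivative (g x \<bullet> v)) (at 0)"
        by (simp add: has_field_derivative_def mult.commute[of _ "g x \<bullet> v"] mult_commute_abs)
      then have "((\<lambda>t. (f (x + t *\<^sub>R v) - f x) / t) \<longlongrightarrow> g x \<bullet> v) (at 0)"
        by (simp add: DERIV_def)
      moreover have "filterlim (\<lambda>n. 1 / real (Suc n)) (at 0) sequentially"
        unfolding filterlim_at using lim_inverse_n' LIMSEQ_Suc[OF lim_inverse_n']
            by (auto simp: eventually_sequentially)
      ultimately have "(\<lambda>n. (f (x + (1 / real (Suc n)) *\<^sub>R v)
          - f x) / (1 / real (Suc n))) \<longlonglongrightarrow> g x \<bullet> v"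
        by (rule filterlim_compose)
      then show "(\<lambda>n. q n x) \<longlonglongrightarrow> g x \<bullet> v"
        by (simp add: q_def mult.commute)
    qed
    show "AE x in lborel. norm (q n x) \<le> indicator (cball 0 (R
        + norm v)) x *\<^sub>R (\<bar>B\<bar> * norm v)" for n
    proof (rule AE_I2)
      fix x
      have n1: "norm ((1 / real (Suc n)) *\<^sub>R v) \<le> norm v"
        using mult_right_mono[of 1 "1 + real n" "norm v"] by (simp add: divide_simps mult.commute)
      show "norm (q n x) \<le> indicator (cball 0 (R + norm v)) x *\<^sub>R (\<bar>B\<bar> * norm v)"
      proof (cases "x \<in> cball 0 (R + norm v)")
        case True
        have "norm (q n x) = real (Suc n) * \<bar>f (x + (1 / real (Suc n)) *\<^sub>R v) - f x\<bar>"
          by (simp add: q_def abs_mult)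
        also have "\<dots> \<le> real (Suc n) * (\<bar>B\<bar> * norm ((1 / real (Suc n)) *\<^sub>R v))"
          using lip[of "x + (1 / real (Suc n)) *\<^sub>R v" x] by (intro mult_left_mono) auto
        also have "\<dots> = \<bar>B\<bar> * norm v" by simp
        finally show ?thesis using True by simp
      next
        case False
        then have x: "R + norm v < norm x" by simp
        \<comment> \<open>Outside the ball of radius \<open>R + norm v\<close> neither x nor its
          translate by \<open>w\<close> meets \<open>K\<close>, so the quotient vanishes.\<close>
        define w where "w = (1 / real (Suc n)) *\<^sub>R v"
        have "norm x \<le> norm (x + w) + norm w"
          by norm
        moreover have "norm w \<le> norm v" using n1 by (simp only: w_def)
        ultimately have "R < norm (x + w)" "R < norm x"
          using x norm_ge_zero[of v] by linarith+
        then have "x + w \<notin> K" "x \<notin> K"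
          using R by force+
        then show ?thesis using False z by (simp add: q_def w_def)
      qed
    qed
  qed (use q_meas in auto)
  then show ?thesis using q0 LIMSEQ_unique[OF _ tendsto_const] by (simp add: LIMSEQ_const_iff)
qed

text \<open>Translation invariance and Tonelli's theorem are applied to Borel functions over
  \<open>lborel\<close>, whereas the Sobolev notions live on \<open>lebesgue_on\<close>. This is the
  bridge, through a Borel representative \<open>k\<close>.\<close>

lemma integral_lebesgue_on_eq_lborel:
  fixes h k :: "'a::euclidean_space \<Rightarrow> 'b::euclidean_space"
  assumes "h \<in> borel_measurable (lebesgue_on \<Omega>)" "\<Omega> \<in> sets lebesgue" "k \<in> borel_measurable borel"
    and ae: "AE y in lborel. k y = indicator \<Omega> y *\<^sub>R h y"
  shows "(\<integral>y. h y \<partial>lebesgue_on \<Omega>) = (\<integral>y. k y \<partial>lborel)"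
proof -
  have "(\<integral>y. h y \<partial>lebesgue_on \<Omega>) = (\<integral>y. indicator \<Omega> y *\<^sub>R h y \<partial>lebesgue)"
    using assms by (intro integral_restrict_space) simp
  also have "\<dots> = (\<integral>y. k y \<partial>lebesgue)"
  proof (rule integral_cong_AE)
    show "(\<lambda>y. indicator \<Omega> y *\<^sub>R h y) \<in> borel_measurable lebesgue"
      using assms by (subst borel_measurable_restrict_space_iff[symmetric]) auto
    show "k \<in> borel_measurable lebesgue"
      using assms(3) by (simp add: measurable_completion)
    show "AE y in lebesgue. indicator \<Omega> y *\<^sub>R h y = k y"
      using AE_completion[OF ae] by eventually_elim simp
  qed
  also have "\<dots> = (\<integral>y. k y \<partial>lborel)"
    using assms(3) by (intro integral_completion) simp
  finally show ?thesis .
qed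

lemma Lp_loc_continuous:
  fixes f :: "real^'n \<Rightarrow> 'b::euclidean_space"
  assumes c: "continuous_on UNIV f" and "\<Omega> \<in> sets lebesgue" and p: "0 < p"
  shows "Lp_loc \<Omega> p f"
  unfolding Lp_loc_def
proof (intro conjI allI impI)
  show "f \<in> borel_measurable (lebesgue_on \<Omega>)"
    using c assms(2) by (intro continuous_imp_measurable_on_sets_lebesgue)
        (auto intro: continuous_on_subset)
  fix K assume K: "compact K \<and> K \<subseteq> \<Omega>"
  have c': "continuous_on UNIV (\<lambda>x. norm (f x) powr p)"
    using c p by (intro continuous_on_powr') (auto intro!: continuous_intros)
  have "integrable lborel (\<lambda>x. indicator K x *\<^sub>R (norm (f x) powr p))"
    using K c' by (intro borel_integrable_compact) (auto intro: continuous_on_subset)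
  then have "integrable lebesgue (\<lambda>x. indicator K x *\<^sub>R (norm (f x) powr p))"
    by (subst integrable_completion) (auto dest: borel_measurable_integrable)
  then show "integrable (lebesgue_on K) (\<lambda>x. norm (f x) powr p)"
    using K by (subst integrable_restrict_space) (auto simp: borel_compact)
qed

lemma Linfty_continuous_compact_support:
  fixes f :: "real^'n \<Rightarrow> 'b::euclidean_space"
  assumes c: "continuous_on UNIV f" and "\<Omega> \<in> sets lebesgue" and K: "compact K" and z: "\<And>x. x \<notin> K
      \<Longrightarrow> f x = 0"
  shows "Linfty \<Omega> f"
proof -
  have "compact (f ` K)" using c K by (intro compact_continuous_image)
      (auto intro: continuous_on_subset)
  then obtain B where B: "\<And>x. x \<in> K \<Longrightarrow> norm (f x) \<le> B"
    using compact_imp_bounded bounded_iff by (metis imageI)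
  have "norm (f x) \<le> max B 0" for x
    using B[of x] z[of x] by (cases "x \<in> K") auto
  moreover have "f \<in> borel_measurable (lebesgue_on \<Omega>)"
    using c assms(2) by (intro continuous_imp_measurable_on_sets_lebesgue)
        (auto intro: continuous_on_subset)
  ultimately show ?thesis unfolding Linfty_def by blast
qed

text \<open>Integration by parts: the vanishing of the integrated gradient is applied to the product
  of \<open>f\<close> with a test function, and the compact support of \<open>f\<close> allows
  integration over the whole space.\<close>

lemma has_weak_gradient_C1:
  fixes f :: "real^'n \<Rightarrow> real"
  assumes d: "\<And>x. (f has_derivative (\<lambda>v. g x \<bullet> v)) (at x)" and c: "continuous_on UNIV g"
    and K: "compact K" "K \<subseteq> \<Omega>" and z: "\<And>x. x \<notin> K \<Longrightarrow> f x = 0" "\<And>x. x \<notin> K \<Longrightarrow> g x = 0"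
    and \<Omega>: "open \<Omega>"
  shows "has_weak_gradient \<Omega> f g"
proof -
  have cf: "continuous_on UNIV f"
    using d has_derivative_continuous by (intro continuous_at_imp_continuous_on) blast
  have \<Omega>l: "\<Omega> \<in> sets lebesgue" using \<Omega> by (simp add: borel_open)
  have "(\<integral>x. f x * partial i \<psi> x \<partial>lebesgue_on \<Omega>) = - (\<integral>x. g x $ i * \<psi> x \<partial>lebesgue_on \<Omega>)"
    if "test_function \<Omega> \<psi>" for \<psi> i
  proof -
    have C: "Ck k \<psi>" for k using that by (simp add: test_function_def)
    have c\<psi>: "continuous_on UNIV \<psi>" using C[of 0] by simp
    have cp: "continuous_on UNIV (partial j \<psi>)" for j using C[of "Suc 0"] by simp
    have dp: "(\<psi> has_derivative (\<lambda>v. (\<chi> i. partial i \<psi> x) \<bullet> v)) (at x)" for x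
      using C[of "Suc 0"] by (intro has_derivative_grad) simp
    have cg: "continuous_on UNIV (\<lambda>x. g x $ i)" using c by (intro continuous_intros)
    have d2: "((\<lambda>x. f x * \<psi> x) has_derivative (\<lambda>v. (f x *\<^sub>R (\<chi> i. partial i \<psi> x)
        + \<psi> x *\<^sub>R g x) \<bullet> v)) (at x)" for x
      using has_derivative_mult[OF d[of x] dp[of x]] by (simp add: inner_add_left mult.commute)
    have "(\<integral>x. (f x *\<^sub>R (\<chi> i. partial i \<psi> x) + \<psi> x *\<^sub>R g x) \<bullet> axis i 1 \<partial>lborel) = 0"
      by (rule integral_gradient_eq_0[OF d2 _ K(1)])
         (use z cf c c\<psi> cp in \<open>auto intro!: continuous_intros continuous_on_vec_lambda\<close>)
    then have "(\<integral>x. f x * partial i \<psi> x + g x $ i * \<psi> x \<partial>lborel) = 0"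
      by (simp add: inner_add_left inner_axis mult.commute)
    moreover have "integrable lborel (\<lambda>x. f x * partial i \<psi> x)"
        "integrable lborel (\<lambda>x. g x $ i * \<psi> x)"
      by (rule integrable_continuous_compact_support[OF _ K(1)];
          use z cf cg c\<psi> cp in \<open>auto intro!: continuous_intros\<close>)+
    ultimately have "(\<integral>x. f x * partial i \<psi> x \<partial>lborel) = - (\<integral>x. g x $ i * \<psi> x \<partial>lborel)"
      by simp
    moreover have zo: "g x = 0" "f x = 0" if "x \<notin> \<Omega>" for x
      using z K that by auto
    moreover have "(\<integral>x. f x * partial i \<psi> x \<partial>lebesgue_on \<Omega>) = (\<integral>x. f x * partial i \<psi> x \<partial>lborel)"
      by (rule integral_lebesgue_on_eq_lborel)
         (use \<Omega>l z K cf cp in \<open>auto intro!: continuous_imp_measurable_on_sets_lebesgue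
             borel_measurable_continuous_onI
            continuous_on_subset[of UNIV _ \<Omega>] continuous_intros AE_I2 split: split_indicator\<close>)
    moreover have "(\<integral>x. g x $ i * \<psi> x \<partial>lebesgue_on \<Omega>) = (\<integral>x. g x $ i * \<psi> x \<partial>lborel)"
      by (rule integral_lebesgue_on_eq_lborel)
         (use \<Omega>l zo c cg c\<psi> in \<open>auto intro!: continuous_imp_measurable_on_sets_lebesgue
             borel_measurable_continuous_onI
            continuous_on_subset[of UNIV _ \<Omega>] continuous_intros AE_I2 split: split_indicator\<close>)
    ultimately show ?thesis by simp
  qed
  then show ?thesis
    unfolding has_weak_gradient_def using cf c \<Omega>l by (auto intro: Lp_loc_continuous)
qed

text \<open>The source of all functions with which the weak inequalities are tested.\<close>

lemma W1infty_C1: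
  fixes f :: "real^'n \<Rightarrow> real"
  assumes d: "\<And>x. (f has_derivative (\<lambda>v. g x \<bullet> v)) (at x)" and c: "continuous_on UNIV g"
    and K: "compact K" "K \<subseteq> \<Omega>" and z: "\<And>x. x \<notin> K \<Longrightarrow> f x = 0" "\<And>x. x \<notin> K \<Longrightarrow> g x = 0"
    and \<Omega>: "open \<Omega>"
  shows "W1infty \<Omega> f" and "compactly_supported_in \<Omega> f"
proof -
  have cf: "continuous_on UNIV f"
    using d has_derivative_continuous by (intro continuous_at_imp_continuous_on) blast
  have "\<Omega> \<in> sets lebesgue" using \<Omega> by (simp add: borel_open)
  then show "W1infty \<Omega> f"
    unfolding W1infty_def using has_weak_gradient_C1[OF assms] Linfty_continuous_compact_support[OF
        c _ K(1) z(2)]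
      Linfty_continuous_compact_support[OF cf _ K(1) z(1)] by blast
  show "compactly_supported_in \<Omega> f"
    unfolding compactly_supported_in_def using K z by auto
qed

subsection \<open>Mollification\<close>

lemma uniformly_continuous_on_compact_support:
  fixes f :: "'a::euclidean_space \<Rightarrow> 'b::real_normed_vector"
  assumes c: "continuous_on UNIV f" and z: "\<And>x. R < norm x \<Longrightarrow> f x = 0"
  shows "uniformly_continuous_on UNIV f"
  unfolding uniformly_continuous_on_def
proof (intro allI impI)
  fix e :: real assume e: "0 < e"
  have "uniformly_continuous_on (cball 0 (R + 1)) f"
    using c by (intro compact_uniformly_continuous) (auto intro: continuous_on_subset)
  then have "\<exists>d>0. \<forall>x\<in>cball 0 (R + 1). \<forall>y\<in>cball 0 (R + 1). dist y x < d \<longrightarrow> dist (f y) (f x) < e"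
    using e by (simp only: uniformly_continuous_on_def)
  then obtain d where d: "0 < d"
    "\<And>x y. x \<in> cball 0 (R + 1) \<Longrightarrow> y \<in> cball 0 (R + 1) \<Longrightarrow> dist y x < d \<Longrightarrow> dist (f y) (f x) < e"
    by auto
  show "\<exists>d>0. \<forall>x\<in>UNIV. \<forall>x'\<in>UNIV. dist x' x < d \<longrightarrow> dist (f x') (f x) < e"
  proof (intro exI[of _ "min d 1"] conjI ballI impI)
    fix x y :: 'a assume xy: "dist y x < min d 1"
    show "dist (f y) (f x) < e"
    proof (cases "x \<in> cball 0 (R + 1) \<and> y \<in> cball 0 (R + 1)")
      case False
      have "norm x \<le> norm y + dist y x" "norm y \<le> norm x + dist y x"
        by (simp_all add: dist_norm norm_triangle_sub norm_minus_commute)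
          (metis norm_minus_commute norm_triangle_sub)
      with False xy have "R < norm x" "R < norm y" by auto
      then show ?thesis using z e by simp
    qed (use d xy in auto)
  qed (use d in auto)
qed

definition mollifier :: "real \<Rightarrow> real^'n \<Rightarrow> real" where
  "mollifier e z = bump 0 e 0 z / (\<integral>y. bump 0 e (0::real^'n) y \<partial>lborel)"

definition mollifier_grad :: "real \<Rightarrow> real^'n \<Rightarrow> real^'n" where
  "mollifier_grad e z = bump_grad 0 e 0 z /\<^sub>R (\<integral>y. bump 0 e (0::real^'n) y \<partial>lborel)"

text \<open>The kernel is even, so this is the usual convolution. Written with \<open>y - x\<close>,
  it turns a derivative in x into minus the derivative of the kernel.\<close>

definition mollify :: "real \<Rightarrow> (real^'n \<Rightarrow> 'b::euclidean_space) \<Rightarrow> real^'n \<Rightarrow> 'b" where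
  "mollify e f x = (\<integral>y. mollifier e (y - x) *\<^sub>R f y \<partial>lborel)"

lemma bump_0_le_1: "bump 0 e c y \<le> 1"
  by (simp add: bump_def exp_flat_def)

lemma bump_translate: "bump m e c y = bump m e 0 (y - c)"
  by (simp add: bump_def)

lemma integrable_bump:
  assumes "0 \<le> e"
  shows "integrable lborel (bump 0 e (c::real^'n))"
proof (rule Bochner_Integration.integrable_bound)
  show "integrable lborel (indicator (cball c e) :: real^'n \<Rightarrow> real)"
    by (intro integrable_real_indicator) (auto
        simp: emeasure_lborel_cball_finite[unfolded infinity_ennreal_def])
  show "bump 0 e c \<in> borel_measurable lborel"
    by (auto intro!: borel_measurable_continuous_onI continuous_intros)
  show "AE y in lborel. norm (bump 0 e c y) \<le> norm (indicator (cball c e) y :: real)"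
    using assms bump_0_le_1[of e c] bump_eq_0[of e _ c 0]
    by (auto simp: indicator_def dist_norm norm_minus_commute)
qed

lemma bump_mass_pos:
  assumes "0 < e"
  shows "0 < (\<integral>y. bump 0 e (0::real^'n) y \<partial>lborel)"
proof -
  have "(\<integral>y. bump 0 e (0::real^'n) y \<partial>lborel) \<noteq> 0"
  proof
    assume "(\<integral>y. bump 0 e (0::real^'n) y \<partial>lborel) = 0"
    then have "AE y in lborel. bump 0 e (0::real^'n) y = 0"
      using integral_nonneg_eq_0_iff_AE[OF integrable_bump[of e "0::real^'n"]] assms by simp
    then have "AE y in lborel. y \<notin> ball (0::real^'n) e"
      using assms bump_pos[of e _ "0::real^'n" 0] by (auto elim!: eventually_mono) force
    then have "emeasure lborel (ball (0::real^'n) e) = 0"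
      by (subst (asm) AE_iff_measurable[OF _ refl]) (auto simp: ball_def)
    then have "measure lborel (ball (0::real^'n) e) = 0"
      by (simp add: measure_def)
    with assms show False by simp
  qed
  moreover have "0 \<le> (\<integral>y. bump 0 e (0::real^'n) y \<partial>lborel)"
    by (intro integral_nonneg_AE) auto
  ultimately show ?thesis by linarith
qed

context
  fixes e :: real
  assumes e: "0 < e"
begin

lemma mollifier_nonneg: "0 \<le> mollifier e z"
  using bump_mass_pos[OF e, where 'n='a] by (simp add: mollifier_def)

lemma mollifier_eq_0: "e \<le> norm z \<Longrightarrow> mollifier e z = 0"
  using e by (simp add: mollifier_def bump_eq_0)

lemma mollifier_grad_eq_0: "e \<le> norm z \<Longrightarrow> mollifier_grad e z = 0"
  using e by (simp add: mollifier_grad_def bump_grad_def bump_eq_0)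

lemma continuous_on_mollifier: "continuous_on S (mollifier e)"
  unfolding mollifier_def by (intro continuous_intros) (use bump_mass_pos[OF e, where 'n='a]
      in auto)

lemma continuous_on_mollifier_grad: "continuous_on S (mollifier_grad e)"
  unfolding mollifier_grad_def bump_grad_def by (intro continuous_intros)

lemma mollifier_measurable [measurable]: "mollifier e \<in> borel_measurable borel"
  by (intro borel_measurable_continuous_onI continuous_on_mollifier)

lemma mollifier_grad_measurable [measurable]: "mollifier_grad e \<in> borel_measurable borel"
  by (intro borel_measurable_continuous_onI continuous_on_mollifier_grad)

lemma integrable_mollifier: "integrable lborel (mollifier e)"
  unfolding mollifier_def[abs_def] by (intro integrable_divide integrable_bump less_imp_le[OF e])

lemma integral_mollifier: "(\<integral>z. mollifier e z \<partial>lborel) = 1"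
  unfolding mollifier_def using bump_mass_pos[OF e, where 'n='a] by simp

lemma mollifier_le: "mollifier e z \<le> 1 / (\<integral>y. bump 0 e (0::real^'n) y \<partial>lborel)" for z :: "real^'n"
  unfolding mollifier_def using bump_mass_pos[OF e, where 'n='n]
  by (intro divide_right_mono bump_0_le_1) simp

lemma mollifier_has_derivative:
  "(mollifier e has_derivative (\<lambda>v. mollifier_grad e z \<bullet> v)) (at z)"
proof -
  have "((\<lambda>z. bump 0 e 0 z / (\<integral>y. bump 0 e (0::real^'a) y \<partial>lborel)) has_derivative
      (\<lambda>v. (bump_grad 0 e 0 z \<bullet> v) / (\<integral>y. bump 0 e (0::real^'a) y \<partial>lborel))) (at z)"
    by (intro bounded_linear.has_derivative[OF bounded_linear_divide] bump_has_derivative)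
  then show ?thesis
    by (simp add: mollifier_def[abs_def] mollifier_grad_def[abs_def] divide_inverse_commute)
qed

lemma integrable_mollify:
  fixes f :: "real^'n \<Rightarrow> 'b::euclidean_space"
  assumes f: "integrable lborel f"
  shows "integrable lborel (\<lambda>y. mollifier e (y - x) *\<^sub>R f y)"
proof (rule Bochner_Integration.integrable_bound)
  show "integrable lborel (\<lambda>y. (1 / (\<integral>y. bump 0 e (0::real^'n) y \<partial>lborel)) *\<^sub>R f y)"
    using f by simp
  have [measurable]: "f \<in> borel_measurable borel" using f
      by (auto dest: borel_measurable_integrable)
  show "(\<lambda>y. mollifier e (y - x) *\<^sub>R f y) \<in> borel_measurable lborel" by measurable
  show "AE y in lborel. norm (mollifier e (y - x) *\<^sub>R f y)
      \<le> norm ((1 / (\<integral>y. bump 0 e (0::real^'n) y \<partial>lborel)) *\<^sub>R f y)"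
    using bump_mass_pos[OF e, where 'n='n]
    by (auto intro!: AE_I2 mult_right_mono mollifier_le
        simp: mollifier_nonneg simp del: times_divide_eq_left)
qed

lemma mollifier_grad_bounded: "\<exists>B. \<forall>z::real^'n. norm (mollifier_grad e z) \<le> B"
proof -
  have "compact (mollifier_grad e ` cball (0::real^'n) e)"
    by (intro compact_continuous_image continuous_on_mollifier_grad) simp
  then obtain B where B: "\<And>z::real^'n. z \<in> cball 0 e \<Longrightarrow> norm (mollifier_grad e z) \<le> B"
    unfolding bounded_iff[symmetric] using compact_imp_bounded bounded_iff by (metis imageI)
  have "norm (mollifier_grad e z) \<le> max B 0" for z :: "real^'n"
    using B[of z] mollifier_grad_eq_0[of z] by (cases "norm z \<le> e") auto
  then show ?thesis by blast
qed

lemma integrable_mollify_grad: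
  fixes f :: "real^'n \<Rightarrow> real"
  assumes f: "integrable lborel f"
  shows "integrable lborel (\<lambda>y. f y *\<^sub>R mollifier_grad e (y - x))"
proof -
  obtain B where B: "\<And>z::real^'n. norm (mollifier_grad e z) \<le> B"
    using mollifier_grad_bounded by blast
  have [measurable]: "f \<in> borel_measurable borel" using f
      by (auto dest: borel_measurable_integrable)
  show ?thesis
  proof (rule Bochner_Integration.integrable_bound)
    show "integrable lborel (\<lambda>y. B * f y)" using f by simp
    show "(\<lambda>y. f y *\<^sub>R mollifier_grad e (y - x)) \<in> borel_measurable lborel" by measurable
    have "\<bar>f y\<bar> * norm (mollifier_grad e (y - x)) \<le> \<bar>f y\<bar> * \<bar>B\<bar>" for y
      using order_trans[OF B abs_ge_self] by (intro mult_left_mono) auto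
    then show "AE y in lborel. norm (f y *\<^sub>R mollifier_grad e (y - x)) \<le> norm (B * f y)"
      by (simp add: abs_mult mult.commute)
  qed
qed

text \<open>Uniform continuity of the gradient of the kernel makes the first-order Taylor remainder
  uniform in the base point; it is this uniformity that permits differentiation under the
  integral.\<close>

lemma mollifier_grad_uniform:
  assumes "0 < \<eta>"
  shows "\<exists>d>0. (\<forall>z z' :: real^'n. norm (z' - z) < d
      \<longrightarrow> norm (mollifier_grad e z' - mollifier_grad e z) \<le> \<eta>) \<and>
    (\<forall>z v :: real^'n. norm v < d \<longrightarrow> \<bar>mollifier e (z + v) - mollifier e z - mollifier_grad e z \<bullet> v\<bar>
        \<le> \<eta> * norm v)"
proof -
  have "uniformly_continuous_on UNIV (mollifier_grad e :: real^'n \<Rightarrow> _)"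
    by (rule uniformly_continuous_on_compact_support[where R = e, OF continuous_on_mollifier_grad])
       (simp add: mollifier_grad_eq_0)
  then have "\<exists>d>0. \<forall>z\<in>UNIV. \<forall>z'\<in>UNIV. dist z' z < d
      \<longrightarrow> dist (mollifier_grad e z') (mollifier_grad e (z::real^'n)) < \<eta>"
    using assms by (simp only: uniformly_continuous_on_def)
  then obtain d where d: "0 < d" "\<And>z z' :: real^'n. dist z' z < d
      \<Longrightarrow> dist (mollifier_grad e z') (mollifier_grad e z) < \<eta>"
    by auto
  have 1: "norm (mollifier_grad e z' - mollifier_grad e z) \<le> \<eta>"
      if "norm (z' - z) < d" for z z' :: "real^'n"
    using d(2)[of z' z] that by (simp add: dist_norm)
  have "\<bar>mollifier e (z + v) - mollifier e z - mollifier_grad e z \<bullet> v\<bar> \<le> \<eta> * norm v"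
      if "norm v < d" for z v :: "real^'n"
  proof -
    have "norm (mollifier e (z + v) - mollifier e z - mollifier_grad e z \<bullet> ((z + v) - z))
        \<le> norm ((z + v) - z) * \<eta>"
    proof (rule differentiable_bound_linearization[where S = "ball z d" and f'
        = "\<lambda>x v. mollifier_grad e x \<bullet> v" and ?x0.0 = z])
      fix t :: real assume t: "t \<in> {0..1}"
      have "norm (t *\<^sub>R v) \<le> 1 * norm v"
        unfolding norm_scaleR using t by (intro mult_right_mono) auto
      then show "z + t *\<^sub>R (z + v - z) \<in> ball z d"
        using that by (simp add: dist_norm)
    next
      fix x assume "x \<in> ball z d"
      then have "norm (mollifier_grad e x - mollifier_grad e z) \<le> \<eta>"
        by (intro 1) (simp add: dist_norm norm_minus_commute)
      show "onorm ((\<lambda>v. mollifier_grad e x \<bullet> v) - (\<lambda>v. mollifier_grad e z \<bullet> v)) \<le> \<eta>"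
      proof (rule onorm_le)
        fix w
        have "norm ((mollifier_grad e x - mollifier_grad e z) \<bullet> w)
            \<le> norm (mollifier_grad e x - mollifier_grad e z) * norm w"
          using Cauchy_Schwarz_ineq2 by simp
        also have "\<dots> \<le> \<eta> * norm w"
          using \<open>norm (mollifier_grad e x - _) \<le> \<eta>\<close> by (intro mult_right_mono) auto
        finally show "norm (((\<lambda>v. mollifier_grad e x \<bullet> v) - (\<lambda>v. mollifier_grad e z \<bullet> v)) w)
            \<le> \<eta> * norm w"
          by (simp add: inner_diff_left)
      qed
    qed (use d in \<open>auto intro!: has_derivative_at_withinI mollifier_has_derivative\<close>)
    then show ?thesis by (simp add: mult.commute)
  qed
  with d(1) 1 show ?thesis by blast
qed

lemma mollify_has_derivative:
  fixes f :: "real^'n \<Rightarrow> real"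
  assumes f: "integrable lborel f"
  shows "(mollify e f has_derivative (\<lambda>v. (- (\<integral>y. f y *\<^sub>R mollifier_grad e (y
      - x) \<partial>lborel)) \<bullet> v)) (at x)"
  unfolding has_derivative_at_alt
proof (intro conjI allI impI bounded_linear_inner_right)
  fix \<eta> :: real assume \<eta>: "0 < \<eta>"
  define I where "I = (\<integral>y. \<bar>f y\<bar> \<partial>lborel)"
  have I: "0 \<le> I" by (simp add: I_def)
  \<comment> \<open>\<open>I + 1\<close> in place of \<open>I\<close> avoids division by zero when
    \<open>f\<close> vanishes almost everywhere.\<close>
  have "0 < \<eta> / (I + 1)" using \<eta> I by simp
  then obtain d where d: "0 < d"
    "\<And>z v :: real^'n. norm v < d \<Longrightarrow> \<bar>mollifier e (z + v) - mollifier e z - mollifier_grad e z \<bullet> v\<bar>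
        \<le> \<eta> / (I + 1) * norm v"
    using mollifier_grad_uniform[OF \<open>0 < \<eta> / (I + 1)\<close>, where 'n='n] by auto
  show "\<exists>d>0. \<forall>y. norm (y - x) < d \<longrightarrow> norm (mollify e f y - mollify e f x -
      (- (\<integral>y. f y *\<^sub>R mollifier_grad e (y - x) \<partial>lborel)) \<bullet> (y - x)) \<le> \<eta> * norm (y - x)"
  proof (intro exI[of _ d] conjI allI impI d(1))
    fix x' assume x': "norm (x' - x) < d"
    define v where "v = x' - x"
    have eq: "mollify e f x' - mollify e f x - (- (\<integral>y. f y *\<^sub>R mollifier_grad e (y
        - x) \<partial>lborel)) \<bullet> v
      = (\<integral>y. mollifier e (y - x') *\<^sub>R f y - mollifier e (y - x) *\<^sub>R f y
          + f y *\<^sub>R mollifier_grad e (y - x) \<bullet> v \<partial>lborel)"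
      unfolding mollify_def
      using integrable_mollify[OF f] integrable_mollify_grad[OF f]
      by (subst Bochner_Integration.integral_add,
          (intro Bochner_Integration.integrable_diff integrable_inner_left; simp),
          (intro integrable_inner_left; simp))
         (simp add: Bochner_Integration.integral_diff flip: integral_inner_left)
    have "norm (mollify e f x' - mollify e f x - (- (\<integral>y. f y *\<^sub>R mollifier_grad e (y
        - x) \<partial>lborel)) \<bullet> v)
      \<le> (\<integral>y. norm (mollifier e (y - x') *\<^sub>R f y - mollifier e (y - x) *\<^sub>R f y
          + f y *\<^sub>R mollifier_grad e (y - x) \<bullet> v) \<partial>lborel)"
      unfolding eq by (rule integral_norm_bound)
    also have "\<dots> \<le> (\<integral>y. \<eta> / (I + 1) * norm v * \<bar>f y\<bar> \<partial>lborel)"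
    proof (rule integral_mono)
      fix y
      have "\<bar>mollifier e ((y - x) + - v) - mollifier e (y - x) - mollifier_grad e (y - x) \<bullet> (- v)\<bar>
          \<le> \<eta> / (I + 1) * norm (- v)"
        using x' by (intro d(2)) (simp add: v_def norm_minus_commute)
      moreover have ve: "(y - x) + - v = y - x'" by (simp add: v_def)
      ultimately have *: "\<bar>mollifier e (y - x') - mollifier e (y - x) + mollifier_grad e (y
          - x) \<bullet> v\<bar> \<le> \<eta> / (I + 1) * norm v"
        unfolding ve by simp
      have "norm (mollifier e (y - x') *\<^sub>R f y - mollifier e (y - x) *\<^sub>R f y
          + f y *\<^sub>R mollifier_grad e (y - x) \<bullet> v)
        = \<bar>mollifier e (y - x') - mollifier e (y - x) + mollifier_grad e (y - x) \<bullet> v\<bar> * \<bar>f y\<bar>"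
        by (simp add: algebra_simps flip: abs_mult)
      also have "\<dots> \<le> \<eta> / (I + 1) * norm v * \<bar>f y\<bar>"
        using * by (intro mult_right_mono) auto
      finally show "norm (mollifier e (y - x') *\<^sub>R f y - mollifier e (y - x) *\<^sub>R f y
          + f y *\<^sub>R mollifier_grad e (y - x) \<bullet> v)
        \<le> \<eta> / (I + 1) * norm v * \<bar>f y\<bar>" .
    qed (use f integrable_mollify[OF f] integrable_mollify_grad[OF f] in
        \<open>auto intro!: integrable_norm integrable_abs Bochner_Integration.integrable_add
            Bochner_Integration.integrable_diff integrable_inner_left simp del: inner_scaleR_left\<close>)
    also have "\<dots> = \<eta> * (I / (I + 1)) * norm v"
      by (simp add: I_def)
    also have "\<dots> \<le> \<eta> * 1 * norm v"
      using \<eta> I by (intro mult_right_mono mult_left_mono) auto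
    finally show "norm (mollify e f x' - mollify e f x -
      (- (\<integral>y. f y *\<^sub>R mollifier_grad e (y - x) \<partial>lborel)) \<bullet> (x' - x)) \<le> \<eta> * norm (x' - x)"
      by (simp add: v_def)
  qed
qed

lemma continuous_on_mollify_grad:
  fixes f :: "real^'n \<Rightarrow> real"
  assumes f: "integrable lborel f"
  shows "continuous_on UNIV (\<lambda>x. - (\<integral>y. f y *\<^sub>R mollifier_grad e (y - x) \<partial>lborel))"
  unfolding continuous_on_iff
proof (intro ballI allI impI)
  fix x and \<eta> :: real assume \<eta>: "0 < \<eta>"
  define I where "I = (\<integral>y. \<bar>f y\<bar> \<partial>lborel)"
  have I: "0 \<le> I" by (simp add: I_def)
  have "0 < \<eta> / (I + 1)" using \<eta> I by simp
  then obtain d where d: "0 < d"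
    "\<And>z z' :: real^'n. norm (z' - z) < d \<Longrightarrow> norm (mollifier_grad e z' - mollifier_grad e z)
        \<le> \<eta> / (I + 1)"
    using mollifier_grad_uniform[OF \<open>0 < \<eta> / (I + 1)\<close>, where 'n='n] by auto
  show "\<exists>d>0. \<forall>x'\<in>UNIV. dist x' x < d \<longrightarrow>
     dist (- (\<integral>y. f y *\<^sub>R mollifier_grad e (y - x') \<partial>lborel)) (- (\<integral>y. f y *\<^sub>R mollifier_grad e (y
         - x) \<partial>lborel)) < \<eta>"
  proof (intro exI[of _ d] conjI ballI impI d(1))
    fix x' assume x': "dist x' x < d"
    have "dist (- (\<integral>y. f y *\<^sub>R mollifier_grad e (y
        - x') \<partial>lborel)) (- (\<integral>y. f y *\<^sub>R mollifier_grad e (y - x) \<partial>lborel))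
      = norm (\<integral>y. f y *\<^sub>R mollifier_grad e (y - x') - f y *\<^sub>R mollifier_grad e (y - x) \<partial>lborel)"
      using integrable_mollify_grad[OF f]
      by (simp add: dist_norm Bochner_Integration.integral_diff norm_minus_commute)
    also have "\<dots> \<le> (\<integral>y. norm (f y *\<^sub>R mollifier_grad e (y - x') - f y *\<^sub>R mollifier_grad e (y
        - x)) \<partial>lborel)"
      by (rule integral_norm_bound)
    also have "\<dots> \<le> (\<integral>y. \<eta> / (I + 1) * \<bar>f y\<bar> \<partial>lborel)"
    proof (rule integral_mono)
      fix y
      have "norm (mollifier_grad e (y - x') - mollifier_grad e (y - x)) \<le> \<eta> / (I + 1)"
        using x' by (intro d(2)) (simp add: dist_norm norm_minus_commute)
      then show "norm (f y *\<^sub>R mollifier_grad e (y - x') - f y *\<^sub>R mollifier_grad e (y - x))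
          \<le> \<eta> / (I + 1) * \<bar>f y\<bar>"
        using mult_right_mono[OF _ abs_ge_zero[of "f y"]]
            by (simp add: mult.commute[of "\<bar>f y\<bar>"] del: times_divide_eq_left flip:
            scaleR_diff_right)
    qed (use f integrable_mollify_grad[OF f] in \<open>auto intro!: integrable_norm\<close>)
    also have "\<dots> = \<eta> * (I / (I + 1))"
      by (simp add: I_def)
    also have "\<dots> < \<eta> * 1"
      using \<eta> I by (intro mult_strict_left_mono) auto
    finally show "dist (- (\<integral>y. f y *\<^sub>R mollifier_grad e (y
        - x') \<partial>lborel)) (- (\<integral>y. f y *\<^sub>R mollifier_grad e (y - x) \<partial>lborel)) < \<eta>"
      by simp
  qed
qed

lemma mollify_translate:
  fixes f :: "real^'n \<Rightarrow> 'b::euclidean_space"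
  assumes [measurable]: "f \<in> borel_measurable borel"
  shows "mollify e f x = (\<integral>h. mollifier e h *\<^sub>R f (x + h) \<partial>lborel)"
proof -
  have "(\<integral>h. mollifier e ((x + h) - x) *\<^sub>R f (x + h) \<partial>lborel)
      = (\<integral>y. mollifier e (y - x) *\<^sub>R f y \<partial>lborel)"
    by (intro integral_translation) measurable
  then show ?thesis by (simp add: mollify_def)
qed

lemma mollify_diff:
  fixes f :: "real^'n \<Rightarrow> 'b::euclidean_space"
  assumes f: "integrable lborel f"
  shows "integrable lborel (\<lambda>h. mollifier e h *\<^sub>R (f (x + h) - c))"
    and "mollify e f x - c = (\<integral>h. mollifier e h *\<^sub>R (f (x + h) - c) \<partial>lborel)"
proof -
  have [measurable]: "f \<in> borel_measurable borel" using f
      by (auto dest: borel_measurable_integrable)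
  have "integrable lborel (\<lambda>h. mollifier e ((x + h) - x) *\<^sub>R f (x + h))"
    using integrable_mollify[OF f, of x]
    by (subst integrable_translation_iff[where f = "\<lambda>y. mollifier e (y - x) *\<^sub>R f y"]) simp_all
  then have 1: "integrable lborel (\<lambda>h. mollifier e h *\<^sub>R f (x + h))" by simp
  have 2: "integrable lborel (\<lambda>h. mollifier e h *\<^sub>R c)"
    by (intro integrable_scaleR_left integrable_mollifier)
  show "integrable lborel (\<lambda>h. mollifier e h *\<^sub>R (f (x + h) - c))"
    unfolding scaleR_diff_right using 1 2 by (rule Bochner_Integration.integrable_diff)
  show "mollify e f x - c = (\<integral>h. mollifier e h *\<^sub>R (f (x + h) - c) \<partial>lborel)"
    unfolding scaleR_diff_right Bochner_Integration.integral_diff[OF 1 2]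
    by (simp add: mollify_translate integral_mollifier integrable_mollifier)
qed

end

section \<open>Convergence of mollifications in L^p\<close>

lemma integrable_of_powr:
  fixes f :: "'a::euclidean_space \<Rightarrow> 'b::euclidean_space"
  assumes [measurable]: "f \<in> borel_measurable borel" and p: "1 \<le> p"
    and int: "integrable lborel (\<lambda>x. norm (f x) powr p)" and supp: "\<And>x. x \<notin> ball 0 R \<Longrightarrow> f x = 0"
  shows "integrable lborel f"
proof (rule Bochner_Integration.integrable_bound)
  have "integrable lborel (indicator (ball 0 R) :: 'a \<Rightarrow> real)"
    by (intro integrable_real_indicator) (auto
        simp: emeasure_lborel_ball_finite[unfolded infinity_ennreal_def])
  then show "integrable lborel (\<lambda>x. indicator (ball 0 R) x + norm (f x) powr p)"
    using int by simp
  have "norm (f x) \<le> indicator (ball 0 R) x + norm (f x) powr p" for x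
  proof (cases "norm (f x) \<le> 1")
    case True
    then show ?thesis using supp[of x] by (auto simp: indicator_def add_increasing2)
  next
    case False
    then have "norm (f x) powr 1 \<le> norm (f x) powr p"
      using p by (intro powr_mono) auto
    then have "norm (f x) \<le> norm (f x) powr p" using False by simp
    then show ?thesis by (simp add: add_increasing)
  qed
  then show "AE x in lborel. norm (f x) \<le> norm (indicator (ball 0 R) x + norm (f x) powr p)"
    by (auto intro: order_trans[OF _ abs_ge_self])
qed simp

text \<open>The kernel is a probability density that vanishes for |h| \<ge> e. Jensen's inequality
  bounds the p-th power of the error at x by an average of increments over small h, and Tonelli's
  theorem reduces the claim to the continuity of translations.\<close>

lemma mollify_tendsto_Lp:
  fixes f :: "real^'n \<Rightarrow> 'b::euclidean_space"
  assumes [measurable]: "f \<in> borel_measurable borel" and p: "1 \<le> p"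
    and int: "integrable lborel (\<lambda>x. norm (f x) powr p)" and supp: "\<And>x. x \<notin> ball 0 R \<Longrightarrow> f x = 0"
    and \<eta>: "0 < \<eta>"
  shows "\<exists>d>0. \<forall>e. 0 < e \<and> e < d \<longrightarrow>
    (\<integral>\<^sup>+x. ennreal (norm (mollify e f x - f x) powr p) \<partial>lborel) \<le> ennreal \<eta>"
proof -
  obtain d where d: "0 < d" "\<And>h. norm h < d \<Longrightarrow>
     (\<integral>\<^sup>+x. ennreal (norm (f (x + h) - f x) powr p) \<partial>lborel) \<le> ennreal \<eta>"
    using translation_Lp_continuous[OF assms(1) p int supp \<eta>] by blast
  have fi: "integrable lborel f" by (rule integrable_of_powr[OF assms(1) p int supp])
  have "(\<integral>\<^sup>+x. ennreal (norm (mollify e f x - f x) powr p) \<partial>lborel) \<le> ennreal \<eta>"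
      if e: "0 < e" "e < d" for e
  proof -
    note [measurable] = mollifier_measurable[OF e(1)]
    have "(\<integral>\<^sup>+x. ennreal (norm (mollify e f x - f x) powr p) \<partial>lborel)
      \<le> (\<integral>\<^sup>+x. (\<integral>\<^sup>+h. ennreal (mollifier e h * norm (f (x + h) - f x) powr p) \<partial>lborel) \<partial>lborel)"
    proof (rule nn_integral_mono)
      fix x
      note md = mollify_diff[OF e(1) fi, of x "f x"]
      have ki: "integrable lborel (\<lambda>h. mollifier e h * norm (f (x + h) - f x))"
        using integrable_norm[OF md(1)] by (simp add: mollifier_nonneg[OF e(1)])
      have "norm (mollify e f x - f x) \<le> (\<integral>h. norm (mollifier e h *\<^sub>R (f (x + h) - f x)) \<partial>lborel)"
        unfolding md(2) by (rule integral_norm_bound)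
      also have "\<dots> = (\<integral>h. mollifier e h * norm (f (x + h) - f x) \<partial>lborel)"
        by (simp add: mollifier_nonneg[OF e(1)])
      finally have "ennreal (norm (mollify e f x - f x) powr p)
          \<le> ennreal ((\<integral>h. mollifier e h * norm (f (x + h) - f x) \<partial>lborel) powr p)"
        using p by (intro ennreal_leI powr_mono2) auto
      also have "\<dots> \<le> (\<integral>\<^sup>+h. ennreal (mollifier e h * norm (f (x + h) - f x) powr p) \<partial>lborel)"
        using ki by (intro jensen_powr p integrable_mollifier integral_mollifier mollifier_nonneg e)
            auto
      finally show "ennreal (norm (mollify e f x - f x) powr p)
          \<le> (\<integral>\<^sup>+h. ennreal (mollifier e h * norm (f (x + h) - f x) powr p) \<partial>lborel)" .
    qed
    also have "\<dots> = (\<integral>\<^sup>+h. (\<integral>\<^sup>+x. ennreal (mollifier e h * norm (f (x + h)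
        - f x) powr p) \<partial>lborel) \<partial>lborel)"
      by (intro lborel_pair.Fubini'[symmetric]) measurable
    also have "\<dots> = (\<integral>\<^sup>+h. ennreal (mollifier e h) * (\<integral>\<^sup>+x. ennreal (norm (f (x + h)
        - f x) powr p) \<partial>lborel) \<partial>lborel)"
      by (intro nn_integral_cong) (simp add: ennreal_mult nn_integral_cmult mollifier_nonneg[OF
          e(1)])
    also have "\<dots> \<le> (\<integral>\<^sup>+(h::real^'n). ennreal (mollifier e h) * ennreal \<eta> \<partial>lborel)"
    proof (rule nn_integral_mono)
      fix h :: "real^'n"
      show "ennreal (mollifier e h) * (\<integral>\<^sup>+x. ennreal (norm (f (x + h) - f x) powr p) \<partial>lborel)
          \<le> ennreal (mollifier e h) * ennreal \<eta>"
        using d(2)[of h] e mollifier_eq_0[OF e(1), of h]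
            by (cases "norm h < e") (auto intro!: mult_left_mono)
    qed
    also have "\<dots> = (\<integral>\<^sup>+h. ennreal (mollifier e (h::real^'n)) \<partial>lborel) * ennreal \<eta>"
      by (intro nn_integral_multc) measurable
    also have "(\<integral>\<^sup>+h. ennreal (mollifier e (h::real^'n)) \<partial>lborel) = 1"
      using nn_integral_eq_integral[OF integrable_mollifier[OF e(1),
          where 'a='n]] mollifier_nonneg[OF e(1), where 'a='n]
      by (simp add: integral_mollifier[OF e(1)])
    finally show ?thesis by simp
  qed
  with d(1) show ?thesis by blast
qed

lemma mollify_uniform_bound:
  fixes f :: "real^'n \<Rightarrow> 'b::euclidean_space"
  assumes e: "0 < e" and f: "integrable lborel f" and b: "\<And>h. norm h < e \<Longrightarrow> norm (f (x + h) - c) \<le> \<eta>"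
  shows "norm (mollify e f x - c) \<le> \<eta>"
proof -
  note md = mollify_diff[OF e f, of x c]
  have "norm (mollify e f x - c) \<le> (\<integral>h. norm (mollifier e h *\<^sub>R (f (x + h) - c)) \<partial>lborel)"
    unfolding md(2) by (rule integral_norm_bound)
  also have "\<dots> \<le> (\<integral>h. mollifier e (h::real^'n) * \<eta> \<partial>lborel)"
  proof (rule integral_mono)
    fix h :: "real^'n"
    show "norm (mollifier e h *\<^sub>R (f (x + h) - c)) \<le> mollifier e h * \<eta>"
      using b[of h] mollifier_eq_0[OF e, of h] mollifier_nonneg[OF e, of h]
      by (cases "norm h < e") (auto intro!: mult_left_mono)
  qed (use integrable_norm[OF md(1)] integrable_mollifier[OF e] in auto)
  also have "\<dots> = \<eta>"
    by (simp add: integral_mollifier[OF e])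
  finally show ?thesis .
qed

subsection \<open>Weak gradients\<close>

lemma borel_measurable_vec_nth [measurable (raw)]:
  fixes f :: "'a \<Rightarrow> real^'n"
  assumes "f \<in> borel_measurable M"
  shows "(\<lambda>x. f x $ i) \<in> borel_measurable M"
  using assms unfolding cart_eq_inner_axis by measurable

text \<open>Componentwise, from the Borel representatives of real functions measurable with respect
  to the completion.\<close>

lemma lebesgue_ex_borel_rep:
  fixes f :: "'a::euclidean_space \<Rightarrow> 'b::euclidean_space"
  assumes f: "f \<in> borel_measurable lebesgue"
  shows "\<exists>g\<in>borel_measurable borel. AE x in lborel. g x = f x"
proof -
  have "\<forall>i. \<exists>h. h \<in> borel_measurable lborel \<and> (AE x in lborel. f x \<bullet> i = h x)"
  proof
    fix i
    have "(\<lambda>x. f x \<bullet> i) \<in> borel_measurable lebesgue" using f by measurable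
    from completion_ex_borel_measurable_real[OF this]
    show "\<exists>h. h \<in> borel_measurable lborel \<and> (AE x in lborel. f x \<bullet> i = h x)" by blast
  qed
  then obtain h where h: "\<And>i. h i \<in> borel_measurable lborel" "\<And>i. AE x in lborel. f x \<bullet> i = h i x"
    by metis
  have "AE x in lborel. \<forall>i\<in>Basis. f x \<bullet> i = h i x"
    using h(2) by (intro AE_finite_allI) auto
  then have "AE x in lborel. (\<Sum>i\<in>Basis. h i x *\<^sub>R i) = f x"
  proof eventually_elim
    case (elim x)
    then have "(\<Sum>i\<in>Basis. h i x *\<^sub>R i) = (\<Sum>i\<in>Basis. (f x \<bullet> i) *\<^sub>R i)"
      by (intro sum.cong) auto
    then show ?case by (simp add: euclidean_representation)
  qed
  moreover have "(\<lambda>x. \<Sum>i\<in>Basis. h i x *\<^sub>R i) \<in> borel_measurable borel"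
    using h(1) by (intro borel_measurable_sum borel_measurable_scaleR) auto
  ultimately show ?thesis by (rule bexI)
qed

text \<open>Mollification acts on Borel functions on the whole space; cutting off by a compact set
  produces such a function from a field that is only defined and measurable on \<Omega>.\<close>

lemma cutoff_ex_borel_rep:
  fixes G :: "'a::euclidean_space \<Rightarrow> 'b::euclidean_space"
  assumes G: "G \<in> borel_measurable (lebesgue_on \<Omega>)" and \<Omega>: "open \<Omega>" and C: "compact C" "C \<subseteq> \<Omega>"
  obtains g where "g \<in> borel_measurable borel" "AE x in lborel. g x = indicator C x *\<^sub>R G x"
    "\<And>x. x \<notin> C \<Longrightarrow> g x = 0"
proof -
  have "(\<lambda>x. indicator \<Omega> x *\<^sub>R G x) \<in> borel_measurable lebesgue"
    using G \<Omega> by (subst (asm) borel_measurable_restrict_space_iff) (auto simp: borel_open)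
  from lebesgue_ex_borel_rep[OF this] obtain g where
    g: "g \<in> borel_measurable borel" "AE x in lborel. g x = indicator \<Omega> x *\<^sub>R G x" by blast
  show thesis
  proof (rule that[of "\<lambda>x. indicator C x *\<^sub>R g x"])
    show "(\<lambda>x. indicator C x *\<^sub>R g x) \<in> borel_measurable borel"
      using g C by (intro borel_measurable_scaleR borel_measurable_indicator) (auto
          simp: borel_compact)
    show "AE x in lborel. indicator C x *\<^sub>R g x = indicator C x *\<^sub>R G x"
      using g(2) by eventually_elim (use C in \<open>auto simp: indicator_def\<close>)
  qed simp
qed

lemma cutoff_rep_integrable:
  fixes G :: "real^'n \<Rightarrow> 'b::euclidean_space"
  assumes G: "Lp_loc \<Omega> p G" and C: "compact C" "C \<subseteq> \<Omega>" and \<Omega>: "open \<Omega>"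
    and g: "g \<in> borel_measurable borel" "AE x in lborel. g x = indicator C x *\<^sub>R G x"
  shows "integrable lborel (\<lambda>x. norm (g x) powr p)"
proof -
  have "integrable (lebesgue_on C) (\<lambda>x. norm (G x) powr p)"
    using G C by (simp add: Lp_loc_def)
  then have i: "integrable lebesgue (\<lambda>x. indicator C x *\<^sub>R (norm (G x) powr p))"
    using C by (subst (asm) integrable_restrict_space) (auto simp: borel_compact)
  have "AE x in lebesgue. norm (g x) powr p = indicator C x *\<^sub>R (norm (G x) powr p)"
    using AE_completion[OF g(2)] by eventually_elim (simp add: indicator_def)
  with i have "integrable lebesgue (\<lambda>x. norm (g x) powr p)"
    using g(1) by (subst integrable_cong_AE[where g = "\<lambda>x. indicator C x *\<^sub>R (norm (G x) powr p)"])
      (auto dest: borel_measurable_integrable intro!: measurable_completion)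
  then show ?thesis
    using g(1) by (subst (asm) integrable_completion) auto
qed

text \<open>The left-hand side is the gradient of the mollified function. The kernel centred at x
  is, up to the normalising mass \<open>m\<close>, a bump function and thus an admissible test
  function; inserting it into the definition of the weak gradient gives the mollified weak gradient.
  The closed ball of radius \<open>e\<close> must lie in \<open>C\<close> for the cutoff to be
  invisible.\<close>

lemma mollify_weak_gradient:
  fixes w :: "real^'n \<Rightarrow> real"
  assumes wg: "has_weak_gradient \<Omega> w G" and \<Omega>: "open \<Omega>" and C: "C \<subseteq> \<Omega>"
    and f: "f \<in> borel_measurable borel" "AE x in lborel. f x = indicator C x *\<^sub>R w x"
        "integrable lborel f"
    and g: "g \<in> borel_measurable borel" "AE x in lborel. g x = indicator C x *\<^sub>R G x"
        "integrable lborel g"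
    and e: "0 < e" "cball x e \<subseteq> C"
  shows "- (\<integral>y. f y *\<^sub>R mollifier_grad e (y - x) \<partial>lborel) = mollify e g x"
proof -
  define m where "m = (\<integral>y. bump 0 e (0::real^'n) y \<partial>lborel)"
  have m: "0 < m" using bump_mass_pos[OF e(1)] by (simp add: m_def)
  have \<Omega>l: "\<Omega> \<in> sets lebesgue" using \<Omega> by (simp add: borel_open)
  note [measurable] = f(1) g(1) mollifier_measurable[OF e(1)] mollifier_grad_measurable[OF e(1)]
  have wm: "w \<in> borel_measurable (lebesgue_on \<Omega>)" and Gm: "G \<in> borel_measurable (lebesgue_on \<Omega>)"
    using wg by (auto simp: has_weak_gradient_def Lp_loc_def)
  have b: "bump 0 e x y = m * mollifier e (y - x)" for y
    using m by (subst bump_translate) (simp add: mollifier_def m_def)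
  have pb: "partial i (bump 0 e x) y = m * mollifier_grad e (y - x) $ i" for i y
  proof -
    have "bump_grad 0 e x y = bump_grad 0 e 0 (y - x)"
      by (simp add: bump_grad_def bump_def)
    then show ?thesis
      using partial_eq[OF bump_has_derivative[of 0 e x y]] m by (simp add: mollifier_grad_def m_def)
  qed
  have out: "mollifier_grad e (y - x) = 0" "mollifier e (y - x) = 0" if "y \<notin> C" for y
    using that e mollifier_grad_eq_0[OF e(1), of "y - x"] mollifier_eq_0[OF e(1), of "y - x"]
    by (auto simp: subset_iff dist_norm norm_minus_commute not_le)
       (metis less_eq_real_def linorder_not_le norm_minus_commute)+
  have "test_function \<Omega> (bump 0 e x)"
    using e C by (intro test_function_bump) auto
  with wg have wk: "(\<integral>y. w y * partial i (bump 0 e x) y \<partial>lebesgue_on \<Omega>)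
      = - (\<integral>y. G y $ i * bump 0 e x y \<partial>lebesgue_on \<Omega>)" for i
    by (simp add: has_weak_gradient_def)
  have cb: "bump 0 e x \<in> borel_measurable (lebesgue_on \<Omega>)"
    using \<Omega>l by (intro continuous_imp_measurable_on_sets_lebesgue continuous_intros) auto
  have cpb: "partial i (bump 0 e x) \<in> borel_measurable (lebesgue_on \<Omega>)" for i
    using \<Omega>l Ck_bump[of "Suc 0" 0 e x]
    by (intro continuous_imp_measurable_on_sets_lebesgue) (auto intro: continuous_on_subset)
  have e1: "(\<integral>y. w y * partial i (bump 0 e x) y \<partial>lebesgue_on \<Omega>)
      = m * (\<integral>y. f y * mollifier_grad e (y - x) $ i \<partial>lborel)" for i
  proof -
    have "(\<integral>y. w y * partial i (bump 0 e x) y \<partial>lebesgue_on \<Omega>)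
      = (\<integral>y. f y * (m * mollifier_grad e (y - x) $ i) \<partial>lborel)"
    proof (rule integral_lebesgue_on_eq_lborel[OF _ \<Omega>l])
      show "AE y in lborel. f y * (m * mollifier_grad e (y - x) $ i)
          = indicator \<Omega> y *\<^sub>R (w y * partial i (bump 0 e x) y)"
        using f(2) by eventually_elim (use C out in \<open>auto simp: indicator_def pb\<close>)
    qed (use wm cpb in \<open>auto intro!: borel_measurable_times borel_measurable_vec_nth\<close>)
    also have "\<dots> = m * (\<integral>y. f y * mollifier_grad e (y - x) $ i \<partial>lborel)"
      by (subst integral_mult_right_zero[symmetric]) (simp add: mult_ac)
    finally show ?thesis .
  qed
  have e2: "(\<integral>y. G y $ i * bump 0 e x y \<partial>lebesgue_on \<Omega>)
      = m * (\<integral>y. mollifier e (y - x) * g y $ i \<partial>lborel)" for i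
  proof -
    have "(\<integral>y. G y $ i * bump 0 e x y \<partial>lebesgue_on \<Omega>)
      = (\<integral>y. m * (mollifier e (y - x) * g y $ i) \<partial>lborel)"
    proof (rule integral_lebesgue_on_eq_lborel[OF _ \<Omega>l])
      show "AE y in lborel. m * (mollifier e (y - x) * g y $ i)
          = indicator \<Omega> y *\<^sub>R (G y $ i * bump 0 e x y)"
        using g(2) by eventually_elim (use C out in \<open>auto simp: indicator_def b\<close>)
    qed (use Gm cb in \<open>auto intro!: borel_measurable_times borel_measurable_vec_nth\<close>)
    then show ?thesis by simp
  qed
  have "(- (\<integral>y. f y *\<^sub>R mollifier_grad e (y - x) \<partial>lborel)) $ i = mollify e g x $ i" for i
  proof -
    define X where "X = (\<integral>y. f y * mollifier_grad e (y - x) $ i \<partial>lborel)"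
    define Y where "Y = (\<integral>y. mollifier e (y - x) * g y $ i \<partial>lborel)"
    have "(\<integral>y. f y *\<^sub>R mollifier_grad e (y - x) \<partial>lborel) $ i = X"
      using integral_bounded_linear[OF bounded_linear_vec_nth integrable_mollify_grad[OF e(1) f(3),
          of x], of i]
      by (simp add: X_def)
    moreover have "mollify e g x $ i = Y"
      unfolding mollify_def
      using integral_bounded_linear[OF bounded_linear_vec_nth integrable_mollify[OF e(1) g(3), of
          x], of i]
      by (simp add: Y_def)
    moreover have "m * X = - (m * Y)"
      using wk[of i] unfolding e1 e2 X_def Y_def .
    then have "m * (X + Y) = 0" by (simp add: distrib_left)
    then have "X + Y = 0" using m by simp
    ultimately show ?thesis by simp
  qed
  then show ?thesis
    by (simp add: vec_eq_iff)
qed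

text \<open>On the half ball the mollifications of the two gradients agree, both being the gradient
  of the mollified \<open>w\<close>. Their difference therefore has vanishing mollifications there,
  which converge to it in L^1. The margin s / 2 leaves room for the kernel.\<close>

lemma weak_gradient_unique_on_ball:
  fixes w :: "real^'n \<Rightarrow> real"
  assumes wg: "has_weak_gradient \<Omega> w G1" "has_weak_gradient \<Omega> w G2" and \<Omega>: "open \<Omega>"
    and s: "0 < s" "cball c s \<subseteq> \<Omega>"
  shows "AE x in lborel. x \<in> ball c (s / 2) \<longrightarrow> G1 x = G2 x"
proof -
  let ?C = "cball c s"
  have L: "Lp_loc \<Omega> 1 w" "Lp_loc \<Omega> 1 G1" "Lp_loc \<Omega> 1 G2"
    using wg by (auto simp: has_weak_gradient_def)
  have m: "w \<in> borel_measurable (lebesgue_on \<Omega>)" "G1 \<in> borel_measurable (lebesgue_on \<Omega>)"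
      "G2 \<in> borel_measurable (lebesgue_on \<Omega>)"
    using L by (auto simp: Lp_loc_def)
  have cC: "compact ?C" by simp
  obtain f where f: "f \<in> borel_measurable borel" "AE x in lborel. f x = indicator ?C x *\<^sub>R w x"
      "\<And>x. x \<notin> ?C \<Longrightarrow> f x = 0"
    using cutoff_ex_borel_rep[OF m(1) \<Omega> cC s(2)] by blast
  obtain g1 where g1: "g1 \<in> borel_measurable borel" "AE x in lborel. g1 x = indicator ?C x *\<^sub>R G1 x"
      "\<And>x. x \<notin> ?C \<Longrightarrow> g1 x = 0"
    using cutoff_ex_borel_rep[OF m(2) \<Omega> cC s(2)] by blast
  obtain g2 where g2: "g2 \<in> borel_measurable borel" "AE x in lborel. g2 x = indicator ?C x *\<^sub>R G2 x"
      "\<And>x. x \<notin> ?C \<Longrightarrow> g2 x = 0"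
    using cutoff_ex_borel_rep[OF m(3) \<Omega> cC s(2)] by blast
  note [measurable] = f(1) g1(1) g2(1)
  have fi: "integrable lborel f"
    using cutoff_rep_integrable[OF L(1) cC s(2) \<Omega> f(1,2)] by (simp add: integrable_abs_iff)
  have gi: "integrable lborel g1" "integrable lborel g2"
    using cutoff_rep_integrable[OF L(2) cC s(2) \<Omega> g1(1,2)] cutoff_rep_integrable[OF L(3) cC s(2) \<Omega>
        g2(1,2)]
    by (auto simp: integrable_norm_iff)
  define g where "g x = g1 x - g2 x" for x
  have [measurable]: "g \<in> borel_measurable borel" unfolding g_def by measurable
  have gint: "integrable lborel g" unfolding g_def using gi by simp
  have zero: "mollify e g x = 0" if "0 < e" "e < s / 2" "x \<in> ball c (s / 2)" for e x
  proof -
    have "cball x e \<subseteq> ?C"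
    proof
      fix y assume "y \<in> cball x e"
      then have "dist c y \<le> s / 2 + e" using that dist_triangle[of c y x] by simp
      then show "y \<in> ?C" using that by simp
    qed
    from mollify_weak_gradient[OF wg(1) \<Omega> s(2) f(1,2) fi g1(1,2) gi(1) that(1) this]
      mollify_weak_gradient[OF wg(2) \<Omega> s(2) f(1,2) fi g2(1,2) gi(2) that(1) this]
    have "mollify e g1 x = mollify e g2 x" by simp
    then show ?thesis
      unfolding mollify_def g_def scaleR_diff_right
      using integrable_mollify[OF that(1) gi(1), of x] integrable_mollify[OF that(1) gi(2), of x]
      by (subst Bochner_Integration.integral_diff) auto
  qed
  have g0: "g x = 0" if "x \<notin> ball 0 (norm c + s + 1)" for x
  proof -
    have "norm x \<le> norm c + dist c x"
      by (simp add: dist_norm) (metis norm_minus_commute norm_triangle_sub)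
    with that have "x \<notin> ?C" by auto
    then show ?thesis using g1 g2 by (simp add: g_def)
  qed
  have g_int1: "integrable lborel (\<lambda>x. norm (g x) powr 1)"
    using gint by simp
  have [measurable]: "ball c (s / 2) \<in> sets borel" by simp
  have small: "(\<integral>\<^sup>+x. indicator (ball c (s / 2)) x * ennreal (norm (g x)) \<partial>lborel) \<le> 0 + ennreal \<eta>"
      if eta: "0 < \<eta>" for \<eta>
  proof -
    obtain d where d: "0 < d" "\<And>e. 0 < e \<Longrightarrow> e < d
        \<Longrightarrow> (\<integral>\<^sup>+x. ennreal (norm (mollify e g x - g x) powr 1) \<partial>lborel) \<le> ennreal \<eta>"
      using mollify_tendsto_Lp[where R = "norm c + s
          + 1", OF \<open>g \<in> borel_measurable borel\<close> _ g_int1 g0 eta] by auto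
    define e where "e = min d (s / 2) / 2"
    have e: "0 < e" "e < d" "e < s / 2" using d s by (auto simp: e_def)
    have "(\<integral>\<^sup>+x. indicator (ball c (s / 2)) x * ennreal (norm (g x)) \<partial>lborel)
       \<le> (\<integral>\<^sup>+x. ennreal (norm (mollify e g x - g x) powr 1) \<partial>lborel)"
      using zero[OF e(1,3)] by (intro nn_integral_mono) (auto simp: indicator_def)
    with d(2)[OF e(1,2)] show ?thesis by simp
  qed
  have "(\<integral>\<^sup>+x. indicator (ball c (s / 2)) x * ennreal (norm (g x)) \<partial>lborel) \<le> 0"
    by (rule ennreal_le_epsilon) (rule small)
  then have "(\<integral>\<^sup>+x. indicator (ball c (s / 2)) x * ennreal (norm (g x)) \<partial>lborel) = 0"
    by simp
  then have "AE x in lborel. indicator (ball c (s / 2)) x * ennreal (norm (g x)) = 0"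
    by (subst (asm) nn_integral_0_iff_AE) measurable
  then show ?thesis
    using g1(2) g2(2) by eventually_elim (use s in \<open>auto
        simp: indicator_def g_def split: if_splits\<close>)
qed

text \<open>By Lindelof's theorem countably many small balls cover \<Omega>, so that the exceptional
  null sets can be united.\<close>

lemma weak_gradient_unique:
  fixes w :: "real^'n \<Rightarrow> real"
  assumes wg: "has_weak_gradient \<Omega> w G1" "has_weak_gradient \<Omega> w G2" and \<Omega>: "open \<Omega>"
  shows "AE x in lborel. x \<in> \<Omega> \<longrightarrow> G1 x = G2 x"
proof -
  define F where "F = {ball c (s / 2) | c s. 0 < s \<and> cball c s \<subseteq> \<Omega>}"
  have U: "\<Union>F = \<Omega>"
  proof
    show "\<Union>F \<subseteq> \<Omega>" unfolding F_def by force
    show "\<Omega> \<subseteq> \<Union>F"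
    proof
      fix x assume "x \<in> \<Omega>"
      then obtain s where "0 < s" "cball x s \<subseteq> \<Omega>" using \<Omega> open_contains_cball by blast
      then have "ball x (s / 2) \<in> F" "x \<in> ball x (s / 2)" by (auto simp: F_def)
      then show "x \<in> \<Union>F" by blast
    qed
  qed
  obtain F' where F': "F' \<subseteq> F" "countable F'" "\<Union>F' = \<Union>F"
    using Lindelof[of F] by (auto simp: F_def)
  have "AE x in lborel. \<forall>B\<in>F'. x \<in> B \<longrightarrow> G1 x = G2 x"
  proof (subst AE_ball_countable[OF F'(2)], intro ballI)
    fix B assume "B \<in> F'"
    then obtain c s where "B = ball c (s / 2)" "0 < s" "cball c s \<subseteq> \<Omega>"
      using F'(1) by (auto simp: F_def)
    then show "AE x in lborel. x \<in> B \<longrightarrow> G1 x = G2 x"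
      using weak_gradient_unique_on_ball[OF wg \<Omega>] by simp
  qed
  then show ?thesis
    by eventually_elim (use U F' in blast)
qed

text \<open>This makes the choice in \<open>weak_gradient\<close> usable: up to a null set, any
  explicit weak gradient may be substituted for it.\<close>

lemma weak_gradient_eq:
  assumes "has_weak_gradient \<Omega> w G" and "open \<Omega>"
  shows "has_weak_gradient \<Omega> w (weak_gradient \<Omega> w)"
    and "AE x in lborel. x \<in> \<Omega> \<longrightarrow> weak_gradient \<Omega> w x = G x"
proof -
  show h: "has_weak_gradient \<Omega> w (weak_gradient \<Omega> w)"
    unfolding weak_gradient_def by (rule someI[where P = "has_weak_gradient \<Omega> w", OF assms(1)])
  show "AE x in lborel. x \<in> \<Omega> \<longrightarrow> weak_gradient \<Omega> w x = G x"
    by (rule weak_gradient_unique[OF h assms])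
qed

text \<open>The gradient that carries the L^p bound need not be the chosen one; uniqueness a.e.
  transfers the bound.\<close>

lemma W1p_loc_weak_gradient:
  assumes "W1p_loc \<Omega> p w" and \<Omega>: "open \<Omega>"
  shows "has_weak_gradient \<Omega> w (weak_gradient \<Omega> w)" "Lp_loc \<Omega> p (weak_gradient \<Omega> w)"
proof -
  obtain G where G: "has_weak_gradient \<Omega> w G" "Lp_loc \<Omega> p G"
    using assms by (auto simp: W1p_loc_def)
  note wg = weak_gradient_eq[OF G(1) \<Omega>]
  show "has_weak_gradient \<Omega> w (weak_gradient \<Omega> w)" by (rule wg)
  have m: "weak_gradient \<Omega> w \<in> borel_measurable (lebesgue_on \<Omega>)"
      "G \<in> borel_measurable (lebesgue_on \<Omega>)"
    using wg(1) G(1) by (auto simp: has_weak_gradient_def Lp_loc_def)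
  show "Lp_loc \<Omega> p (weak_gradient \<Omega> w)"
    unfolding Lp_loc_def
  proof (intro conjI allI impI m)
    fix K assume K: "compact K \<and> K \<subseteq> \<Omega>"
    have Kl: "K \<in> sets lebesgue" using K by (simp add: borel_compact)
    have mK: "h \<in> borel_measurable (lebesgue_on K)"
        if "h \<in> borel_measurable (lebesgue_on \<Omega>)" for h :: "real^'a \<Rightarrow> real^'a"
      using measurable_restrict_mono[OF that] K by blast
    have "AE x in lebesgue_on K. norm (G x) powr p = norm (weak_gradient \<Omega> w x) powr p"
      using AE_completion[OF wg(2)] Kl K
      by (subst AE_restrict_space_iff) (auto elim!: eventually_mono)
    moreover have "integrable (lebesgue_on K) (\<lambda>x. norm (G x) powr p)"
      using G K by (simp add: Lp_loc_def)
    ultimately show "integrable (lebesgue_on K) (\<lambda>x. norm (weak_gradient \<Omega> w x) powr p)"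
      using mK[OF m(1)] mK[OF m(2)]
      by (subst integrable_cong_AE[where g = "\<lambda>x. norm (G x) powr p"]) (auto simp: eq_commute)
  qed
qed

text \<open>Approximation from below: the mollified function is lowered by the supremum of its error
  on the ball, which leaves the gradient unchanged. Staying below \<open>w\<close> ensures that
  truncations of the approximants vanish wherever the corresponding truncation of \<open>w\<close>
  does.\<close>

lemma W1p_loc_approximation:
  fixes w :: "real^'n \<Rightarrow> real"
  assumes W: "W1p_loc \<Omega> p w" and p: "1 \<le> p" and \<Omega>: "open \<Omega>" and cw: "continuous_on \<Omega> w"
    and d: "0 < d" "d < d2" "cball y d2 \<subseteq> \<Omega>"
  obtains W H where
    "\<And>n x. (W n has_derivative (\<lambda>v. H n x \<bullet> v)) (at x)"
    "\<And>n::nat. continuous_on UNIV (H n)"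
    "\<And>n x. x \<in> cball y d \<Longrightarrow> W n x \<le> w x"
    "\<And>\<eta>. 0 < \<eta> \<Longrightarrow> \<forall>\<^sub>F n in sequentially. \<forall>x\<in>cball y d. w x - W n x \<le> \<eta>"
    "\<And>n. (\<integral>\<^sup>+x. ennreal (norm (H n x - weak_gradient \<Omega> w x) powr p) \<partial>lebesgue_on (cball y d))
        \<le> ennreal (1 / real (Suc n))"
proof -
  let ?C = "cball y d2" and ?G = "weak_gradient \<Omega> w"
  note wg = W1p_loc_weak_gradient[OF W \<Omega>]
  have cC: "compact ?C" by simp
  have Gm: "?G \<in> borel_measurable (lebesgue_on \<Omega>)" using wg by (simp add: Lp_loc_def)
  obtain g where g: "g \<in> borel_measurable borel" "AE x in lborel. g x = indicator ?C x *\<^sub>R ?G x"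
      "\<And>x. x \<notin> ?C \<Longrightarrow> g x = 0"
    using cutoff_ex_borel_rep[OF Gm \<Omega> cC d(3)] by blast
  have inball: "x \<in> ball 0 (norm y + d2 + 1)" if "x \<in> ?C" for x
  proof -
    have "norm x \<le> norm y + dist y x"
      by (simp add: dist_norm) (metis norm_minus_commute norm_triangle_sub)
    with that show ?thesis by simp
  qed
  have g0: "g x = 0" if "x \<notin> ball 0 (norm y + d2 + 1)" for x using that inball g(3) by blast
  have gp: "integrable lborel (\<lambda>x. norm (g x) powr p)"
    by (rule cutoff_rep_integrable[OF wg(2) cC d(3) \<Omega> g(1,2)])
  have gi: "integrable lborel g"
    by (rule integrable_of_powr[OF g(1) p gp g0])
  define f where "f x = indicator ?C x *\<^sub>R w x" for x
  have cwC: "continuous_on ?C w" using cw d by (auto intro: continuous_on_subset)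
  have fi: "integrable lborel f"
    unfolding f_def by (intro borel_integrable_compact cwC) simp
  then have fm: "f \<in> borel_measurable borel" by (auto dest: borel_measurable_integrable)
  have f_eq: "f x = w x" if "x \<in> ?C" for x using that by (simp add: f_def)
  \<comment> \<open>The bound (d2 - d) / (n + 1) keeps the kernel inside the larger ball and forces
    the radii to 0; the second condition prescribes a rate for the gradients.\<close>
  have ex: "\<exists>e. 0 < e \<and> e < (d2 - d) / (real n + 1) \<and>
     (\<integral>\<^sup>+x. ennreal (norm (mollify e g x - g x) powr p) \<partial>lborel) \<le> ennreal (1 / real (Suc n))" for n
  proof -
    obtain t where t: "0 < t" "\<And>e. 0 < e \<Longrightarrow> e < t \<Longrightarrow>
      (\<integral>\<^sup>+x. ennreal (norm (mollify e g x - g x) powr p) \<partial>lborel) \<le> ennreal (1 / real (Suc n))"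
      using mollify_tendsto_Lp[where \<eta> = "1 / real (Suc n)" and R
          = "norm y + d2 + 1", OF g(1) p gp g0] by auto
    define q where "q = (d2 - d) / (real n + 1)"
    have "0 < q" using d by (simp add: q_def)
    with t show ?thesis
      unfolding q_def[symmetric] by (intro exI[of _ "min t q / 2"]) auto
  qed
  obtain e where "\<forall>n. 0 < e n \<and> e n < (d2 - d) / (real n + 1) \<and>
      (\<integral>\<^sup>+x. ennreal (norm (mollify (e n) g x - g x) powr p) \<partial>lborel) \<le> ennreal (1 / real (Suc n))"
    using choice[OF allI[OF ex]] ..
  then have e: "\<And>n. 0 < e n" "\<And>n::nat. e n < (d2 - d) / (real n + 1)"
    "\<And>n. (\<integral>\<^sup>+x. ennreal (norm (mollify (e n) g x - g x) powr p) \<partial>lborel)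
        \<le> ennreal (1 / real (Suc n))"
    by blast+
  have e_small: "e n < d2 - d" for n
  proof -
    have "(d2 - d) / (real n + 1) \<le> d2 - d" using d by (simp add: divide_simps mult_left_le)
    with e(2)[of n] show ?thesis by simp
  qed
  have sub: "x + h \<in> ?C" if "x \<in> cball y d" "norm h \<le> e n" for x h n
  proof -
    have "dist y (x + h) \<le> dist y x + norm h"
      using dist_triangle[of y "x + h" x] by (simp add: dist_norm)
    with that e_small[of n] show ?thesis by simp
  qed
  have sub': "cball x (e n) \<subseteq> ?C" if "x \<in> cball y d" for x n
  proof
    fix z assume "z \<in> cball x (e n)"
    then show "z \<in> ?C" using sub[OF that, of "z - x" n] by (simp add: dist_norm norm_minus_commute)
  qed
  have dC: "x \<in> ?C" if "x \<in> cball y d" for x using that d by simp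
  have unif: "\<forall>\<^sub>F n in sequentially. \<forall>x\<in>cball y d. \<bar>mollify (e n) f x - w x\<bar> \<le> \<eta>" if "0 < \<eta>" for \<eta>
  proof -
    have "uniformly_continuous_on ?C w" by (intro compact_uniformly_continuous cwC) simp
    then have "\<exists>t>0. \<forall>x\<in>?C. \<forall>x'\<in>?C. dist x' x < t \<longrightarrow> dist (w x') (w x) < \<eta>"
      using that by (simp only: uniformly_continuous_on_def)
    then obtain t where t: "0 < t" "\<And>x x'. x \<in> ?C \<Longrightarrow> x' \<in> ?C \<Longrightarrow> dist x' x < t \<Longrightarrow> dist (w x') (w x) < \<eta>"
      by auto
    obtain n0 :: nat where n0: "(d2 - d) / t < real n0" using reals_Archimedean2 by blast
    show ?thesis
      unfolding eventually_sequentially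
    proof (intro exI[of _ n0] allI impI ballI)
      fix n x assume n: "n0 \<le> n" and x: "x \<in> cball y d"
      have "(d2 - d) / t < real n + 1" using n0 n by simp
      then have "(d2 - d) / (real n + 1) < t" using t by (simp add: divide_simps mult.commute)
      then have et: "e n < t" using e(2)[of n] by simp
      have "norm (mollify (e n) f x - w x) \<le> \<eta>"
      proof (rule mollify_uniform_bound[OF e(1) fi])
        fix h :: "real^'n" assume h: "norm h < e n"
        then have "x + h \<in> ?C" using sub[OF x, of h n] by simp
        then have "dist (w (x + h)) (w x) < \<eta>"
          using t(2)[OF dC[OF x], of "x + h"] h et by (simp add: dist_norm)
        then show "norm (f (x + h) - w x) \<le> \<eta>"
          using f_eq[OF \<open>x + h \<in> ?C\<close>] by (simp add: dist_norm)
      qed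
      then show "\<bar>mollify (e n) f x - w x\<bar> \<le> \<eta>" by simp
    qed
  qed
  have "compact (w ` ?C)" using cwC by (intro compact_continuous_image) auto
  then obtain B where B: "\<And>x. x \<in> ?C \<Longrightarrow> \<bar>w x\<bar> \<le> B"
    using compact_imp_bounded bounded_iff by (metis imageI real_norm_def)
  define s where "s n = (SUP x\<in>cball y d. \<bar>mollify (e n) f x - w x\<bar>)" for n
  have bd: "\<bar>mollify (e n) f x - w x\<bar> \<le> 2 * B" if x: "x \<in> cball y d" for x n
  proof -
    have "norm (mollify (e n) f x - w x) \<le> 2 * B"
    proof (rule mollify_uniform_bound[OF e(1) fi])
      fix h :: "real^'n" assume h: "norm h < e n"
      then have xh: "x + h \<in> ?C" using sub[OF x, of h n] by simp
      show "norm (f (x + h) - w x) \<le> 2 * B"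
        using B[OF xh] B[OF dC[OF x]] f_eq[OF xh] by simp
    qed
    then show ?thesis by simp
  qed
  have s_ge: "\<bar>mollify (e n) f x - w x\<bar> \<le> s n" if "x \<in> cball y d" for x n
    unfolding s_def using bd by (intro cSUP_upper[OF that]) (auto intro!: bdd_aboveI2)
  have s_le: "s n \<le> \<eta>" if "\<forall>x\<in>cball y d. \<bar>mollify (e n) f x - w x\<bar> \<le> \<eta>" for n \<eta>
    unfolding s_def using that d by (intro cSUP_least) auto
  define W where "W n x = mollify (e n) f x - s n" for n x
  define H where "H n x = - (\<integral>z. f z *\<^sub>R mollifier_grad (e n) (z - x) \<partial>lborel)" for n x
  show thesis
  proof (rule that[of W H])
    show "(W n has_derivative (\<lambda>v. H n x \<bullet> v)) (at x)" for n x
      unfolding W_def[abs_def] H_def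
      using has_derivative_diff[OF mollify_has_derivative[OF e(1) fi] has_derivative_const] by simp
    show "continuous_on UNIV (H n)" for n
      unfolding H_def[abs_def] by (rule continuous_on_mollify_grad[OF e(1) fi])
    show "W n x \<le> w x" if "x \<in> cball y d" for n x
      using s_ge[OF that, of n] by (simp add: W_def)
    show "\<forall>\<^sub>F n in sequentially. \<forall>x\<in>cball y d. w x - W n x \<le> \<eta>" if "0 < \<eta>" for \<eta>
    proof -
      \<comment> \<open>Half of the tolerance is spent on the mollification error, half on the shift
        \<open>s n\<close>.\<close>
      have "0 < \<eta> / 2" using that by simp
      from unif[OF this] show ?thesis
      proof eventually_elim
        case (elim n)
        have "w x - W n x \<le> \<eta>" if "x \<in> cball y d" for x
        proof -
          have "\<bar>mollify (e n) f x - w x\<bar> \<le> \<eta> / 2" using elim that by blast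
          moreover have "s n \<le> \<eta> / 2" by (rule s_le[OF elim])
          ultimately show ?thesis unfolding W_def by linarith
        qed
        then show ?case by blast
      qed
    qed
    show "(\<integral>\<^sup>+x. ennreal (norm (H n x - ?G x) powr p) \<partial>lebesgue_on (cball y d))
        \<le> ennreal (1 / real (Suc n))" for n
    proof -
      have Hg: "H n x = mollify (e n) g x" if "x \<in> cball y d" for x
        unfolding H_def
        by (rule mollify_weak_gradient[OF wg(1) \<Omega> d(3) fm _ fi g(1,2) gi e(1) sub'[OF that]])
            (simp add: f_def)
      have "(\<integral>\<^sup>+x. ennreal (norm (H n x - ?G x) powr p) \<partial>lebesgue_on (cball y d))
        = (\<integral>\<^sup>+x. ennreal (norm (H n x - ?G x) powr p) * indicator (cball y d) x \<partial>lebesgue)"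
        by (intro nn_integral_restrict_space) simp
      also have "\<dots> \<le> (\<integral>\<^sup>+x. ennreal (norm (mollify (e n) g x - g x) powr p) \<partial>lebesgue)"
      proof (rule nn_integral_mono_AE)
        show "AE x in lebesgue. ennreal (norm (H n x - ?G x) powr p) * indicator (cball y d) x
            \<le> ennreal (norm (mollify (e n) g x - g x) powr p)"
          using AE_completion[OF g(2)]
          by eventually_elim (use Hg dC in \<open>auto simp: indicator_def\<close>)
      qed
      also have "\<dots> = (\<integral>\<^sup>+x. ennreal (norm (mollify (e n) g x - g x) powr p) \<partial>lborel)"
        by (rule nn_integral_completion)
      also have "\<dots> \<le> ennreal (1 / real (Suc n))" by (rule e(3))
      finally show ?thesis .
    qed
  qed
qed

subsection \<open>Coercive fluxes\<close>

lemma max_powr_has_derivative: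
  fixes q t :: real
  assumes q: "1 < q"
  shows "((\<lambda>t. max 0 t powr q) has_real_derivative q * max 0 t powr (q - 1)) (at t)"
proof (cases t "0::real" rule: linorder_cases)
  case less
  have "((\<lambda>_. 0) has_real_derivative 0) (at t)" by simp
  moreover have "eventually (\<lambda>s. s < 0) (nhds t)"
    using less order_tendstoD(2) tendsto_ident_at eventually_nhds_conv_at by blast
  ultimately have "((\<lambda>t. max 0 t powr q) has_real_derivative 0) (at t)"
    by (subst DERIV_cong_ev[of t t _ "\<lambda>_. 0"]) (auto elim!: eventually_mono simp: max_def)
  then show ?thesis using less by (simp add: max_def)
next
  case greater
  have "((\<lambda>t. t powr q) has_real_derivative q * t powr (q - 1)) (at t)"
    using greater by (auto intro!: derivative_eq_intros simp: powr_diff)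
  moreover have "eventually (\<lambda>s. s > 0) (nhds t)"
    using greater order_tendstoD(1) tendsto_ident_at eventually_nhds_conv_at by blast
  ultimately show ?thesis
    using greater by (subst DERIV_cong_ev[of t t _ "\<lambda>t. t powr q"]) (auto elim!: eventually_mono
        simp: max_def)
next
  case equal
  have "((\<lambda>s::real. \<bar>s\<bar> powr (q - 1)) \<longlongrightarrow> \<bar>0\<bar> powr (q - 1)) (at 0)"
    using q by (intro tendsto_powr' tendsto_intros) auto
  then have l: "((\<lambda>s::real. \<bar>s\<bar> powr (q - 1)) \<longlongrightarrow> 0) (at 0)" by simp
  have "((\<lambda>s. max 0 s powr q / s) \<longlongrightarrow> 0) (at 0)"
  proof (rule Lim_null_comparison[OF _ l])
    have "norm (max 0 s powr q / s) \<le> \<bar>s\<bar> powr (q - 1)" for s :: real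
    proof (cases "0 < s")
      case True
      then show ?thesis using q by (simp add: max_def powr_diff)
    qed (simp add: max_def)
    then show "\<forall>\<^sub>F s in at 0. norm (max 0 s powr q / s) \<le> \<bar>s\<bar> powr (q - 1)" by simp
  qed
  then show ?thesis
    using equal q by (simp add: DERIV_def)
qed

text \<open>Young's inequality with a free parameter and without optimal constants: depending on
  which factor dominates, one of the two summands alone bounds the product.\<close>

lemma young_product:
  fixes \<alpha> \<beta> \<eta> p :: real
  assumes "0 \<le> \<alpha>" "0 \<le> \<beta>" "0 < \<eta>" "1 < p"
  shows "\<alpha> * \<beta> \<le> \<eta> * \<alpha> powr (p / (p - 1)) + \<eta> powr (1 - p) * \<beta> powr p"
proof (cases "\<beta> \<le> \<eta> * \<alpha> powr (1 / (p - 1))")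
  case True
  have "\<alpha> * \<beta> \<le> \<alpha> * (\<eta> * \<alpha> powr (1 / (p - 1)))"
    using True assms by (intro mult_left_mono) auto
  also have "\<dots> = \<eta> * (\<alpha> * \<alpha> powr (1 / (p - 1)))" by simp
  also have "\<alpha> * \<alpha> powr (1 / (p - 1)) = \<alpha> powr (1 + 1 / (p - 1))"
    using assms by (intro powr_mult_base)
  also have "1 + 1 / (p - 1) = p / (p - 1)"
    using assms by (simp add: field_simps)
  finally show ?thesis using assms by (simp add: add_increasing2)
next
  case False
  then have b: "0 < \<beta>" "\<alpha> powr (1 / (p - 1)) \<le> \<beta> / \<eta>"
    using assms by (auto simp: field_simps not_le intro: le_less_trans[of 0 "\<eta> * \<alpha> powr (1 / (p
        - 1))"])
  have "\<alpha> = (\<alpha> powr (1 / (p - 1))) powr (p - 1)"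
    using assms by (cases "\<alpha> = 0") (auto simp: powr_powr)
  also have "\<dots> \<le> (\<beta> / \<eta>) powr (p - 1)"
    using b assms by (intro powr_mono2) auto
  finally have "\<alpha> * \<beta> \<le> (\<beta> / \<eta>) powr (p - 1) * \<beta>"
    using b by (intro mult_right_mono) auto
  also have "\<dots> = \<eta> powr (1 - p) * \<beta> powr p"
    using assms b powr_mult_base[of \<beta> "p - 1"] powr_minus[of \<eta> "p - 1"]
    by (simp add: powr_divide field_simps)
  finally show ?thesis using assms by (simp add: add_increasing)
qed

text \<open>The effect of Hoelder's inequality, obtained from Young's: first \<eta> is chosen so
  small that the part with \<alpha> is negligible, then n so large that the rate of \<beta>
  outweighs the factor \<open>\<eta> powr (1 - p)\<close>.\<close>

lemma nn_integral_pairing_tendsto_0: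
  fixes \<alpha> :: "'a \<Rightarrow> real" and \<beta> :: "nat \<Rightarrow> 'a \<Rightarrow> real"
  assumes p: "1 < p" and \<alpha>: "\<alpha> \<in> borel_measurable M" "\<And>x. 0 \<le> \<alpha> x"
      "integrable M (\<lambda>x. \<alpha> x powr (p / (p - 1)))"
    and \<beta>: "\<And>n. \<beta> n \<in> borel_measurable M" "\<And>n x. 0 \<le> \<beta> n x"
      "\<And>n. (\<integral>\<^sup>+x. ennreal (\<beta> n x powr p) \<partial>M) \<le> ennreal (1 / real (Suc n))"
  shows "integrable M (\<lambda>x. \<alpha> x * \<beta> n x)" and "(\<lambda>n. \<integral>x. \<alpha> x * \<beta> n x \<partial>M) \<longlonglongrightarrow> 0"
proof -
  note [measurable] = \<alpha>(1) \<beta>(1)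
  have bi: "integrable M (\<lambda>x. \<beta> n x powr p)" for n
    using \<beta>(3)[of n] by (intro integrableI_nonneg) (auto intro: le_less_trans)
  have bl: "(\<integral>x. \<beta> n x powr p \<partial>M) \<le> 1 / real (Suc n)" for n
    using \<beta>(3)[of n] by (subst (asm) nn_integral_eq_integral[OF bi]) auto
  show abi: "integrable M (\<lambda>x. \<alpha> x * \<beta> n x)" for n
  proof (rule Bochner_Integration.integrable_bound)
    show "integrable M (\<lambda>x. \<alpha> x powr (p / (p - 1)) + \<beta> n x powr p)" using \<alpha>(3) bi by simp
    show "AE x in M. norm (\<alpha> x * \<beta> n x) \<le> norm (\<alpha> x powr (p / (p - 1)) + \<beta> n x powr p)"
      using young_product[OF \<alpha>(2) \<beta>(2), of 1 p] p \<alpha>(2) \<beta>(2) by (intro AE_I2) simp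
  qed measurable
  define I where "I = (\<integral>x. \<alpha> x powr (p / (p - 1)) \<partial>M)"
  have I: "0 \<le> I" by (simp add: I_def)
  have le: "(\<integral>x. \<alpha> x * \<beta> n x \<partial>M) \<le> \<eta> * I + \<eta> powr (1 - p) * (1 / real (Suc n))" if "0 < \<eta>" for n \<eta>
  proof -
    have "(\<integral>x. \<alpha> x * \<beta> n x \<partial>M) \<le> (\<integral>x. \<eta> * \<alpha> x powr (p / (p - 1)) + \<eta> powr (1
        - p) * \<beta> n x powr p \<partial>M)"
      using abi \<alpha>(3) bi young_product[OF \<alpha>(2) \<beta>(2) that p] by (intro integral_mono) auto
    also have "\<dots> = \<eta> * I + \<eta> powr (1 - p) * (\<integral>x. \<beta> n x powr p \<partial>M)"
      using \<alpha>(3) bi by (simp add: I_def)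
    also have "\<dots> \<le> \<eta> * I + \<eta> powr (1 - p) * (1 / real (Suc n))"
      using bl[of n] by (intro add_left_mono mult_left_mono) auto
    finally show ?thesis .
  qed
  show "(\<lambda>n. \<integral>x. \<alpha> x * \<beta> n x \<partial>M) \<longlonglongrightarrow> 0"
  proof (rule LIMSEQ_I)
    fix r :: real assume r: "0 < r"
    define \<eta> where "\<eta> = r / (2 * (I + 1))"
    have \<eta>: "0 < \<eta>" using r I by (simp add: \<eta>_def)
    have "\<eta> * I \<le> \<eta> * (I + 1)" using \<eta> by (intro mult_left_mono) auto
    also have "\<dots> = r / 2" using I by (simp add: \<eta>_def divide_simps)
    finally have 1: "\<eta> * I \<le> r / 2" .
    obtain N :: nat where N: "2 * \<eta> powr (1 - p) / r < real N" using reals_Archimedean2 by blast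
    show "\<exists>no. \<forall>n\<ge>no. norm ((\<integral>x. \<alpha> x * \<beta> n x \<partial>M) - 0) < r"
    proof (intro exI[of _ N] allI impI)
      fix n assume "N \<le> n"
      then have "2 * \<eta> powr (1 - p) / r < real (Suc n)" using N by simp
      then have "\<eta> powr (1 - p) * (1 / real (Suc n)) < r / 2"
        using r by (simp add: divide_simps mult.commute)
      with 1 le[OF \<eta>, of n] have "(\<integral>x. \<alpha> x * \<beta> n x \<partial>M) < r" by linarith
      moreover have "0 \<le> (\<integral>x. \<alpha> x * \<beta> n x \<partial>M)"
        using \<alpha>(2) \<beta>(2) by (intro integral_nonneg_AE) auto
      ultimately show "norm ((\<integral>x. \<alpha> x * \<beta> n x \<partial>M) - 0) < r" by simp
    qed
  qed
qed

text \<open>The growth constant c in |A| \<le> c |\<eta>|^(p-1), which is the second coercivity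
  inequality raised to the power (p - 1) / p.\<close>

definition flux_const :: "real \<Rightarrow> real \<Rightarrow> real \<Rightarrow> real" where
  "flux_const p K1 K2 = (K1 / K2) powr ((p - 1) / p)"

text \<open>With c the growth constant and |Q| \<le> T, the product of the flux with Q is at most c
  |\<eta>|^(p-1) T. Above the threshold |\<eta>| = (2c / K1) T half of the coercive term absorbs
  this; below it, the value at the threshold is this constant times T^p.\<close>

definition energy_const :: "real \<Rightarrow> real \<Rightarrow> real \<Rightarrow> real" where
  "energy_const p K1 K2 = flux_const p K1 K2 * (2 * flux_const p K1 K2 / K1) powr (p - 1)"

lemma energy_const_pos: "0 < K1 \<Longrightarrow> 0 < K2 \<Longrightarrow> 0 < energy_const p K1 K2"
  by (simp add: energy_const_def flux_const_def)

lemma coercive_flux_bound: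
  assumes A: "strongly_coercive \<Omega> p K1 K2 A" and p: "1 < p" and x: "x \<in> \<Omega>" "0 \<le> t"
  shows "norm (A x t \<eta>) \<le> flux_const p K1 K2 * norm \<eta> powr (p - 1)"
proof -
  have K: "0 < K1" "0 < K2" using A by (auto simp: strongly_coercive_def)
  have "K2 * norm (A x t \<eta>) powr (p / (p - 1)) \<le> K1 * norm \<eta> powr p"
    using A x by (auto simp: strongly_coercive_def)
  then have "norm (A x t \<eta>) powr (p / (p - 1)) \<le> K1 / K2 * norm \<eta> powr p"
    using K by (simp add: field_simps)
  then have "(norm (A x t \<eta>) powr (p / (p - 1))) powr ((p - 1) / p)
      \<le> (K1 / K2 * norm \<eta> powr p) powr ((p - 1) / p)"
    using p by (intro powr_mono2) auto
  also have "\<dots> = (K1 / K2) powr ((p - 1) / p) * (norm \<eta> powr p) powr ((p - 1) / p)"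
    by (rule powr_mult)
  finally show ?thesis
    using p by (simp add: flux_const_def powr_powr)
qed

text \<open>In the application \<eta> is the gradient of the solution and \<open>Q\<close> that of
  the paraboloid, so the flux is paired with the gradient of a difference and not with its own
  argument.\<close>

lemma coercive_shifted:
  assumes A: "strongly_coercive \<Omega> p K1 K2 A" and p: "1 < p" and x: "x \<in> \<Omega>" "0 \<le> t"
    and Q: "norm Q \<le> T"
  shows "K1 / 2 * norm \<eta> powr p - energy_const p K1 K2 * T powr p \<le> A x t \<eta> \<bullet> (\<eta> - Q)"
proof -
  define c where "c = flux_const p K1 K2"
  have K: "0 < K1" "0 < K2" using A by (auto simp: strongly_coercive_def)
  have c: "0 < c" using K by (simp add: c_def flux_const_def)
  have T: "0 \<le> T" using Q norm_ge_zero order_trans by blast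
  have "A x t \<eta> \<bullet> Q \<le> norm (A x t \<eta>) * norm Q" by (rule norm_cauchy_schwarz)
  also have "\<dots> \<le> (c * norm \<eta> powr (p - 1)) * T"
    using coercive_flux_bound[OF A p x] Q by (intro mult_mono) (auto simp: c_def flux_const_def)
  also have "\<dots> \<le> K1 / 2 * norm \<eta> powr p + energy_const p K1 K2 * T powr p"
  proof (cases "2 * c / K1 * T \<le> norm \<eta>")
    case True
    then have "c * T \<le> K1 / 2 * norm \<eta>" using K by (simp add: field_simps)
    then have "(c * T) * norm \<eta> powr (p - 1) \<le> (K1 / 2 * norm \<eta>) * norm \<eta> powr (p - 1)"
      by (intro mult_right_mono) auto
    also have "\<dots> = K1 / 2 * norm \<eta> powr p"
      using powr_mult_base[of "norm \<eta>" "p - 1"] by simp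
    also have "\<dots> \<le> K1 / 2 * norm \<eta> powr p + energy_const p K1 K2 * T powr p"
      using energy_const_pos[OF K, of p] by simp
    finally show ?thesis by (simp add: mult_ac)
  next
    case False
    then have "norm \<eta> powr (p - 1) \<le> (2 * c / K1 * T) powr (p - 1)"
      using p by (intro powr_mono2) auto
    also have "\<dots> = (2 * c / K1) powr (p - 1) * T powr (p - 1)"
      by (rule powr_mult)
    finally have "(c * norm \<eta> powr (p - 1)) * T
        \<le> (c * ((2 * c / K1) powr (p - 1) * T powr (p - 1))) * T"
      using c T by (intro mult_right_mono mult_left_mono) auto
    also have "\<dots> = energy_const p K1 K2 * (T * T powr (p - 1))"
      by (simp add: energy_const_def c_def)
    also have "T * T powr (p - 1) = T powr p"
      using powr_mult_base[OF T, of "p - 1"] by simp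
    finally show ?thesis using K by (simp add: add_increasing)
  qed
  finally have "A x t \<eta> \<bullet> Q \<le> K1 / 2 * norm \<eta> powr p + energy_const p K1 K2 * T powr p" .
  moreover have "K1 * norm \<eta> powr p \<le> A x t \<eta> \<bullet> \<eta>"
    using A x by (auto simp: strongly_coercive_def)
  ultimately show ?thesis
    by (simp add: inner_diff_right)
qed

subsection \<open>Energy estimates for subsolutions\<close>

definition pos_powr :: "real \<Rightarrow> real \<Rightarrow> real" where
  "pos_powr q t = max 0 t powr q"

lemma pos_powr_nonneg [simp]: "0 \<le> pos_powr q t"
  by (simp add: pos_powr_def)

lemma pos_powr_nonpos [simp]: "t \<le> 0 \<Longrightarrow> pos_powr q t = 0"
  by (simp add: pos_powr_def max_def)

lemma pos_powr_mono: "0 \<le> q \<Longrightarrow> s \<le> t \<Longrightarrow> pos_powr q s \<le> pos_powr q t"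
  unfolding pos_powr_def by (intro powr_mono2) auto

lemma continuous_on_pos_powr [continuous_intros]:
  "0 < q \<Longrightarrow> continuous_on S f \<Longrightarrow> continuous_on S (\<lambda>x. pos_powr q (f x))"
  unfolding pos_powr_def by (intro continuous_on_powr' continuous_intros) auto

lemma integral_lebesgue_on_subset:
  fixes f :: "'a::euclidean_space \<Rightarrow> 'b::euclidean_space"
  assumes "S \<subseteq> \<Omega>" "S \<in> sets lebesgue" "\<Omega> \<in> sets lebesgue" "\<And>x. x \<in> \<Omega> \<Longrightarrow> x \<notin> S \<Longrightarrow> f x = 0"
  shows "(\<integral>x. f x \<partial>lebesgue_on \<Omega>) = (\<integral>x. f x \<partial>lebesgue_on S)"
proof -
  have "(\<integral>x. f x \<partial>lebesgue_on \<Omega>) = (\<integral>x. indicator \<Omega> x *\<^sub>R f x \<partial>lebesgue)"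
    using assms by (intro integral_restrict_space) simp
  also have "\<dots> = (\<integral>x. indicator S x *\<^sub>R f x \<partial>lebesgue)"
    using assms by (intro Bochner_Integration.integral_cong) (auto simp: indicator_def)
  also have "\<dots> = (\<integral>x. f x \<partial>lebesgue_on S)"
    using assms by (intro integral_restrict_space[symmetric]) simp
  finally show ?thesis .
qed

lemma nn_integral_lborel_eq_lebesgue_on:
  assumes "S \<in> sets lebesgue" "\<And>x. x \<notin> S \<Longrightarrow> f x = 0"
  shows "(\<integral>\<^sup>+x. f x \<partial>lborel) = (\<integral>\<^sup>+x. f x \<partial>lebesgue_on S)"
proof -
  have "(\<integral>\<^sup>+x. f x \<partial>lborel) = (\<integral>\<^sup>+x. f x \<partial>lebesgue)"
    by (rule nn_integral_completion[symmetric])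
  also have "\<dots> = (\<integral>\<^sup>+x. f x * indicator S x \<partial>lebesgue)"
    using assms by (intro nn_integral_cong) (auto simp: indicator_def)
  also have "\<dots> = (\<integral>\<^sup>+x. f x \<partial>lebesgue_on S)"
    using assms by (intro nn_integral_restrict_space[symmetric]) simp
  finally show ?thesis .
qed

text \<open>Each inequality of the system is an instance, the other unknown entering only through
  the given absorption term \<open>h\<close>. The single-equation estimates thus serve both unknowns
  and both exponents.\<close>

locale subsolution =
  fixes \<Omega> :: "(real^'n) set" and p K1 K2 :: real and A :: "'n flux" and w h :: "real^'n \<Rightarrow> real"
  assumes \<Omega>: "open \<Omega>" and p: "1 < p" and coercive: "strongly_coercive \<Omega> p K1 K2 A"
    and W1p: "W1p_loc \<Omega> p w" and cont: "continuous_on \<Omega> w" and nonneg: "\<And>x. x \<in> \<Omega> \<Longrightarrow> 0 \<le> w x"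
    and cont_h: "continuous_on \<Omega> h" and nonneg_h: "\<And>x. x \<in> \<Omega> \<Longrightarrow> 0 \<le> h x"
    and weakly: "weakly_le \<Omega> p A w (\<lambda>x. - h x)"
begin

lemma K_pos: "0 < K1" "0 < K2"
  using coercive by (auto simp: strongly_coercive_def)

end

text \<open>Instead of cutting off, the test functions vanish near the sphere because \<open>w\<close> is compared with
  a paraboloid that lies above \<open>w\<close> there.\<close>

locale subsolution_below_paraboloid = subsolution +
  fixes y :: "real^'n" and d d2 c k :: real
  assumes d: "0 < d" "d < d2" "cball y d2 \<subseteq> \<Omega>" and c: "0 < c"
    and sphere: "\<And>x. dist y x = d \<Longrightarrow> w x < k + c * (norm (x - y))\<^sup>2"
begin

text \<open>\<open>Q\<close> is the gradient of the paraboloid and \<open>T\<close> bounds it on the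
  ball, so that formally the gradient of \<open>z\<close> is \<open>G - Q\<close>; \<open>a\<close>
  is the flux of the solution.\<close>

definition z :: "real^'n \<Rightarrow> real" where "z x = w x - (k + c * (norm (x - y))\<^sup>2)"
definition Q :: "real^'n \<Rightarrow> real^'n" where "Q x = (2 * c) *\<^sub>R (x - y)"
definition T :: real where "T = 2 * c * d"
definition M :: "(real^'n) measure" where "M = lebesgue_on (cball y d)"
definition G :: "real^'n \<Rightarrow> real^'n" where "G = weak_gradient \<Omega> w"
definition a :: "real^'n \<Rightarrow> real^'n" where "a x = A x (w x) (G x)"

lemma T_pos: "0 < T" using c d by (simp add: T_def)

lemma cball_subset: "cball y d \<subseteq> \<Omega>" using d by auto

lemma space_M: "space M = cball y d" by (simp add: M_def)

lemma norm_Q_le: "x \<in> cball y d \<Longrightarrow> norm (Q x) \<le> T"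
  using c by (simp add: Q_def T_def dist_norm norm_minus_commute)

lemma cont_z: "continuous_on (cball y d) z"
  unfolding z_def using cball_subset by (intro continuous_intros continuous_on_subset[OF cont]) auto

lemma measurable_M: "continuous_on (cball y d) f \<Longrightarrow> f \<in> borel_measurable M"
  unfolding M_def by (intro continuous_imp_measurable_on_sets_lebesgue) auto

lemma measurable_M_of_\<Omega>: "f \<in> borel_measurable (lebesgue_on \<Omega>) \<Longrightarrow> f \<in> borel_measurable M"
  unfolding M_def using measurable_restrict_mono cball_subset by blast

lemma G_props: "G \<in> borel_measurable (lebesgue_on \<Omega>)" "integrable M (\<lambda>x. norm (G x) powr p)"
  using W1p_loc_weak_gradient[OF W1p \<Omega>] cball_subset by (auto simp: Lp_loc_def G_def M_def)

lemma a_props: "a \<in> borel_measurable (lebesgue_on \<Omega>)"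
    "integrable M (\<lambda>x. norm (a x) powr (p / (p - 1)))"
  using weakly cball_subset by (auto simp: weakly_le_def Lp_loc_def G_def M_def a_def[abs_def])

lemma finite_M: "finite_measure M"
  unfolding M_def by (intro finite_measure_lebesgue_on) auto

lemma bounded_integrable_M:
  fixes f :: "real^'n \<Rightarrow> real"
  assumes "continuous_on (cball y d) f"
  shows "integrable M f"
proof -
  interpret finite_measure M by (rule finite_M)
  have "compact (f ` cball y d)" using assms by (intro compact_continuous_image) auto
  then obtain B where B: "\<And>x. x \<in> cball y d \<Longrightarrow> norm (f x) \<le> B"
    using compact_imp_bounded bounded_iff by (metis imageI)
  then show ?thesis
    using measurable_M[OF assms] by (intro integrable_const_bound[of _ B]) (auto intro!: AE_I2
        simp: space_M)
qed

end

text \<open>Admissible stand-ins for \<open>pos_powr (p + 1) (z x) / (p + 1)\<close>, whose formal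
  gradient is \<open>pos_powr p (z x)\<close> times \<open>G - Q\<close>. An exponent above 1 makes
  the truncation continuously differentiable across the boundary of its support. The assumptions
  collect what the limit passage uses: domination by \<open>z\<close>, pointwise convergence, and
  convergence of the gradients in L^p at a rate.\<close>

locale test_sequence = subsolution_below_paraboloid \<Omega> p K1 K2 A w h y d d2 c k
  for \<Omega> :: "(real^'n) set" and p K1 K2 A w h y d d2 c k +
  fixes f :: "nat \<Rightarrow> real^'n \<Rightarrow> real" and g H :: "nat \<Rightarrow> real^'n \<Rightarrow> real^'n"
    and \<zeta> :: "nat \<Rightarrow> real^'n \<Rightarrow> real"
  assumes fd: "(f n has_derivative (\<lambda>v. g n x \<bullet> v)) (at x)" and cg: "continuous_on UNIV (g n)"
    and f0: "x \<notin> cball y d \<or> z x \<le> 0 \<Longrightarrow> f n x = 0"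
    and g0: "x \<notin> cball y d \<or> z x \<le> 0 \<Longrightarrow> g n x = 0"
    and f_eq: "x \<in> cball y d \<Longrightarrow> f n x = pos_powr (p + 1) (\<zeta> n x) / (p + 1)"
    and g_eq: "x \<in> cball y d \<Longrightarrow> g n x = pos_powr p (\<zeta> n x) *\<^sub>R (H n x - Q x)"
    and \<zeta>z: "x \<in> cball y d \<Longrightarrow> \<zeta> n x \<le> z x"
    and \<zeta>lim: "x \<in> cball y d \<Longrightarrow> (\<lambda>n. \<zeta> n x) \<longlonglongrightarrow> z x"
    and c\<zeta>: "continuous_on UNIV (\<zeta> n)" and cH: "continuous_on UNIV (H n)"
    and HG: "(\<integral>\<^sup>+x. ennreal (norm (H n x - G x) powr p) \<partial>M) \<le> ennreal (1 / real (Suc n))"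
    and test: "W1infty \<Omega> (f n) \<and> compactly_supported_in \<Omega> (f n) \<and> has_weak_gradient \<Omega> (f n) (g n)"

text \<open>Since \<open>z\<close> is negative on the sphere, the set where \<open>z\<close> is
  nonnegative is a compact subset of the open ball. The approximants lie below \<open>z\<close>, so
  their truncations vanish outside this one set and extend by zero as continuously differentiable
  functions.\<close>

lemma (in subsolution_below_paraboloid) ex_test_sequence:
  "\<exists>f g H \<zeta>. test_sequence \<Omega> p K1 K2 A w h y d d2 c k f g H \<zeta>"
proof -
  have "1 \<le> p" using p by simp
  from W1p_loc_approximation[OF W1p this \<Omega> cont d]
  obtain W H where
    W: "\<And>n x. (W n has_derivative (\<lambda>v. H n x \<bullet> v)) (at x)"
    and H: "\<And>n::nat. continuous_on UNIV (H n)"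
    and Wle: "\<And>n x. x \<in> cball y d \<Longrightarrow> W n x \<le> w x"
    and Wu: "\<And>\<eta>. 0 < \<eta> \<Longrightarrow> \<forall>\<^sub>F n in sequentially. \<forall>x\<in>cball y d. w x - W n x \<le> \<eta>"
    and HG: "\<And>n. (\<integral>\<^sup>+x. ennreal (norm (H n x - weak_gradient \<Omega> w x) powr p) \<partial>lebesgue_on (cball y
        d)) \<le> ennreal (1 / real (Suc n))"
    by blast
  define \<zeta> where "\<zeta> n x = W n x - (k + c * (norm (x - y))\<^sup>2)" for n x
  define f where "f n x = (if x \<in> ball y d then pos_powr (p + 1) (\<zeta> n x) / (p + 1) else 0)" for n x
  define g where "g n x = (if x \<in> ball y d then pos_powr p (\<zeta> n x) *\<^sub>R (H n x
      - Q x) else 0)" for n x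
  define K0 where "K0 = cball y d \<inter> z -` {0..}"
  have "closed K0" unfolding K0_def by (intro continuous_closed_preimage cont_z) auto
  then have K0: "compact K0"
    unfolding compact_eq_bounded_closed by (auto
        simp: K0_def intro: bounded_subset[OF bounded_cball])
  have zs: "z x < 0" if "dist y x = d" for x using sphere[OF that] by (simp add: z_def)
  have K0b: "K0 \<subseteq> ball y d"
  proof
    fix x assume "x \<in> K0"
    then have "dist y x \<le> d" "dist y x \<noteq> d" using zs[of x] by (auto simp: K0_def)
    then show "x \<in> ball y d" by simp
  qed
  have \<zeta>z: "\<zeta> n x \<le> z x" if "x \<in> cball y d" for n x
    using Wle[OF that] by (simp add: \<zeta>_def z_def)
  have f_eq: "f n x = pos_powr (p + 1) (\<zeta> n x) / (p + 1)" if "x \<in> cball y d" for n x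
    using that zs[of x] \<zeta>z[OF that, of n] by (auto simp: f_def)
  have g_eq: "g n x = pos_powr p (\<zeta> n x) *\<^sub>R (H n x - Q x)" if "x \<in> cball y d" for n x
    using that zs[of x] \<zeta>z[OF that, of n] by (auto simp: g_def)
  have f0: "f n x = 0" if "x \<notin> cball y d \<or> z x \<le> 0" for n x
    using that \<zeta>z[of x n] by (auto simp: f_def)
  have g0: "g n x = 0" if "x \<notin> cball y d \<or> z x \<le> 0" for n x
    using that \<zeta>z[of x n] by (auto simp: g_def)
  have f0': "f n x = 0" and g0': "g n x = 0" if "x \<notin> K0" for n x
    using that f0[of x n] g0[of x n] by (auto simp: K0_def)
  have \<zeta>d: "(\<zeta> n has_derivative (\<lambda>v. (H n x - Q x) \<bullet> v)) (at x)" for n x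
  proof -
    have "((\<lambda>x. W n x - (k + c * ((x - y) \<bullet> (x - y)))) has_derivative (\<lambda>v. (H n x
        - Q x) \<bullet> v)) (at x)"
      by (rule has_derivative_eq_rhs, (rule derivative_eq_intros W refl)+)
         (auto simp: Q_def fun_eq_iff inner_diff_left inner_diff_right inner_commute algebra_simps)
    then show ?thesis by (simp add: \<zeta>_def[abs_def] power2_norm_eq_inner)
  qed
  have c\<zeta>: "continuous_on UNIV (\<zeta> n)" for n
    using has_derivative_continuous[OF \<zeta>d] by (intro continuous_at_imp_continuous_on) blast
  have fd: "(f n has_derivative (\<lambda>v. g n x \<bullet> v)) (at x)" for n x
  proof (cases "x \<in> ball y d")
    case True
    have "((\<lambda>t. pos_powr (p + 1) t / (p + 1)) has_real_derivative pos_powr p (\<zeta> n x)) (at (\<zeta> n x))"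
      using DERIV_cdivide[OF max_powr_has_derivative[of "p + 1" "\<zeta> n x"], of "p + 1"] p
      by (simp add: pos_powr_def[abs_def])
    from DERIV_compose_FDERIV[OF this \<zeta>d]
    have "((\<lambda>x. pos_powr (p + 1) (\<zeta> n x) / (p + 1)) has_derivative (\<lambda>v. g n x \<bullet> v)) (at x)"
      using True by (simp add: g_def mult.commute)
    then show ?thesis
      by (rule has_derivative_transform_within_open[where s
          = "ball y d"]) (use True in \<open>auto simp: f_def\<close>)
  next
    case False
    then have x: "x \<in> - K0" using K0b by auto
    have "((\<lambda>x. 0) has_derivative (\<lambda>v. g n x \<bullet> v)) (at x)"
      using g0'[of x n] x by simp
    then show ?thesis
      by (rule has_derivative_transform_within_open[where s = "- K0"])
         (use x \<open>closed K0\<close> f0' in auto)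
  qed
  \<comment> \<open>The open ball and the complement of \<open>K0\<close> are open sets covering the
    whole space, and \<open>g n\<close> has a continuous expression on each.\<close>
  have cg: "continuous_on UNIV (g n)" for n
  proof -
    have "continuous_on (ball y d) (\<lambda>x. pos_powr p (\<zeta> n x) *\<^sub>R (H n x - Q x))"
      unfolding Q_def using p
      by (intro continuous_intros continuous_on_subset[OF c\<zeta>] continuous_on_subset[OF H]) auto
    then have "continuous_on (ball y d) (g n)"
      by (rule continuous_on_eq) (simp add: g_def)
    moreover have "continuous_on (- K0) (g n)"
      by (rule continuous_on_eq[OF continuous_on_const[of _ 0]]) (use g0' in auto)
    ultimately have "continuous_on (ball y d \<union> - K0) (g n)"
      using \<open>closed K0\<close> by (intro continuous_on_open_Un) auto
    moreover have "ball y d \<union> - K0 = UNIV" using K0b by auto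
    ultimately show ?thesis by simp
  qed
  have K0\<Omega>: "K0 \<subseteq> \<Omega>" using cball_subset by (auto simp: K0_def)
  have lim: "(\<lambda>n. \<zeta> n x) \<longlonglongrightarrow> z x" if x: "x \<in> cball y d" for x
  proof (rule tendstoI)
    fix e :: real assume "0 < e"
    then have "0 < e / 2" by simp
    from Wu[OF this] show "\<forall>\<^sub>F n in sequentially. dist (\<zeta> n x) (z x) < e"
    proof eventually_elim
      case (elim n)
      then have "w x - W n x \<le> e / 2" using x by blast
      then show ?case using Wle[OF x, of n] \<open>0 < e\<close> by (simp add: dist_real_def \<zeta>_def z_def)
    qed
  qed
  have "test_sequence \<Omega> p K1 K2 A w h y d d2 c k f g H \<zeta>"
    using fd cg f0 g0 f_eq g_eq \<zeta>z lim c\<zeta> H HG W1infty_C1[OF fd cg K0 K0\<Omega> f0' g0' \<Omega>]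
      has_weak_gradient_C1[OF fd cg K0 K0\<Omega> f0' g0' \<Omega>]
    by unfold_locales (simp_all add: M_def G_def)
  then show ?thesis by blast
qed

section \<open>Measurability and integrable majorants\<close>

context subsolution_below_paraboloid
begin

abbreviation C0 :: real where "C0 \<equiv> energy_const p K1 K2"

lemma open_superlevel: "open {x \<in> ball y d. 0 < z x}"
proof -
  have "open (z -` {0<..} \<inter> ball y d)"
    by (rule continuous_on_open_vimage[THEN iffD1, rule_format])
       (use cont_z in \<open>auto intro: continuous_on_subset\<close>)
  moreover have "z -` {0<..} \<inter> ball y d = {x \<in> ball y d. 0 < z x}" by auto
  ultimately show ?thesis by simp
qed

lemma cont_pos_powr_z: "0 < q \<Longrightarrow> continuous_on (cball y d) (\<lambda>x. pos_powr q (z x))"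
  by (intro continuous_intros cont_z)

text \<open>A common bound for the truncation of \<open>z\<close> and, by approximation from below,
  for those of all approximants; it enters the majorants of the limit passage.\<close>

definition B :: real where "B = (SUP x\<in>cball y d. pos_powr p (z x))"

lemma pos_powr_z_le_B: "x \<in> cball y d \<Longrightarrow> pos_powr p (z x) \<le> B"
proof -
  have "compact ((\<lambda>x. pos_powr p (z x)) ` cball y d)"
    using cont_pos_powr_z p by (intro compact_continuous_image) auto
  then show "x \<in> cball y d \<Longrightarrow> pos_powr p (z x) \<le> B"
    unfolding B_def by (intro cSUP_upper bounded_imp_bdd_above compact_imp_bounded)
qed

lemma B_nonneg: "0 \<le> B"
  using order_trans[OF pos_powr_nonneg pos_powr_z_le_B[of y]] d by simp

lemma z_measurable [measurable]:
  "(\<lambda>x. pos_powr p (z x)) \<in> borel_measurable M" "(\<lambda>x. pos_powr (p + 1) (z x)) \<in> borel_measurable M"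
  using p by (auto intro!: measurable_M cont_pos_powr_z)

lemma field_measurable [measurable]:
  "G \<in> borel_measurable M" "a \<in> borel_measurable M" "Q \<in> borel_measurable M"
      "h \<in> borel_measurable M"
proof -
  show "G \<in> borel_measurable M" "a \<in> borel_measurable M"
    using measurable_M_of_\<Omega>[OF G_props(1)] measurable_M_of_\<Omega>[OF a_props(1)] by auto
  show "Q \<in> borel_measurable M"
    unfolding Q_def by (intro measurable_M continuous_intros)
  show "h \<in> borel_measurable M"
    by (rule measurable_M[OF continuous_on_subset[OF cont_h cball_subset]])
qed

lemma integrable_G_pos_powr: "integrable M (\<lambda>x. norm (G x) powr p * pos_powr p (z x))"
proof (rule Bochner_Integration.integrable_bound)
  show "integrable M (\<lambda>x. norm (G x) powr p * B)" using G_props by simp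
  show "AE x in M. norm (norm (G x) powr p * pos_powr p (z x)) \<le> norm (norm (G x) powr p * B)"
    using pos_powr_z_le_B
    by (intro AE_I2) (auto simp: space_M abs_mult intro!: mult_left_mono order_trans[OF _
        abs_ge_self])
qed measurable

lemma integrable_G: "integrable M (\<lambda>x. norm (G x))"
proof -
  interpret finite_measure M by (rule finite_M)
  show ?thesis
  proof (rule Bochner_Integration.integrable_bound)
    show "integrable M (\<lambda>x. 1 + norm (G x) powr p)" using G_props by simp
    have "norm (G x) \<le> 1 + norm (G x) powr p" for x
      using young_product[of 1 "norm (G x)" 1 p] p by simp
    then show "AE x in M. norm (norm (G x)) \<le> norm (1 + norm (G x) powr p)"
      by (intro AE_I2) (auto intro: order_trans[OF _ abs_ge_self])
  qed measurable
qed

lemma integrable_mass: "integrable M (\<lambda>x. (norm (G x) + T) * pos_powr p (z x))"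
proof -
  interpret finite_measure M by (rule finite_M)
  show ?thesis
  proof (rule Bochner_Integration.integrable_bound)
    show "integrable M (\<lambda>x. (norm (G x) + T) * B)"
      using integrable_G by simp
    show "AE x in M. norm ((norm (G x) + T) * pos_powr p (z x)) \<le> norm ((norm (G x) + T) * B)"
      using pos_powr_z_le_B B_nonneg T_pos by (auto intro!: AE_I2 mult_left_mono
          simp: space_M abs_mult)
  qed measurable
qed

end

section \<open>Passage to the limit along the test functions\<close>

context test_sequence
begin

definition F :: "nat \<Rightarrow> real^'n \<Rightarrow> real" where "F n x = pos_powr (p + 1) (\<zeta> n x) / (p + 1)"
definition F' :: "nat \<Rightarrow> real^'n \<Rightarrow> real" where "F' n x = pos_powr p (\<zeta> n x)"
definition e :: "nat \<Rightarrow> real^'n \<Rightarrow> real" where "e n x = norm (H n x - G x)"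

lemma F_measurable [measurable]: "F n \<in> borel_measurable M" "F' n \<in> borel_measurable M"
  unfolding F_def F'_def using p
  by (auto intro!: measurable_M continuous_intros continuous_on_subset[OF c\<zeta>])

lemma H_measurable [measurable]: "H n \<in> borel_measurable M"
  using cH by (intro measurable_M) (auto intro: continuous_on_subset)

lemma e_measurable [measurable]: "e n \<in> borel_measurable M"
  unfolding e_def by measurable

lemma F'_le: "x \<in> cball y d \<Longrightarrow> F' n x \<le> pos_powr p (z x)"
  unfolding F'_def using \<zeta>z p by (intro pos_powr_mono) auto

lemma F'_bounds: "0 \<le> F' n x" "x \<in> cball y d \<Longrightarrow> F' n x \<le> B"
  using order_trans[OF F'_le pos_powr_z_le_B] by (auto simp: F'_def)

lemma F_le: "x \<in> cball y d \<Longrightarrow> F n x \<le> pos_powr (p + 1) (z x) / (p + 1)"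
  unfolding F_def using \<zeta>z p by (intro divide_right_mono pos_powr_mono) auto

lemma F_nonneg: "0 \<le> F n x"
  using p by (simp add: F_def)

lemma F'_tendsto: "x \<in> cball y d \<Longrightarrow> (\<lambda>n. F' n x) \<longlonglongrightarrow> pos_powr p (z x)"
  unfolding F'_def pos_powr_def using p \<zeta>lim by (intro tendsto_powr' tendsto_intros) auto

lemma F_tendsto: "x \<in> cball y d \<Longrightarrow> (\<lambda>n. F n x) \<longlonglongrightarrow> pos_powr (p + 1) (z x) / (p + 1)"
  unfolding F_def pos_powr_def using p \<zeta>lim by
      (intro tendsto_divide tendsto_powr' tendsto_intros) auto

lemma f_eq_F: "x \<in> space M \<Longrightarrow> f n x = F n x"
  using f_eq by (simp add: space_M F_def)

lemma e_nonneg: "0 \<le> e n x"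
  by (simp add: e_def)

lemma e_powr: "(\<integral>\<^sup>+x. ennreal (e n x powr p) \<partial>M) \<le> ennreal (1 / real (Suc n))"
  using HG by (simp add: e_def)

lemma a_e: "integrable M (\<lambda>x. norm (a x) * e n x)" "(\<lambda>n. \<integral>x. norm (a x) * e n x \<partial>M) \<longlonglongrightarrow> 0"
  by (rule nn_integral_pairing_tendsto_0[OF p _ _ a_props(2) e_measurable e_nonneg e_powr]; simp)+

lemma e_integral: "integrable M (e n)" "(\<lambda>n. \<integral>x. e n x \<partial>M) \<longlonglongrightarrow> 0"
proof -
  interpret finite_measure M by (rule finite_M)
  have one: "(\<lambda>x. 1) \<in> borel_measurable M" "\<And>x. (0::real) \<le> 1"
      "integrable M (\<lambda>x. 1 powr (p / (p - 1)))"
    by auto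
  note nn_integral_pairing_tendsto_0[OF p one e_measurable e_nonneg e_powr, simplified]
  then show "integrable M (e n)" "(\<lambda>n. \<integral>x. e n x \<partial>M) \<longlonglongrightarrow> 0" by auto
qed

text \<open>The weak formulation pairs the flux with the chosen weak gradient of the test function,
  which is replaced a.e. by the explicit \<open>g n\<close>. All integrals then shrink to the ball,
  outside which the test function vanishes.\<close>

lemma weak_inequality: "(\<integral>x. a x \<bullet> g n x \<partial>M) + (\<integral>x. h x * f n x \<partial>M) \<le> 0"
proof -
  have \<Omega>l: "\<Omega> \<in> sets lebesgue" "cball y d \<in> sets lebesgue" using \<Omega> by (auto simp: borel_open)
  have fn0: "0 \<le> f n x" for x
    using f0[of x n] f_eq[of x n] p by (cases "x \<in> cball y d") auto
  have tn: "has_weak_gradient \<Omega> (f n) (g n)" using test by blast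
  have gm: "g n \<in> borel_measurable (lebesgue_on \<Omega>)"
    using cg \<Omega>l by (intro continuous_imp_measurable_on_sets_lebesgue)
        (auto intro: continuous_on_subset)
  have wgm: "weak_gradient \<Omega> (f n) \<in> borel_measurable (lebesgue_on \<Omega>)"
    using weak_gradient_eq(1)[OF tn \<Omega>] unfolding has_weak_gradient_def Lp_loc_def by blast
  have "(\<integral>x. A x (w x) (weak_gradient \<Omega> w x) \<bullet> weak_gradient \<Omega> (f n) x \<partial>lebesgue_on \<Omega>)
        \<le> (\<integral>x. - h x * f n x \<partial>lebesgue_on \<Omega>)"
    using weakly[unfolded weakly_le_def, THEN conjunct2, THEN conjunct2, THEN conjunct2, THEN
        conjunct2,
        rule_format, of "f n"] test[of n] fn0 by simp
  moreover have "(\<integral>x. A x (w x) (weak_gradient \<Omega> w x) \<bullet> weak_gradient \<Omega> (f n) x \<partial>lebesgue_on \<Omega>)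
      = (\<integral>x. a x \<bullet> g n x \<partial>lebesgue_on \<Omega>)"
  proof (rule integral_cong_AE)
    have "AE x in lborel. x \<in> \<Omega> \<longrightarrow> weak_gradient \<Omega> (f n) x = g n x"
      by (rule weak_gradient_eq(2)[OF tn \<Omega>])
    from AE_completion[OF this] \<Omega>l(1)
    show "AE x in lebesgue_on \<Omega>. A x (w x) (weak_gradient \<Omega> w x) \<bullet> weak_gradient \<Omega> (f n) x
        = a x \<bullet> g n x"
      by (subst AE_restrict_space_iff) (auto elim!: eventually_mono simp: a_def G_def)
  qed (use a_props(1) gm wgm in \<open>auto simp: a_def[abs_def] G_def intro!: borel_measurable_inner\<close>)
  moreover have "(\<integral>x. a x \<bullet> g n x \<partial>lebesgue_on \<Omega>) = (\<integral>x. a x \<bullet> g n x \<partial>M)"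
    unfolding M_def using cball_subset \<Omega>l g0 by (intro integral_lebesgue_on_subset) auto
  moreover have "(\<integral>x. - h x * f n x \<partial>lebesgue_on \<Omega>) = (\<integral>x. - h x * f n x \<partial>M)"
    unfolding M_def using cball_subset \<Omega>l f0 by (intro integral_lebesgue_on_subset) auto
  moreover have "(\<integral>x. - h x * f n x \<partial>M) = - (\<integral>x. h x * f n x \<partial>M)"
    by simp
  ultimately show ?thesis by linarith
qed

text \<open>The flux term is split by writing \<open>H n - Q\<close> as \<open>G - Q\<close> plus
  \<open>H n - G\<close>. The first part converges by domination; the second vanishes because the
  flux has an integrable power p / (p - 1) and the gradients converge in L^p. Coercivity is applied
  only after the limit, because it relates the flux to the gradient \<open>G\<close> at which it is
  evaluated and not to the mollified gradient.\<close>

lemma energy_limit: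
  "(\<integral>x. h x * (pos_powr (p + 1) (z x) / (p + 1)) \<partial>M)
      + K1 / 2 * (\<integral>x. norm (G x) powr p * pos_powr p (z x) \<partial>M)
    \<le> C0 * T powr p * (\<integral>x. pos_powr p (z x) \<partial>M)"
proof -
  interpret finite_measure M by (rule finite_M)
  have iaG: "integrable M (\<lambda>x. norm (a x) * (norm (G x) + T))"
  proof (rule Bochner_Integration.integrable_bound)
    show "integrable M (\<lambda>x. (norm (a x) powr (p / (p - 1)) + norm (G x) powr p)
        + (norm (a x) powr (p / (p - 1)) + T powr p))"
      using a_props(2) G_props by simp
    have "norm (a x) * (norm (G x) + T) \<le> (norm (a x) powr (p / (p - 1)) + norm (G x) powr p)
        + (norm (a x) powr (p / (p - 1)) + T powr p)" for x
      using young_product[of "norm (a x)" "norm (G x)" 1 p] young_product[of "norm (a x)" T 1 p] p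
          T_pos
      by (simp add: distrib_left)
    then show "AE x in M. norm (norm (a x) * (norm (G x) + T))
        \<le> norm ((norm (a x) powr (p / (p - 1)) + norm (G x) powr p) + (norm (a x) powr (p / (p - 1))
        + T powr p))"
      using T_pos by (intro AE_I2) (auto simp: abs_mult intro: order_trans[OF _ abs_ge_self])
  qed measurable
  have aGQ: "norm (a x \<bullet> (G x - Q x)) \<le> norm (a x) * (norm (G x) + T)" if "x \<in> cball y d" for x
  proof -
    have "norm (a x \<bullet> (G x - Q x)) \<le> norm (a x) * norm (G x - Q x)"
      using Cauchy_Schwarz_ineq2 by simp
    also have "norm (G x - Q x) \<le> norm (G x) + T"
      using norm_triangle_ineq4[of "G x" "Q x"] norm_Q_le[OF that] by linarith
    finally show ?thesis by (simp add: mult_left_mono)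
  qed
  \<comment> \<open>The limit of the main part of the flux term, which coercivity bounds from
    below.\<close>
  define X where "X = (\<integral>x. (a x \<bullet> (G x - Q x)) * pos_powr p (z x) \<partial>M)"
  have iX: "integrable M (\<lambda>x. (norm (a x) * (norm (G x) + T)) * B)" using iaG by simp
  have dom: "norm ((a x \<bullet> (G x - Q x)) * t) \<le> (norm (a x) * (norm (G x) + T)) * B"
    if "x \<in> cball y d" "0 \<le> t" "t \<le> B" for x t
  proof -
    have "norm ((a x \<bullet> (G x - Q x)) * t) = norm (a x \<bullet> (G x - Q x)) * t"
      using that by (simp add: abs_mult)
    also have "\<dots> \<le> (norm (a x) * (norm (G x) + T)) * B"
      using aGQ[OF that(1)] that(2,3) T_pos by (intro mult_mono) auto
    finally show ?thesis .
  qed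
  have L1: "(\<lambda>n. \<integral>x. (a x \<bullet> (G x - Q x)) * F' n x \<partial>M) \<longlonglongrightarrow> X"
    unfolding X_def
  proof (rule integral_dominated_convergence[OF _ _ iX])
    show "AE x in M. (\<lambda>n. (a x \<bullet> (G x - Q x)) * F' n x) \<longlonglongrightarrow> (a x \<bullet> (G x - Q x)) * pos_powr p (z x)"
      using F'_tendsto by (intro AE_I2 tendsto_mult_left) (auto simp: space_M)
    show "AE x in M. norm ((a x \<bullet> (G x - Q x)) * F' n x)
        \<le> (norm (a x) * (norm (G x) + T)) * B" for n
      using dom F'_bounds by (intro AE_I2) (simp add: space_M)
  qed measurable
  have I1: "integrable M (\<lambda>x. (a x \<bullet> (G x - Q x)) * F' n x)" for n
    by (rule Bochner_Integration.integrable_bound[OF iX], measurable)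
       (use dom F'_bounds in \<open>auto intro!: AE_I2 order_trans[OF _ abs_ge_self]
           simp: space_M simp del: norm_mult\<close>)
  have IX: "integrable M (\<lambda>x. (a x \<bullet> (G x - Q x)) * pos_powr p (z x))"
    by (rule Bochner_Integration.integrable_bound[OF iX], measurable)
       (use dom pos_powr_z_le_B in \<open>auto intro!: AE_I2 order_trans[OF _ abs_ge_self]
           simp: space_M simp del: norm_mult\<close>)
  have aeB: "norm ((a x \<bullet> (H n x - G x)) * F' n x) \<le> B * (norm (a x) * e n x)"
      if "x \<in> cball y d" for x n
  proof -
    have "norm ((a x \<bullet> (H n x - G x)) * F' n x) = norm (a x \<bullet> (H n x - G x)) * F' n x"
      using F'_bounds by (simp add: abs_mult)
    also have "\<dots> \<le> (norm (a x) * e n x) * B"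
      using Cauchy_Schwarz_ineq2[of "a x" "H n x - G x"] F'_bounds that
          by (intro mult_mono) (auto simp: e_def)
    finally show ?thesis by (simp add: mult.commute)
  qed
  have I2: "integrable M (\<lambda>x. (a x \<bullet> (H n x - G x)) * F' n x)" for n
    by (rule Bochner_Integration.integrable_bound[OF integrable_mult_right[OF a_e(1)[of n], of B]],
        measurable)
       (use aeB in \<open>auto intro!: AE_I2 order_trans[OF _ abs_ge_self]
           simp: space_M simp del: norm_mult\<close>)
  have L2: "(\<lambda>n. \<integral>x. (a x \<bullet> (H n x - G x)) * F' n x \<partial>M) \<longlonglongrightarrow> 0"
  proof (rule Lim_null_comparison)
    show "(\<lambda>n. B * (\<integral>x. norm (a x) * e n x \<partial>M)) \<longlonglongrightarrow> 0"
      using tendsto_mult_right_zero[OF a_e(2)] by simp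
    have "norm (\<integral>x. (a x \<bullet> (H n x - G x)) * F' n x \<partial>M) \<le> B * (\<integral>x. norm (a x) * e n x \<partial>M)" for n
    proof -
      have "norm (\<integral>x. (a x \<bullet> (H n x - G x)) * F' n x \<partial>M)
          \<le> (\<integral>x. norm ((a x \<bullet> (H n x - G x)) * F' n x) \<partial>M)"
        by (rule integral_norm_bound)
      also have "\<dots> \<le> (\<integral>x. B * (norm (a x) * e n x) \<partial>M)"
        using aeB integrable_norm[OF I2] integrable_mult_right[OF a_e(1)[of n], of B]
        by (intro integral_mono) (auto simp: space_M)
      finally show ?thesis by simp
    qed
    then show "\<forall>\<^sub>F n in sequentially. norm (\<integral>x. (a x \<bullet> (H n x - G x)) * F' n x \<partial>M)
        \<le> B * (\<integral>x. norm (a x) * e n x \<partial>M)"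
      by simp
  qed
  have ag: "(\<integral>x. a x \<bullet> g n x \<partial>M) = (\<integral>x. (a x \<bullet> (G x - Q x)) * F' n x \<partial>M) + (\<integral>x. (a x \<bullet> (H n x
      - G x)) * F' n x \<partial>M)" for n
  proof -
    have "(\<integral>x. a x \<bullet> g n x \<partial>M) = (\<integral>x. (a x \<bullet> (G x - Q x)) * F' n x + (a x \<bullet> (H n x
        - G x)) * F' n x \<partial>M)"
      by (intro Bochner_Integration.integral_cong) (auto
          simp: space_M F'_def g_eq inner_diff_right algebra_simps)
    then show ?thesis using I1 I2 by simp
  qed
  have ihF: "integrable M (\<lambda>x. h x * (pos_powr (p + 1) (z x) / (p + 1)))"
    using p by (intro bounded_integrable_M continuous_intros continuous_on_subset[OF cont_h
        cball_subset] cont_z) auto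
  have L3: "(\<lambda>n. \<integral>x. h x * f n x \<partial>M) \<longlonglongrightarrow> (\<integral>x. h x * (pos_powr (p + 1) (z x) / (p + 1)) \<partial>M)"
  proof (rule integral_dominated_convergence[OF _ _ ihF])
    show "AE x in M. (\<lambda>n. h x * f n x) \<longlonglongrightarrow> h x * (pos_powr (p + 1) (z x) / (p + 1))"
      using F_tendsto by (intro AE_I2 tendsto_mult_left) (auto
          simp: space_M f_eq_F[unfolded space_M])
    show "AE x in M. norm (h x * f n x) \<le> h x * (pos_powr (p + 1) (z x) / (p + 1))" for n
    proof (rule AE_I2)
      fix x assume x: "x \<in> space M"
      then have "x \<in> cball y d" "0 \<le> h x" using cball_subset nonneg_h by (auto simp: space_M)
      then show "norm (h x * f n x) \<le> h x * (pos_powr (p + 1) (z x) / (p + 1))"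
        using mult_left_mono[OF F_le[of x n]] F_nonneg[of n x] f_eq_F[OF x, of n]
            by (simp add: abs_mult)
    qed
    show "(\<lambda>x. h x * f n x) \<in> borel_measurable M" for n
      by (subst measurable_cong[where g = "\<lambda>x. h x * F n x"]) (simp add: f_eq_F, measurable)
  qed measurable
  have lim0: "X + 0 + (\<integral>x. h x * (pos_powr (p + 1) (z x) / (p + 1)) \<partial>M) \<le> 0"
  proof (rule LIMSEQ_le_const2)
    show "(\<lambda>n. (\<integral>x. a x \<bullet> g n x \<partial>M) + (\<integral>x. h x * f n x \<partial>M)) \<longlonglongrightarrow>
        X + 0 + (\<integral>x. h x * (pos_powr (p + 1) (z x) / (p + 1)) \<partial>M)"
      unfolding ag by (intro tendsto_add L1 L2 L3)
  qed (use weak_inequality in auto)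
  have iz: "integrable M (\<lambda>x. pos_powr p (z x))"
    using p by (intro bounded_integrable_M cont_pos_powr_z) simp
  have "K1 / 2 * (\<integral>x. norm (G x) powr p * pos_powr p (z x) \<partial>M)
      - C0 * T powr p * (\<integral>x. pos_powr p (z x) \<partial>M)
    = (\<integral>x. K1 / 2 * (norm (G x) powr p * pos_powr p (z x)) - C0 * T powr p * pos_powr p (z x) \<partial>M)"
    using iz integrable_G_pos_powr by simp
  also have "\<dots> \<le> X"
    unfolding X_def
  proof (rule integral_mono)
    fix x assume "x \<in> space M"
    then have x: "x \<in> cball y d" "x \<in> \<Omega>" using cball_subset by (auto simp: space_M)
    have "(K1 / 2 * norm (G x) powr p - C0 * T powr p) * pos_powr p (z x)
        \<le> (a x \<bullet> (G x - Q x)) * pos_powr p (z x)"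
      unfolding a_def using coercive_shifted[OF coercive p x(2) nonneg[OF x(2)] norm_Q_le[OF x(1)]]
      by (intro mult_right_mono) auto
    then show "K1 / 2 * (norm (G x) powr p * pos_powr p (z x)) - C0 * T powr p * pos_powr p (z x)
        \<le> (a x \<bullet> (G x - Q x)) * pos_powr p (z x)"
      by (simp add: algebra_simps)
  qed (use IX iz integrable_G_pos_powr in auto)
  finally show "(\<integral>x. h x * (pos_powr (p + 1) (z x) / (p + 1)) \<partial>M)
      + K1 / 2 * (\<integral>x. norm (G x) powr p * pos_powr p (z x) \<partial>M)
    \<le> C0 * T powr p * (\<integral>x. pos_powr p (z x) \<partial>M)"
    using lim0 by linarith
qed

text \<open>All approximants have truncations supported in the one set where \<open>z\<close> is
  positive, so the L^1 inequality applies with the same radius \<open>r\<close> for every n; this is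
  where approximation from below is used. The gradient error is multiplied by at most
  \<open>B\<close> and disappears in the limit.\<close>

lemma mass_limit:
  assumes r: "0 < r" "emeasure lborel (ball (0::real^'n) r) = ennreal (2 * m)" "0 < m"
      "emeasure lborel {x \<in> ball y d. 0 < z x} = ennreal m"
  shows "(\<integral>x. pos_powr (p + 1) (z x) / (p + 1) \<partial>M)
    \<le> 2 * r * (\<integral>x. (norm (G x) + T) * pos_powr p (z x) \<partial>M)"
proof -
  have sph: "z x < 0" if "dist y x = d" for x using sphere[OF that] by (simp add: z_def)
  have fk: "(\<integral>x. F n x \<partial>M) \<le> 2 * r * ((\<integral>x. (norm (G x) + T) * pos_powr p (z x) \<partial>M)
      + B * (\<integral>x. e n x \<partial>M))" for n
  proof -
    have "(\<integral>\<^sup>+x. ennreal \<bar>f n x\<bar> \<partial>lborel) \<le> ennreal (2 * r)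
        * (\<integral>\<^sup>+x. ennreal (norm (g n x)) \<partial>lborel)"
    proof (rule faber_krahn_L1[OF fd cg _ r(4) r(3) _ r(1,2)])
      show "{x \<in> ball y d. 0 < z x} \<in> sets borel" using open_superlevel by (rule borel_open)
      fix x assume "x \<notin> {x \<in> ball y d. 0 < z x}"
      then have "x \<notin> cball y d \<or> z x \<le> 0" using sph[of x] by force
      then show "f n x = 0" by (rule f0)
    qed
    moreover have "(\<integral>\<^sup>+x. ennreal \<bar>f n x\<bar> \<partial>lborel) = (\<integral>\<^sup>+x. ennreal \<bar>f n x\<bar> \<partial>M)"
      unfolding M_def using f0 by (intro nn_integral_lborel_eq_lebesgue_on) auto
    moreover have "(\<integral>\<^sup>+x. ennreal (norm (g n x)) \<partial>lborel) = (\<integral>\<^sup>+x. ennreal (norm (g n x)) \<partial>M)"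
      unfolding M_def using g0 by (intro nn_integral_lborel_eq_lebesgue_on) auto
    moreover have "(\<integral>\<^sup>+x. ennreal \<bar>f n x\<bar> \<partial>M) = (\<integral>\<^sup>+x. ennreal (F n x) \<partial>M)"
      using f_eq_F F_nonneg by (intro nn_integral_cong) simp
    moreover have iF: "integrable M (F n)"
      unfolding F_def using p by (intro bounded_integrable_M continuous_intros
          continuous_on_subset[OF c\<zeta>]) auto
    moreover have ig: "integrable M (\<lambda>x. (norm (G x) + T) * pos_powr p (z x) + B * e n x)"
      using integrable_mass e_integral(1) by simp
    moreover have "(\<integral>\<^sup>+x. ennreal (norm (g n x)) \<partial>M)
        \<le> (\<integral>\<^sup>+x. ennreal ((norm (G x) + T) * pos_powr p (z x) + B * e n x) \<partial>M)"
    proof (rule nn_integral_mono, rule ennreal_leI)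
      fix x assume "x \<in> space M"
      then have x: "x \<in> cball y d" by (simp add: space_M)
      have "norm (g n x) = F' n x * norm (H n x - Q x)"
        using g_eq[OF x] F'_bounds(1)[of n x] by (simp add: F'_def)
      also have "\<dots> \<le> F' n x * ((norm (G x) + T) + e n x)"
      proof (rule mult_left_mono)
        show "norm (H n x - Q x) \<le> (norm (G x) + T) + e n x"
          using norm_triangle_ineq4[of "H n x" "Q x"] norm_triangle_sub[of "H n x"
              "G x"] norm_Q_le[OF x]
          by (simp add: e_def)
      qed (rule F'_bounds)
      also have "\<dots> = (norm (G x) + T) * F' n x + F' n x * e n x"
        by (simp add: algebra_simps)
      also have "\<dots> \<le> (norm (G x) + T) * pos_powr p (z x) + B * e n x"
        using F'_le[OF x] F'_bounds(2)[OF x] T_pos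
            by (intro add_mono mult_left_mono mult_right_mono e_nonneg) auto
      finally show "norm (g n x) \<le> (norm (G x) + T) * pos_powr p (z x) + B * e n x" .
    qed
    moreover have gnn: "0 \<le> (norm (G x) + T) * pos_powr p (z x) + B * e n x" for x
      using T_pos B_nonneg e_nonneg[of n x] by (intro add_nonneg_nonneg mult_nonneg_nonneg) auto
    ultimately have "ennreal (\<integral>x. F n x \<partial>M) \<le> ennreal (2 * r) * ennreal (\<integral>x. (norm (G x)
        + T) * pos_powr p (z x) + B * e n x \<partial>M)"
      using nn_integral_eq_integral[OF iF] nn_integral_eq_integral[OF ig] F_nonneg
      by (simp add: order_trans[OF _ mult_left_mono])
    also have "\<dots> = ennreal (2 * r * (\<integral>x. (norm (G x) + T) * pos_powr p (z x) + B * e n x \<partial>M))"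
      using r by (simp add: ennreal_mult')
    finally have "(\<integral>x. F n x \<partial>M) \<le> 2 * r * (\<integral>x. (norm (G x) + T) * pos_powr p (z x) + B * e n x \<partial>M)"
      using r gnn by (subst (asm) ennreal_le_iff)
          (auto intro!: mult_nonneg_nonneg integral_nonneg_AE)
    then show ?thesis using integrable_mass e_integral(1) by simp
  qed
  have L4: "(\<lambda>n. \<integral>x. F n x \<partial>M) \<longlonglongrightarrow> (\<integral>x. pos_powr (p + 1) (z x) / (p + 1) \<partial>M)"
  proof (rule integral_dominated_convergence[where w = "\<lambda>x. pos_powr (p + 1) (z x) / (p + 1)"])
    show "integrable M (\<lambda>x. pos_powr (p + 1) (z x) / (p + 1))"
      using p by (intro bounded_integrable_M continuous_intros cont_z) auto
  qed (use F_tendsto F_le F_nonneg in \<open>auto intro!: AE_I2 simp: space_M\<close>)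
  have "(\<lambda>n. 2 * r * ((\<integral>x. (norm (G x) + T) * pos_powr p (z x) \<partial>M) + B * (\<integral>x. e n x \<partial>M)))
      \<longlonglongrightarrow> 2 * r * ((\<integral>x. (norm (G x) + T) * pos_powr p (z x) \<partial>M) + B * 0)"
    by (intro tendsto_intros e_integral(2))
  from LIMSEQ_le[OF L4 this] fk
  show "(\<integral>x. pos_powr (p + 1) (z x) / (p + 1) \<partial>M)
      \<le> 2 * r * (\<integral>x. (norm (G x) + T) * pos_powr p (z x) \<partial>M)"
    by simp
qed

end

section \<open>Combination of the energy and L^1 estimates\<close>

context subsolution_below_paraboloid
begin

lemma energy:
  "(\<integral>x. h x * (pos_powr (p + 1) (z x) / (p + 1)) \<partial>M)
      + K1 / 2 * (\<integral>x. norm (G x) powr p * pos_powr p (z x) \<partial>M)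
    \<le> C0 * T powr p * (\<integral>x. pos_powr p (z x) \<partial>M)"
  using ex_test_sequence test_sequence.energy_limit by blast

lemma mass:
  assumes r: "0 < r" "emeasure lborel (ball (0::real^'n) r) = ennreal (2 * m)" "0 < m"
      "emeasure lborel {x \<in> ball y d. 0 < z x} = ennreal m"
  shows "(\<integral>x. pos_powr (p + 1) (z x) / (p + 1) \<partial>M)
    \<le> 2 * r * (\<integral>x. (norm (G x) + T) * pos_powr p (z x) \<partial>M)"
  using ex_test_sequence test_sequence.mass_limit[OF _ r] by blast

text \<open>The L^1 inequality contains |G| to the first power, the energy bound |G|^p. The two are
  matched at the natural size \<open>T\<close>: either |G| \<le> T, or |G| \<le> T^(1-p) |G|^p, and
  the energy bound turns the second alternative back into a multiple of \<open>T\<close>. The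
  absorption term in the energy is nonnegative and is dropped.\<close>

lemma truncation_estimate:
  assumes r: "0 < r" "emeasure lborel (ball (0::real^'n) r) = ennreal (2 * m)" "0 < m"
      "emeasure lborel {x \<in> ball y d. 0 < z x} = ennreal m"
  shows "(\<integral>x. pos_powr (p + 1) (z x) / (p + 1) \<partial>M)
      \<le> 4 * (1 + C0 / K1) * r * T * (\<integral>x. pos_powr p (z x) \<partial>M)"
proof -
  define I where "I = (\<integral>x. pos_powr p (z x) \<partial>M)"
  define E where "E = (\<integral>x. norm (G x) powr p * pos_powr p (z x) \<partial>M)"
  have iz: "integrable M (\<lambda>x. pos_powr p (z x))"
    using p by (intro bounded_integrable_M cont_pos_powr_z) simp
  have hF: "0 \<le> (\<integral>x. h x * (pos_powr (p + 1) (z x) / (p + 1)) \<partial>M)"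
    using nonneg_h cball_subset p by (intro integral_nonneg_AE AE_I2) (auto
        simp: space_M intro!: mult_nonneg_nonneg divide_nonneg_nonneg)
  have E: "E \<le> 2 * C0 / K1 * T powr p * I"
    using energy hF K_pos by (simp add: E_def I_def field_simps)
  have "(\<integral>x. (norm (G x) + T) * pos_powr p (z x) \<partial>M)
    \<le> (\<integral>x. T powr (1 - p) * (norm (G x) powr p * pos_powr p (z x)) + 2 * T * pos_powr p (z x) \<partial>M)"
  proof (rule integral_mono[OF integrable_mass])
    fix x
    have "norm (G x) \<le> T powr (1 - p) * norm (G x) powr p + T"
    proof (cases "norm (G x) \<le> T")
      case False
      have "1 = T powr (1 - p) * T powr (p - 1)"
        using T_pos by (simp flip: powr_add)
      also have "\<dots> \<le> T powr (1 - p) * norm (G x) powr (p - 1)"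
        using False p T_pos by (intro mult_left_mono powr_mono2) auto
      finally have "norm (G x) * 1 \<le> norm (G x) * (T powr (1 - p) * norm (G x) powr (p - 1))"
        by (rule mult_left_mono) simp
      also have "\<dots> = T powr (1 - p) * (norm (G x) * norm (G x) powr (p - 1))" by simp
      also have "norm (G x) * norm (G x) powr (p - 1) = norm (G x) powr p"
        using powr_mult_base[of "norm (G x)" "p - 1"] by simp
      finally show ?thesis using T_pos by simp
    qed (simp add: add_increasing)
    then have "(norm (G x) + T) * pos_powr p (z x)
        \<le> (T powr (1 - p) * norm (G x) powr p + 2 * T) * pos_powr p (z x)"
      by (intro mult_right_mono) auto
    then show "(norm (G x) + T) * pos_powr p (z x)
      \<le> T powr (1 - p) * (norm (G x) powr p * pos_powr p (z x)) + 2 * T * pos_powr p (z x)"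
      by (simp add: algebra_simps)
  qed (use iz integrable_G_pos_powr in auto)
  also have "\<dots> = T powr (1 - p) * E + 2 * T * I"
    using iz integrable_G_pos_powr by (simp add: E_def I_def)
  also have "\<dots> \<le> T powr (1 - p) * (2 * C0 / K1 * T powr p * I) + 2 * T * I"
    using E by (intro add_right_mono mult_left_mono) auto
  also have "\<dots> = 2 * C0 / K1 * (T powr (1 - p) * T powr p) * I + 2 * T * I"
    by (simp add: mult_ac)
  also have "T powr (1 - p) * T powr p = T"
    using T_pos by (simp flip: powr_add)
  also have "2 * C0 / K1 * T * I + 2 * T * I = 2 * (1 + C0 / K1) * T * I"
    by (simp add: algebra_simps)
  finally have "2 * r * (\<integral>x. (norm (G x) + T) * pos_powr p (z x) \<partial>M)
      \<le> 2 * r * (2 * (1 + C0 / K1) * T * I)"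
    using r by (intro mult_left_mono) auto
  also have "2 * r * (2 * q * T * I) = 4 * q * r * T * I" for q by simp
  finally show ?thesis
    unfolding I_def using mass[OF r] by (rule order_trans[rotated])
qed

end

subsection \<open>Pointwise bounds\<close>

text \<open>The rate q = b^(-1/s) is the one at which the growing coefficients are compensated
  exactly, since b q^s = 1. The condition on \<open>Y 0\<close> makes the remaining factor C (Y 0)^s
  at most q, so the bound \<open>Y 0 * q ^ j\<close> reproduces itself.\<close>

lemma fast_geometric_convergence:
  fixes Y :: "nat \<Rightarrow> real"
  assumes b: "1 < b" and s: "0 < s" and C: "0 < C" and Y: "\<And>j. 0 \<le> Y j"
    and step: "\<And>j. Y (Suc j) \<le> C * b ^ j * (Y j * Y j powr s)"
    and Y0: "Y 0 \<le> C powr (- 1 / s) * b powr (- 1 / s\<^sup>2)"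
  shows "Y \<longlonglongrightarrow> 0"
proof -
  define q where "q = b powr (- 1 / s)"
  have q: "0 < q" "q < 1"
    using b s by (auto simp: q_def powr_less_one)
  have "C * Y 0 powr s \<le> C * (C powr (- 1 / s) * b powr (- 1 / s\<^sup>2)) powr s"
    using Y0 Y C s by (intro mult_left_mono powr_mono2) auto
  also have "(C powr (- 1 / s) * b powr (- 1 / s\<^sup>2)) powr s = inverse C * q"
  proof -
    have "(C powr (- 1 / s)) powr s = C powr (- 1)" "(b powr (- 1 / s\<^sup>2)) powr s = q"
      unfolding q_def powr_powr using s by (simp_all add: power2_eq_square)
    then show ?thesis using C by (simp add: powr_mult powr_minus)
  qed
  finally have CY: "C * Y 0 powr s \<le> q" using C by (simp add: field_simps)
  have bq: "b * q powr s = 1"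
  proof -
    have "q powr s = b powr (- 1)"
      unfolding q_def powr_powr using s by simp
    then show ?thesis using b by (simp add: powr_minus)
  qed
  have bound: "Y j \<le> Y 0 * q ^ j" for j
  proof (induction j)
    case (Suc j)
    have "Y (Suc j) \<le> C * b ^ j * (Y j * Y j powr s)" by (rule step)
    also have "\<dots> \<le> C * b ^ j * ((Y 0 * q ^ j) * (Y 0 * q ^ j) powr s)"
      using Suc Y C b q s by (intro mult_left_mono mult_mono powr_mono2) auto
    also have "(Y 0 * q ^ j) powr s = Y 0 powr s * (q powr s) ^ j"
      using q by (simp add: powr_mult powr_power powr_powr mult.commute flip: powr_realpow)
    also have "C * b ^ j * ((Y 0 * q ^ j) * (Y 0 powr s * (q powr s) ^ j))
        = (C * Y 0 powr s) * (Y 0 * q ^ j) * (b * q powr s) ^ j"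
      by (simp add: power_mult_distrib)
    also have "\<dots> = (C * Y 0 powr s) * (Y 0 * q ^ j)"
      by (simp add: bq)
    also have "\<dots> \<le> q * (Y 0 * q ^ j)"
      using CY Y q by (intro mult_right_mono) auto
    finally show ?case by (simp add: mult_ac)
  qed simp
  have "(\<lambda>j. Y 0 * q ^ j) \<longlonglongrightarrow> Y 0 * 0"
    using q by (intro tendsto_mult_left LIMSEQ_power_zero) auto
  then have "(\<lambda>j. Y 0 * q ^ j) \<longlonglongrightarrow> 0" by simp
  moreover have "\<forall>\<^sub>F j in sequentially. norm (Y j) \<le> Y 0 * q ^ j"
    using bound Y by (intro always_eventually) simp
  ultimately show ?thesis by (rule Lim_null_comparison[rotated])
qed

section \<open>One step of the De Giorgi iteration\<close>

context subsolution_below_paraboloid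
begin

lemma measure_M:
  assumes "S \<in> sets borel" "S \<subseteq> cball y d"
  shows "measure M S = measure lborel S"
  using assms unfolding M_def by (subst measure_restrict_space) (auto simp: measure_completion)

lemma indicator_integral_M:
  assumes "S \<in> sets borel" "S \<subseteq> cball y d"
  shows "integrable M (\<lambda>x. indicator S x * (t::real))"
      "(\<integral>x. indicator S x * t \<partial>M) = measure lborel S * t"
proof -
  interpret finite_measure M by (rule finite_M)
  have S: "S \<in> sets M"
    using assms unfolding M_def by (subst sets_restrict_space_iff) auto
  then show "integrable M (\<lambda>x. indicator S x * t)"
    by (intro integrable_mult_left integrable_real_indicator) (auto simp: less_top[symmetric])
  show "(\<integral>x. indicator S x * t \<partial>M) = measure lborel S * t"
    using S assms measure_M[OF assms] by (simp add: space_M Int_absorb2)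
qed

text \<open>Chebyshev's inequality at height \<open>l\<close> on the left, the trivial bound z \<le>
  L on the right, and in between the radius of a ball of volume 2m. This radius is of order m^(1/N)
  and supplies the superlinear power of \<open>m\<close> that drives the iteration.\<close>

lemma superlevel_decay:
  assumes k: "0 \<le> k" "0 < l" and L: "\<And>x. x \<in> cball y d \<Longrightarrow> w x \<le> L"
  defines "m \<equiv> measure lborel {x \<in> ball y d. 0 < z x}"
  shows "l powr (p + 1) * measure lborel {x \<in> ball y d. l < z x}
    \<le> (p + 1) * (4 * (1 + C0 / K1)) * (2 / unit_ball_vol (real CARD('n))) powr (1 / CARD('n)) * T
        * L powr p
        * (m * m powr (1 / CARD('n)))"
proof -
  let ?N = "CARD('n)" and ?\<omega> = "unit_ball_vol (real CARD('n))"
  let ?A = "{x \<in> ball y d. 0 < z x}" and ?B = "{x \<in> ball y d. l < z x}"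
  have A: "?A \<in> sets borel" using open_superlevel by (rule borel_open)
  have "open (z -` {l<..} \<inter> ball y d)"
    by (rule continuous_on_open_vimage[THEN iffD1, rule_format])
       (use cont_z in \<open>auto intro: continuous_on_subset\<close>)
  moreover have "z -` {l<..} \<inter> ball y d = ?B" by auto
  ultimately have B: "?B \<in> sets borel" by (metis borel_open)
  have BA: "?B \<subseteq> ?A" using k by auto
  have finA: "emeasure lborel ?A < \<infinity>"
    by (rule le_less_trans[OF emeasure_mono emeasure_lborel_ball_finite[of y d]]) auto
  then have emA: "emeasure lborel ?A = ennreal m"
    unfolding m_def by (intro emeasure_eq_ennreal_measure) (auto simp: top.not_eq_extremum)
  have \<omega>: "0 < ?\<omega>" by (simp add: unit_ball_vol_pos)
  then have \<omega>0: "?\<omega> \<noteq> 0" by linarith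
  have L0: "0 \<le> L" using L[of y] nonneg[of y] cball_subset d by force
  show ?thesis
  \<comment> \<open>The L^1 inequality requires a support of positive measure; otherwise the higher
    superlevel set is null as well.\<close>
  proof (cases "m = 0")
    case True
    have "measure lborel ?B \<le> measure lborel ?A"
    proof (rule measure_mono_fmeasurable[OF BA])
      show "?B \<in> sets lborel" using B by (simp only: sets_lborel)
      show "?A \<in> fmeasurable lborel" using A finA
          by (intro fmeasurableI) (simp_all only: sets_lborel)
    qed
    also have "measure lborel ?A = 0" using True by (simp only: m_def)
    finally have "measure lborel ?B = 0" using measure_nonneg[of lborel ?B] by linarith
    then show ?thesis unfolding True by simp
  next
    case False
    then have m: "0 < m" by (simp add: m_def zero_less_measure_iff)
    define r where "r = (2 * m / ?\<omega>) powr (1 / ?N)"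
    have r: "0 < r" using m \<omega>0 by (simp add: r_def)
    have "r ^ ?N = r powr real ?N" using r by (simp add: powr_realpow)
    also have "\<dots> = (2 * m / ?\<omega>) powr 1"
      unfolding r_def powr_powr by simp
    also have "\<dots> = 2 * m / ?\<omega>"
    proof -
      have "0 < 2 * m / ?\<omega>" by (rule divide_pos_pos[OF _ \<omega>]) (use m in simp)
      then show ?thesis by (simp only: powr_one_gt_zero_iff less_imp_le)
    qed
    finally have rN: "r ^ ?N = 2 * m / ?\<omega>" .
    have er: "emeasure lborel (ball (0::real^'n) r) = ennreal (2 * m)"
    proof -
      have "emeasure lborel (ball (0::real^'n) r) = ennreal (?\<omega> * r ^ ?N)"
        using emeasure_ball[of r "0::real^'n"] r by simp
      also have "?\<omega> * r ^ ?N = 2 * m" unfolding rN using \<omega>0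
          by (metis nonzero_mult_div_cancel_left times_divide_eq_right)
      finally show ?thesis .
    qed
    have I: "(\<integral>x. pos_powr p (z x) \<partial>M) \<le> m * L powr p"
    proof -
      have "(\<integral>x. pos_powr p (z x) \<partial>M) \<le> (\<integral>x. indicator ?A x * L powr p \<partial>M)"
      proof (rule integral_mono)
        fix x assume "x \<in> space M"
        then have x: "x \<in> cball y d" by (simp add: space_M)
        show "pos_powr p (z x) \<le> indicator ?A x * L powr p"
        proof (cases "0 < z x")
          case True
          have "dist y x \<noteq> d" using sphere[of x] True by (auto simp: z_def)
          then have "x \<in> ?A" using x True by simp
          have "0 \<le> c * (norm (x - y))\<^sup>2" using c by simp
          then have "z x \<le> L" using L[OF x] k by (simp add: z_def)
          then have "pos_powr p (z x) \<le> L powr p"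
            unfolding pos_powr_def using p L0 by (intro powr_mono2) auto
          then show ?thesis using \<open>x \<in> ?A\<close> by simp
        qed simp
      next
        show "integrable M (\<lambda>x. pos_powr p (z x))"
          using p by (intro bounded_integrable_M cont_pos_powr_z) simp
        show "integrable M (\<lambda>x. indicator ?A x * L powr p)"
          using A by (intro indicator_integral_M) auto
      qed
      also have "\<dots> = m * L powr p"
        unfolding m_def using A by (intro indicator_integral_M) auto
      finally show ?thesis .
    qed
    have "measure lborel ?B * (l powr (p + 1) / (p + 1))
        = (\<integral>x. indicator ?B x * (l powr (p + 1) / (p + 1)) \<partial>M)"
      using B by (intro indicator_integral_M(2)[symmetric]) auto
    also have "\<dots> \<le> (\<integral>x. pos_powr (p + 1) (z x) / (p + 1) \<partial>M)"
    proof (rule integral_mono)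
      fix x
      show "indicator ?B x * (l powr (p + 1) / (p + 1)) \<le> pos_powr (p + 1) (z x) / (p + 1)"
        using k p by (auto simp: indicator_def pos_powr_def intro!: divide_right_mono powr_mono2)
    next
      show "integrable M (\<lambda>x. indicator ?B x * (l powr (p + 1) / (p + 1)))"
        using B by (intro indicator_integral_M) auto
      show "integrable M (\<lambda>x. pos_powr (p + 1) (z x) / (p + 1))"
        using p by (intro bounded_integrable_M continuous_intros cont_z) auto
    qed
    also have "\<dots> \<le> 4 * (1 + C0 / K1) * r * T * (\<integral>x. pos_powr p (z x) \<partial>M)"
      by (rule truncation_estimate[OF r er m emA])
    also have "\<dots> \<le> 4 * (1 + C0 / K1) * r * T * (m * L powr p)"
      using I r T_pos K_pos energy_const_pos[OF K_pos, of p]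
      by (intro mult_left_mono mult_nonneg_nonneg add_nonneg_nonneg divide_nonneg_nonneg) auto
    finally have "(p + 1) * (measure lborel ?B * (l powr (p + 1) / (p + 1)))
        \<le> (p + 1) * (4 * (1 + C0 / K1) * r * T * (m * L powr p))"
      using p by (intro mult_left_mono) auto
    moreover have "r = (2 / ?\<omega>) powr (1 / ?N) * m powr (1 / ?N)"
      unfolding r_def by (simp flip: powr_mult)
    ultimately show ?thesis
      using p by (simp add: mult_ac)
  qed
qed

end

text \<open>The constant of \<open>superlevel_decay\<close>; the final factor 2 comes from the slope
  \<open>T = 2 * c * d\<close> of the paraboloid.\<close>

definition level_const :: "nat \<Rightarrow> real \<Rightarrow> real \<Rightarrow> real \<Rightarrow> real" where
  "level_const N p K1 K2 =
    (p + 1) * (4 * (1 + energy_const p K1 K2 / K1)) * (2 / unit_ball_vol (real N)) powr (1 / N) * 2"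

text \<open>The smallness condition of fast geometric convergence for \<open>s = 1 / N\<close> and \<open>b = 2\<^sup>p\<^sup>+\<^sup>1\<close>.\<close>

definition superlevel_const :: "nat \<Rightarrow> real \<Rightarrow> real \<Rightarrow> real \<Rightarrow> real \<Rightarrow> real" where
  "superlevel_const N p K1 K2 \<Lambda> =
    (level_const N p K1 K2 * \<Lambda> powr (p + 1) * 8 powr (p + 1)) powr (- 1 / (1 / N)) *
    (2 powr (p + 1)) powr (- 1 / (1 / N)\<^sup>2)"

lemma level_const_pos: "0 < N \<Longrightarrow> 1 < p \<Longrightarrow> 0 < K1 \<Longrightarrow> 0 < K2 \<Longrightarrow> 0 < level_const N p K1 K2"
  using energy_const_pos[of K1 K2 p] unit_ball_vol_pos[of "real N"]
  unfolding level_const_def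
  by (intro mult_pos_pos add_pos_pos divide_pos_pos) (auto simp del: unit_ball_vol_pos)

lemma superlevel_const_pos:
  "0 < N \<Longrightarrow> 1 < p \<Longrightarrow> 0 < K1 \<Longrightarrow> 0 < K2 \<Longrightarrow> 1 \<le> \<Lambda> \<Longrightarrow> 0 < superlevel_const N p K1 K2 \<Lambda>"
  using level_const_pos[of N p K1 K2] by (simp add: superlevel_const_def)

context subsolution
begin

text \<open>De Giorgi's argument by contradiction. If the set where w exceeds w(y)/2 were too small
  relative to d^N, the measures of the sets above paraboloids with levels rising towards 3/4 w(y)
  would tend to zero. At its centre y, however, a paraboloid is only as high as its level, so w
  still exceeds the one of level 3/4 w(y) on a nonempty open set.\<close>

lemma superlevel_measure_bound:
  assumes \<Lambda>: "1 \<le> \<Lambda>" and d: "0 < d" "d < d2" "cball y d2 \<subseteq> \<Omega>"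
    and wy: "0 < w y" and le: "\<forall>x\<in>cball y d. w x \<le> \<Lambda> * w y"
  shows "superlevel_const CARD('n) p K1 K2 \<Lambda> * d ^ CARD('n) \<le> measure lborel {x \<in> ball y d. w y / 2
      < w x}"
proof -
  let ?N = "CARD('n)"
  define s where "s = 1 / real ?N"
  define b where "b = 2 powr (p + 1)"
  define C where "C = level_const ?N p K1 K2"
  define C5 where "C5 = C * \<Lambda> powr (p + 1) * 8 powr (p + 1)"
  have s: "0 < s" by (simp add: s_def)
  have b: "1 < b" using p by (simp add: b_def)
  have C: "0 < C" unfolding C_def using p K_pos by (intro level_const_pos) auto
  have C5: "0 < C5" using C \<Lambda> by (simp add: C5_def)
  have sc: "superlevel_const ?N p K1 K2 \<Lambda> = C5 powr (- 1 / s) * b powr (- 1 / s\<^sup>2)"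
    by (simp only: superlevel_const_def s_def b_def C_def C5_def)
  show ?thesis
  proof (rule ccontr)
    assume small: "\<not> superlevel_const ?N p K1 K2 \<Lambda> * d ^ ?N \<le> measure lborel {x \<in> ball y d. w y / 2
        < w x}"
    have sBd: "ball y d \<subseteq> cball y d2" using d by auto
    \<comment> \<open>This curvature lifts the paraboloid on the sphere by exactly the assumed bound
      \<open>\<Lambda> * w y\<close>; a positive level makes the comparison strict.\<close>
    define c where "c = \<Lambda> * w y / d\<^sup>2"
    have c: "0 < c" using \<Lambda> wy d by (simp add: c_def)
    have par: "subsolution_below_paraboloid \<Omega> p K1 K2 A w h y d d2 c k" if "0 < k" for k
    proof unfold_locales
      fix x assume "dist y x = d"
      then have "w x \<le> \<Lambda> * w y" "norm (x - y) = d"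
        using le by (auto simp: dist_norm norm_minus_commute)
      then show "w x < k + c * (norm (x - y))\<^sup>2" using d that by (simp add: c_def)
    qed (use d c in auto)
    \<comment> \<open>The increments are w(y)/8 times 2^-j. Raised to the power -(p + 1) they
      produce the factor 8^(p+1) in \<open>C5\<close> and the growth b^j with b = 2^(p+1).\<close>
    define lev where "lev j = w y / 2 + w y / 4 * (1 - (1 / 2) ^ j)" for j :: nat
    have lev: "0 < lev j" "lev j \<le> 3 / 4 * w y" "lev 0 = w y / 2" for j
    proof -
      have "(1 / 2 :: real) ^ j \<le> 1" by (simp add: power_le_one)
      then have "0 \<le> w y / 4 * (1 - (1 / 2) ^ j)" "w y / 4 * (1 - (1 / 2) ^ j) \<le> w y / 4 * 1"
        using wy by (auto intro!: mult_nonneg_nonneg mult_left_mono simp del: mult_1_right)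
      then show "0 < lev j" "lev j \<le> 3 / 4 * w y" using wy by (auto simp: lev_def)
    qed (simp add: lev_def)
    define S where "S k = {x \<in> ball y d. k + c * (norm (x - y))\<^sup>2 < w x}" for k
    \<comment> \<open>Division by d^N makes the recursion scale invariant: the power 1/N of the
      measure contributes a factor d, which cancels the 1/d in the slope of the paraboloid.\<close>
    define Y where "Y j = measure lborel (S (lev j)) / d ^ ?N" for j
    have openS: "open (S k)" if "0 < k" for k
    proof -
      interpret P: subsolution_below_paraboloid \<Omega> p K1 K2 A w h y d d2 c k by (rule par[OF that])
      show ?thesis using P.open_superlevel by (simp add: P.z_def S_def)
    qed
    have finS: "S k \<in> fmeasurable lborel" if "0 < k" for k
    proof (rule fmeasurableI)
      show "S k \<in> sets lborel" using openS[OF that] by (simp add: borel_open)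
      show "emeasure lborel (S k) < \<infinity>"
        by (rule le_less_trans[OF emeasure_mono emeasure_lborel_ball_finite[of y d]]) (auto
            simp: S_def)
    qed
    have "Y \<longlonglongrightarrow> 0"
    proof (rule fast_geometric_convergence[OF b s C5])
      show "0 \<le> Y j" for j using d by (simp add: Y_def)
      have "measure lborel (S (lev 0)) \<le> measure lborel {x \<in> ball y d. w y / 2 < w x}"
      proof (rule measure_mono_fmeasurable)
        show "S (lev 0) \<subseteq> {x \<in> ball y d. w y / 2 < w x}"
        proof
          fix x assume x: "x \<in> S (lev 0)"
          have "0 \<le> c * (norm (x - y))\<^sup>2" using c by simp
          with x show "x \<in> {x \<in> ball y d. w y / 2 < w x}"
            by (auto simp: S_def lev(3))
        qed
        show "S (lev 0) \<in> sets lborel" using finS[OF lev(1)] by (rule fmeasurableD)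
        have "open (w -` {w y / 2<..} \<inter> ball y d)"
          by (rule continuous_on_open_vimage[THEN iffD1, rule_format])
             (use continuous_on_subset[OF cont, of "ball y d"] d(3) sBd in auto)
        moreover have "w -` {w y / 2<..} \<inter> ball y d = {x \<in> ball y d. w y / 2 < w x}" by auto
        ultimately have "open {x \<in> ball y d. w y / 2 < w x}" by simp
        then show "{x \<in> ball y d. w y / 2 < w x} \<in> fmeasurable lborel"
          by (intro fmeasurableI le_less_trans[OF emeasure_mono emeasure_lborel_ball_finite[of y
              d]]) (auto simp: borel_open)
      qed
      also have "\<dots> < superlevel_const ?N p K1 K2 \<Lambda> * d ^ ?N" using small by simp
      finally show "Y 0 \<le> C5 powr (- 1 / s) * b powr (- 1 / s\<^sup>2)"
        unfolding sc[symmetric] Y_def using d by (simp add: divide_simps)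
      show "Y (Suc j) \<le> C5 * b ^ j * (Y j * Y j powr s)" for j
      proof -
        interpret P: subsolution_below_paraboloid \<Omega> p K1 K2 A w h y d d2 c "lev j"
            by (rule par[OF lev(1)])
        define l where "l = w y / 8 * (1 / 2) ^ j"
        have l: "0 < l" using wy by (simp add: l_def)
        have ls: "lev (Suc j) = lev j + l" by (simp add: lev_def l_def algebra_simps)
        have "{x \<in> ball y d. l < P.z x} = S (lev (Suc j))" "{x \<in> ball y d. 0 < P.z x} = S (lev j)"
          unfolding P.z_def S_def ls by auto
        moreover have "P.T = 2 * c * d" by (rule P.T_def)
        then have "P.T = 2 * (\<Lambda> * w y) / d"
          using d by (simp add: c_def power2_eq_square)
        ultimately have D: "l powr (p + 1) * measure lborel (S (lev (Suc j)))
          \<le> (p + 1) * (4 * (1 + energy_const p K1 K2 / K1))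
              * (2 / unit_ball_vol (real CARD('n))) powr s * (2 * (\<Lambda> * w y) / d) * (\<Lambda> * w y) powr p
            * (measure lborel (S (lev j)) * measure lborel (S (lev j)) powr s)"
          using P.superlevel_decay[of l "\<Lambda> * w y"] lev(1)[of j] l le unfolding s_def by auto
        have S_Y: "measure lborel (S (lev i)) = Y i * d ^ ?N" for i using d by (simp add: Y_def)
        have Yd: "(Y j * d ^ ?N) powr s = Y j powr s * d"
        proof -
          have "(d ^ ?N) powr s = d"
            using d by (simp add: s_def powr_powr flip: powr_realpow)
          then show ?thesis by (simp add: powr_mult)
        qed
        have lw: "l powr (p + 1) * (8 powr (p + 1) * b ^ j) = w y powr (p + 1)"
        proof -
          have "b ^ j = (2 ^ j) powr (p + 1)"
            by (simp add: b_def powr_powr powr_power mult.commute flip: powr_realpow)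
          then have "l powr (p + 1) * (8 powr (p + 1) * b ^ j) = (l * (8 * 2 ^ j)) powr (p + 1)"
            by (simp add: powr_mult)
          also have "l * (8 * 2 ^ j) = w y" by (simp add: l_def power_divide)
          finally show ?thesis .
        qed
        have Lw: "(\<Lambda> * w y) * (\<Lambda> * w y) powr p = \<Lambda> powr (p + 1) * w y powr (p + 1)"
          using \<Lambda> wy powr_mult_base[of "\<Lambda> * w y" p] by (simp add: powr_mult add.commute)
        have "l powr (p + 1) * Y (Suc j) * d ^ ?N
            \<le> C * ((\<Lambda> * w y) * (\<Lambda> * w y) powr p) * (Y j * Y j powr s) * d ^ ?N"
          using D d unfolding S_Y Yd C_def level_const_def s_def[symmetric] by (simp add: mult_ac)
        then have "l powr (p + 1) * Y (Suc j)
            \<le> C * ((\<Lambda> * w y) * (\<Lambda> * w y) powr p) * (Y j * Y j powr s)"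
          using d by simp
        also have "\<dots> = l powr (p + 1) * (C5 * b ^ j * (Y j * Y j powr s))"
          unfolding Lw C5_def lw[symmetric] by (simp only: mult_ac)
        finally show ?thesis using l by simp
      qed
    qed
    \<comment> \<open>All levels stay below 3/4 w(y), so each set of the iteration contains the open
      set belonging to that level, to which y belongs.\<close>
    have S0: "0 < 3 / 4 * w y" using wy by simp
    have yS: "y \<in> S (3 / 4 * w y)" using wy d by (simp add: S_def)
    then have "emeasure lborel (S (3 / 4 * w y)) \<noteq> 0"
      using open_not_negligible[of "S (3 / 4 * w y)"] openS[OF S0]
      by (auto simp: negligible_iff_null_sets null_sets_def null_sets_completion_iff borel_open)
    then have pos: "0 < measure lborel (S (3 / 4 * w y))"
      using finS[OF S0] by (simp add: measure_def enn2real_positive_iff fmeasurable_def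
          zero_less_iff_neq_zero)
    have "measure lborel (S (3 / 4 * w y)) / d ^ ?N \<le> Y j" for j
      unfolding Y_def
    proof (intro divide_right_mono measure_mono_fmeasurable finS lev)
      show "S (3 / 4 * w y) \<subseteq> S (lev j)" using lev(2)[of j] by (auto simp: S_def)
      show "S (3 / 4 * w y) \<in> sets lborel" using finS[OF S0] by (rule fmeasurableD)
    qed (use d in auto)
    with \<open>Y \<longlonglongrightarrow> 0\<close> have "measure lborel (S (3 / 4 * w y)) / d ^ ?N \<le> 0"
      by (intro LIMSEQ_le_const) auto
    moreover have "0 < measure lborel (S (3 / 4 * w y)) / d ^ ?N"
      using pos d by (intro divide_pos_pos) auto
    ultimately show False by linarith
  qed
qed

text \<open>Chebyshev's inequality on the set where w exceeds w(y)/2, whose measure is at least a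
  multiple of d^N. Because the iteration controls a measure and not a norm, every exponent \<mu> > 0
  is allowed, including those below 1.\<close>

lemma pointwise_bound_by_mean:
  assumes \<Lambda>: "1 \<le> \<Lambda>" and \<mu>: "0 < \<mu>" and d: "0 < d" "d < d2" "cball y d2 \<subseteq> \<Omega>"
    and le: "\<forall>x\<in>cball y d. w x \<le> \<Lambda> * w y"
  shows "w y powr \<mu> * d ^ CARD('n)
    \<le> (2 powr \<mu> / superlevel_const CARD('n) p K1 K2 \<Lambda>) * (\<integral>x. w x powr \<mu> \<partial>lebesgue_on (cball y d))"
proof -
  let ?\<nu> = "superlevel_const CARD('n) p K1 K2 \<Lambda>"
  have \<nu>: "0 < ?\<nu>" using p K_pos \<Lambda> by (intro superlevel_const_pos) auto
  have sC: "cball y d \<subseteq> \<Omega>" using d by auto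
  have "y \<in> cball y d" using d by simp
  then have ny: "0 \<le> w y" using nonneg[of y] sC by blast
  have I0: "0 \<le> (\<integral>x. w x powr \<mu> \<partial>lebesgue_on (cball y d))" by simp
  show ?thesis
  proof (cases "w y = 0")
    case True
    then show ?thesis using \<nu> I0 \<mu> by simp
  next
    case False
    then have wy: "0 < w y" using ny by simp
    let ?S = "{x \<in> ball y d. w y / 2 < w x}"
    have cw: "continuous_on (cball y d) w" using cont sC by (rule continuous_on_subset)
    have "open (w -` {w y / 2<..} \<inter> ball y d)"
      by (rule continuous_on_open_vimage[THEN iffD1, rule_format])
         (use cw in \<open>auto intro: continuous_on_subset\<close>)
    moreover have "w -` {w y / 2<..} \<inter> ball y d = ?S" by auto
    ultimately have oS: "open ?S" by simp
    let ?M = "lebesgue_on (cball y d)"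
    interpret finite_measure ?M by (intro finite_measure_lebesgue_on) auto
    have sM: "?S \<in> sets ?M" using oS by (subst sets_restrict_space_iff) (auto simp: borel_open)
    have mS: "measure ?M ?S = measure lborel ?S"
      using oS by (subst measure_restrict_space) (auto simp: measure_completion borel_open)
    have cp: "continuous_on (cball y d) (\<lambda>x. w x powr \<mu>)"
      using cw nonneg sC \<mu> by (intro continuous_on_powr') (auto intro!: continuous_intros)
    have "compact ((\<lambda>x. w x powr \<mu>) ` cball y d)"
      using cp by (intro compact_continuous_image) auto
    then obtain B where "\<And>x. x \<in> cball y d \<Longrightarrow> norm (w x powr \<mu>) \<le> B"
      using compact_imp_bounded bounded_iff by (metis imageI)
    then have int: "integrable ?M (\<lambda>x. w x powr \<mu>)"
      using cp by (intro integrable_const_bound[of _ B] continuous_imp_measurable_on_sets_lebesgue)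
          (auto intro!: AE_I2)
    have "(w y / 2) powr \<mu> * (?\<nu> * d ^ CARD('n)) \<le> (w y / 2) powr \<mu> * measure lborel ?S"
      using superlevel_measure_bound[OF \<Lambda> d wy le] by (intro mult_left_mono) auto
    also have "\<dots> = (\<integral>x. indicator ?S x * (w y / 2) powr \<mu> \<partial>?M)"
      using sM mS by (simp add: Int_absorb2 subset_eq)
    also have "\<dots> \<le> (\<integral>x. w x powr \<mu> \<partial>?M)"
    proof (rule integral_mono)
      show "integrable ?M (\<lambda>x. indicator ?S x * (w y / 2) powr \<mu>)"
        using sM by (intro integrable_mult_left integrable_real_indicator) (auto
            simp: less_top[symmetric])
      show "indicator ?S x * (w y / 2) powr \<mu> \<le> w x powr \<mu>" for x
        using wy \<mu> by (auto simp: indicator_def intro!: powr_mono2)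
    qed (rule int)
    finally have "(2 powr \<mu> / ?\<nu>) * ((w y / 2) powr \<mu> * (?\<nu> * d ^ CARD('n)))
        \<le> (2 powr \<mu> / ?\<nu>) * (\<integral>x. w x powr \<mu> \<partial>?M)"
      using \<nu> by (intro mult_left_mono) auto
    moreover have "(w y / 2) powr \<mu> = w y powr \<mu> / 2 powr \<mu>" by (rule powr_divide)
    ultimately show ?thesis using \<nu> by simp
  qed
qed

end

text \<open>In terms of the truncated difference z in the estimate below: 4^(p+1) reflects z \<ge>
  S/4 on the inner ball, 3^p the slope 3S/d, 2^p the bound z \<le> 2S, and 2^N the volume of the
  ball of radius 2d.\<close>

definition absorption_const :: "nat \<Rightarrow> real \<Rightarrow> real \<Rightarrow> real \<Rightarrow> real" where
  "absorption_const N p K1 K2 =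
    (p + 1) * 4 powr (p + 1) * energy_const p K1 K2 * 3 powr p * 2 powr p * unit_ball_vol (real N)
        * 2 ^ N"

text \<open>The level of the paraboloid is negative, so the truncated difference is bounded below on
  the inner ball even where \<open>w\<close> vanishes, while on the outer sphere the paraboloid
  still lies above \<open>w\<close>. The energy estimate, with its gradient term dropped, then
  bounds the integral of \<open>h\<close>.\<close>

lemma (in subsolution) absorption_bound:
  assumes d: "0 < d" "2 * d < d2" "cball y d2 \<subseteq> \<Omega>" and S: "0 < S" and le: "\<forall>x\<in>cball y (2 * d). w x
      \<le> S"
  shows "(\<integral>x. h x \<partial>lebesgue_on (cball y d))
    \<le> absorption_const CARD('n) p K1 K2 * S powr (p - 1) * d ^ CARD('n) * d powr (- p)"
proof -
  let ?N = "CARD('n)" and ?\<omega> = "unit_ball_vol (real CARD('n))" and ?C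
      = "absorption_const CARD('n) p K1 K2"
  \<comment> \<open>With level -S the paraboloid has height 2S at radius 2d and height -S/4 at
    radius d.\<close>
  define c where "c = 3 * S / (2 * d)\<^sup>2"
  interpret P: subsolution_below_paraboloid \<Omega> p K1 K2 A w h y "2 * d" d2 c "- S"
  proof unfold_locales
    fix x assume "dist y x = 2 * d"
    then have "w x \<le> S" "norm (x - y) = 2 * d"
      using le by (auto simp: dist_norm norm_minus_commute)
    then show "w x < - S + c * (norm (x - y))\<^sup>2" using d S by (simp add: c_def)
  qed (use d S in \<open>auto simp: c_def\<close>)
  interpret finite_measure P.M by (rule P.finite_M)
  have "P.T = 2 * c * (2 * d)" by (rule P.T_def)
  then have T: "P.T = 3 * S / d" using d by (simp add: c_def power2_eq_square)
  define \<kappa> where "\<kappa> = (S / 4) powr (p + 1) / (p + 1)"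
  have \<kappa>: "0 < \<kappa>" using S p by (simp add: \<kappa>_def)
  have s1: "cball y d \<subseteq> cball y (2 * d)" using d by auto
  have ch: "continuous_on (cball y (2 * d)) h" using cont_h P.cball_subset
      by (rule continuous_on_subset)
  have sets1: "cball y d \<in> sets P.M"
    unfolding P.M_def using s1 by (subst sets_restrict_space_iff) auto
  have "(\<integral>x. h x \<partial>lebesgue_on (cball y d)) = (\<integral>x. indicator (cball y d) x *\<^sub>R h x \<partial>lebesgue)"
    by (intro integral_restrict_space) simp
  also have "\<dots> = (\<integral>x. indicator (cball y (2 * d)) x *\<^sub>R (indicator (cball y d) x * h x) \<partial>lebesgue)"
    using d by (intro Bochner_Integration.integral_cong) (auto simp: indicator_def)
  also have "\<dots> = (\<integral>x. indicator (cball y d) x * h x \<partial>P.M)"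
    unfolding P.M_def by (intro integral_restrict_space[symmetric]) simp
  finally have hM: "\<kappa> * (\<integral>x. h x \<partial>lebesgue_on (cball y d))
      = (\<integral>x. \<kappa> * (indicator (cball y d) x * h x) \<partial>P.M)"
    by simp
  have hi: "integrable P.M (\<lambda>x. indicator (cball y d) x * h x)"
    using integrable_mult_indicator[OF sets1 P.bounded_integrable_M[OF ch]] by simp
  have hFi: "integrable P.M (\<lambda>x. h x * (pos_powr (p + 1) (P.z x) / (p + 1)))"
    using p by (intro P.bounded_integrable_M continuous_intros ch P.cont_z) auto
  have "(\<integral>x. \<kappa> * (indicator (cball y d) x * h x) \<partial>P.M)
      \<le> (\<integral>x. h x * (pos_powr (p + 1) (P.z x) / (p + 1)) \<partial>P.M)"
  proof (rule integral_mono)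
    fix x assume "x \<in> space P.M"
    then have x: "x \<in> cball y (2 * d)" "x \<in> \<Omega>" using P.cball_subset by (auto simp: P.space_M)
    show "\<kappa> * (indicator (cball y d) x * h x) \<le> h x * (pos_powr (p + 1) (P.z x) / (p + 1))"
    proof (cases "x \<in> cball y d")
      case True
      then have "(norm (x - y))\<^sup>2 \<le> d\<^sup>2" by (intro power_mono) (auto
          simp: dist_norm norm_minus_commute)
      then have "c * (norm (x - y))\<^sup>2 \<le> c * d\<^sup>2" using P.c by (intro mult_left_mono) auto
      also have "c * d\<^sup>2 = 3 * S / 4" using d by (simp add: c_def power2_eq_square)
      finally have "S / 4 \<le> P.z x" using nonneg[OF x(2)] by (simp add: P.z_def)
      then have "(S / 4) powr (p + 1) \<le> pos_powr (p + 1) (P.z x)"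
        unfolding pos_powr_def using S p by (intro powr_mono2) auto
      then have "\<kappa> \<le> pos_powr (p + 1) (P.z x) / (p + 1)"
        unfolding \<kappa>_def using p by (intro divide_right_mono) auto
      then have "\<kappa> * h x \<le> (pos_powr (p + 1) (P.z x) / (p + 1)) * h x"
        using nonneg_h[OF x(2)] by (rule mult_right_mono)
      then show ?thesis using True by (simp add: mult.commute)
    qed (use nonneg_h[OF x(2)] p in \<open>auto intro!: mult_nonneg_nonneg divide_nonneg_nonneg\<close>)
  qed (use hi hFi in auto)
  also have "\<dots> \<le> energy_const p K1 K2 * P.T powr p * (\<integral>x. pos_powr p (P.z x) \<partial>P.M)"
  proof -
    have "0 \<le> K1 / 2 * (\<integral>x. norm (P.G x) powr p * pos_powr p (P.z x) \<partial>P.M)"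
      using K_pos by (intro mult_nonneg_nonneg integral_nonneg_AE) auto
    with P.energy show ?thesis by linarith
  qed
  also have "\<dots> \<le> energy_const p K1 K2 * P.T powr p * (?\<omega> * (2 * d) ^ ?N * (2 * S) powr p)"
  proof (rule mult_left_mono)
    have "(\<integral>x. pos_powr p (P.z x) \<partial>P.M) \<le> (\<integral>x. indicator (cball y (2 * d)) x * (2 * S) powr p \<partial>P.M)"
    proof (rule integral_mono)
      fix x assume "x \<in> space P.M"
      then have x: "x \<in> cball y (2 * d)" by (simp add: P.space_M)
      have "0 \<le> c * (norm (x - y))\<^sup>2" using P.c by simp
      moreover have "w x \<le> S" using le x by blast
      ultimately have "P.z x \<le> 2 * S" by (simp add: P.z_def)
      then have "pos_powr p (P.z x) \<le> (2 * S) powr p"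
        unfolding pos_powr_def using p S by (intro powr_mono2) auto
      then show "pos_powr p (P.z x) \<le> indicator (cball y (2 * d)) x * (2 * S) powr p" using x
          by simp
    next
      show "integrable P.M (\<lambda>x. pos_powr p (P.z x))"
        using p by (intro P.bounded_integrable_M P.cont_pos_powr_z) simp
      show "integrable P.M (\<lambda>x. indicator (cball y (2 * d)) x * (2 * S) powr p)"
        by (intro P.indicator_integral_M) auto
    qed
    also have "\<dots> = measure lborel (cball y (2 * d)) * (2 * S) powr p"
      by (intro P.indicator_integral_M) auto
    also have "measure lborel (cball y (2 * d)) = ?\<omega> * (2 * d) ^ ?N"
      using content_cball[of "2 * d" y] d by simp
    finally show "(\<integral>x. pos_powr p (P.z x) \<partial>P.M) \<le> ?\<omega> * (2 * d) ^ ?N * (2 * S) powr p" .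
  qed (use energy_const_pos[OF K_pos, of p] in auto)
  also have "\<dots> = \<kappa> * (?C * S powr (p - 1) * d ^ ?N * d powr (- p))"
  proof -
    have "S powr (p + 1) * S powr (p - 1) = S powr p * S powr p"
      by (simp flip: powr_add)
    then have e1: "(S / 4) powr (p + 1) * 4 powr (p + 1) * S powr (p - 1) = S powr p * S powr p"
      using S by (simp add: powr_divide)
    have e2: "P.T powr p = 3 powr p * S powr p * d powr (- p)"
      unfolding T powr_divide powr_mult powr_minus_divide by simp
    have e3: "(2 * S) powr p = 2 powr p * S powr p" "(2 * d) ^ ?N = 2 ^ ?N * d ^ ?N"
      by (simp_all add: powr_mult power_mult_distrib)
    have e4: "\<kappa> * (?C * S powr (p - 1) * d ^ ?N * d powr (- p))
      = ((S / 4) powr (p + 1) * 4 powr (p + 1) * S powr (p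
          - 1)) * (energy_const p K1 K2 * 3 powr p * 2 powr p * ?\<omega> * 2 ^ ?N * d ^ ?N
          * d powr (- p))"
      using p by (simp add: \<kappa>_def absorption_const_def)
    show ?thesis unfolding e4 e1 e2 e3 by (simp only: mult_ac)
  qed
  finally show ?thesis
    unfolding hM[symmetric] using \<kappa> by (subst (asm) mult_le_cancel_left_pos) auto
qed

subsection \<open>The coupled system\<close>

lemma open_punctured_ball: "open (punctured_ball r)"
  by (simp add: punctured_ball_def open_delete)

lemma half_norm_cball:
  fixes x0 x :: "real^'n"
  assumes "x \<in> cball x0 (norm x0 / 2)"
  shows "norm x0 / 2 \<le> norm x" "norm x \<le> 3 * (norm x0 / 2)"
proof -
  have "norm (x0 - x) \<le> norm x0 / 2" using assms by (simp add: dist_norm)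
  then show "norm x0 / 2 \<le> norm x" "norm x \<le> 3 * (norm x0 / 2)"
    using norm_triangle_ineq2[of x0 x] norm_triangle_ineq2[of x x0]
        by (simp_all add: norm_minus_commute)
qed

text \<open>The smallest value of the power on [R, 3R] is attained at R for nonnegative
  \<open>b\<close> and at 3R for negative \<open>b\<close>; the minimum in the constant covers both
  signs.\<close>

lemma powr_lower_bound_on_annulus:
  fixes b R t :: real
  assumes "0 < R" "R \<le> t" "t \<le> 3 * R"
  shows "min 1 (3 powr b) * R powr b \<le> t powr b"
proof (cases "0 \<le> b")
  case True
  then have "R powr b \<le> t powr b" using assms by (intro powr_mono2) auto
  moreover have "min 1 (3 powr b) * R powr b \<le> 1 * R powr b" by (intro mult_right_mono) auto
  ultimately show ?thesis by simp
next
  case False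
  then have "(3 * R) powr b \<le> t powr b" using assms by (intro powr_mono2') auto
  moreover have "min 1 (3 powr b) * R powr b \<le> 3 powr b * R powr b" by (intro mult_right_mono) auto
  ultimately show ?thesis by (simp add: powr_mult)
qed

text \<open>The factors in order: the bound by the mean with growth factor
  \<open>2 powr \<alpha>\<close>, the absorption estimate, the comparison of |x|^b with R^b on the
  annulus, the bound of the other unknown by its weighted maximum at distance at least 2d from the
  sphere, and the weight (4d)^\<alpha> at the maximum point.\<close>

definition system_const :: "nat \<Rightarrow> real \<Rightarrow> real \<Rightarrow> real \<Rightarrow> real \<Rightarrow> real \<Rightarrow> real \<Rightarrow> real \<Rightarrow> real \<Rightarrow> real \<Rightarrow>
    real \<Rightarrow> real" where
  "system_const N p K1p K2p q K1q K2q \<mu> b \<alpha> \<beta> =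
    2 powr \<mu> / superlevel_const N p K1p K2p (2 powr \<alpha>)
        * absorption_const N q K1q K2q / min 1 (3 powr b)
      * (2 powr (- \<beta>)) powr (q - 1) * 4 powr (\<alpha> * \<mu>)"

lemma system_const_pos:
  assumes "1 < p" "1 < q" "0 < K1p" "0 < K2p" "0 < K1q" "0 < K2q" "0 < \<alpha>" "0 < N"
  shows "0 < system_const N p K1p K2p q K1q K2q \<mu> b \<alpha> \<beta>"
proof -
  have "0 < absorption_const N q K1q K2q"
    using assms energy_const_pos[of K1q K2q q] unit_ball_vol_pos[of "real N"]
    unfolding absorption_const_def by (intro mult_pos_pos) (auto simp del: unit_ball_vol_pos)
  moreover have "0 < superlevel_const N p K1p K2p (2 powr \<alpha>)"
    using assms by (intro superlevel_const_pos) (auto simp: ge_one_powr_ge_zero)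
  ultimately show ?thesis
    unfolding system_const_def by (intro mult_pos_pos divide_pos_pos) auto
qed

text \<open>Let d be a quarter of the distance of y from the sphere. On the ball of radius 2d around
  y the weight is at least (2d)^\<alpha>, against (4d)^\<alpha> at y; maximality therefore gives u
  \<le> 2^\<alpha> u(y), which is the growth condition for bounding u(y)^\<mu> by a mean. The
  absorption estimate for the second inequality bounds this mean. \<open>H\<close> is any positive
  upper bound, because the weighted maximum of \<open>v\<close> itself might be zero.\<close>

lemma weighted_maximum_bound:
  fixes x0 y :: "real^'n"
  assumes su: "subsolution \<Omega> p K1p K2p A u h"
    and sv: "subsolution \<Omega> q K1q K2q A' v (\<lambda>x. norm x powr b * u x powr \<mu>)"
    and \<mu>: "0 < \<mu>" and \<alpha>: "0 < \<alpha>" and \<beta>: "0 < \<beta>" and scal: "\<alpha> * \<mu> = q + \<beta> * (q - 1)"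
    and R: "R = norm x0 / 2" "0 < R" "cball x0 R \<subseteq> \<Omega>" and H: "0 < H"
    and vH: "\<forall>x\<in>cball x0 R. v x * (R - dist x0 x) powr \<beta> \<le> H" and y: "y \<in> cball x0 R"
    and ymax: "\<forall>x\<in>cball x0 R. u x * (R - dist x0 x) powr \<alpha> \<le> u y * (R - dist x0 y) powr \<alpha>"
  shows "(u y * (R - dist x0 y) powr \<alpha>) powr \<mu>
    \<le> system_const CARD('n) p K1p K2p q K1q K2q \<mu> b \<alpha> \<beta> * R powr (- b) * H powr (q - 1)"
proof -
  interpret U: subsolution \<Omega> p K1p K2p A u h by (rule su)
  interpret V: subsolution \<Omega> q K1q K2q A' v "\<lambda>x. norm x powr b * u x powr \<mu>" by (rule sv)
  let ?N = "CARD('n)"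
  define C1 where "C1 = 2 powr \<mu> / superlevel_const ?N p K1p K2p (2 powr \<alpha>)"
  define C2 where "C2 = absorption_const ?N q K1q K2q"
  define C where "C = system_const ?N p K1p K2p q K1q K2q \<mu> b \<alpha> \<beta>"
  define cb :: real where "cb = min 1 (3 powr b)"
  have C_eq: "C = C1 * C2 / cb * (2 powr (- \<beta>)) powr (q - 1) * 4 powr (\<alpha> * \<mu>)"
    by (simp only: C_def system_const_def C1_def C2_def cb_def)
  have \<Lambda>: "1 \<le> 2 powr \<alpha>" using \<alpha> by (simp add: ge_one_powr_ge_zero)
  have cb: "0 < cb" by (simp add: cb_def)
  have C1: "0 < C1"
    unfolding C1_def using U.p U.K_pos \<Lambda> by (intro divide_pos_pos superlevel_const_pos) auto
  have C: "0 < C"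
    unfolding C_def using U.p V.p U.K_pos V.K_pos \<alpha> by (intro system_const_pos) auto
  have "(u y * (R - dist x0 y) powr \<alpha>) powr \<mu> \<le> C * R powr (- b) * H powr (q - 1)"
  \<comment> \<open>In these cases the weighted value at y is zero; otherwise d is positive.\<close>
  proof (cases "u y = 0 \<or> dist x0 y = R")
    case True
    then show ?thesis using C H \<mu> by auto
  next
    case False
    define d where "d = (R - dist x0 y) / 4"
    have d: "0 < d" using False y by (simp add: d_def)
    have \<rho>: "R - dist x0 y = 4 * d" by (simp add: d_def)
    have sub4: "cball y (4 * d) \<subseteq> cball x0 R"
    proof
      fix x assume "x \<in> cball y (4 * d)"
      then have "dist x0 x \<le> dist x0 y + 4 * d" using dist_triangle[of x0 x y] by simp
      then show "x \<in> cball x0 R" using \<rho> by simp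
    qed
    have \<rho>x: "2 * d \<le> R - dist x0 x" if "x \<in> cball y (2 * d)" for x
      using dist_triangle[of x0 x y] that \<rho> by simp
    have sub2: "cball y (2 * d) \<subseteq> cball y (4 * d)" using d by auto
    have sub1: "cball y d \<subseteq> cball y (2 * d)" using d by auto
    have ule: "u x \<le> 2 powr \<alpha> * u y" if x: "x \<in> cball y (2 * d)" for x
    proof -
      have x0: "x \<in> cball x0 R" using x sub2 sub4 by blast
      then have x\<Omega>: "x \<in> \<Omega>" using R by blast
      have "u x * (2 * d) powr \<alpha> \<le> u x * (R - dist x0 x) powr \<alpha>"
        using \<rho>x[OF x] d \<alpha> U.nonneg[OF x\<Omega>] by (intro mult_left_mono powr_mono2) auto
      also have "\<dots> \<le> u y * (4 * d) powr \<alpha>" using ymax x0 \<rho> by auto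
      also have "(4 * d) powr \<alpha> = 2 powr \<alpha> * (2 * d) powr \<alpha>"
        by (simp flip: powr_mult)
      finally show ?thesis using d by (simp add: mult_ac)
    qed
    \<comment> \<open>The weighted bound for \<open>v\<close>, read at distance at least 2d from the
      sphere.\<close>
    define S where "S = H * (2 * d) powr (- \<beta>)"
    have S: "0 < S" using H d by (simp add: S_def)
    have vle: "v x \<le> S" if x: "x \<in> cball y (2 * d)" for x
    proof -
      have x0: "x \<in> cball x0 R" using x sub2 sub4 by blast
      then have x\<Omega>: "x \<in> \<Omega>" using R by blast
      have "v x * (2 * d) powr \<beta> \<le> v x * (R - dist x0 x) powr \<beta>"
        using \<rho>x[OF x] d \<beta> V.nonneg[OF x\<Omega>] by (intro mult_left_mono powr_mono2) auto
      also have "\<dots> \<le> H" using vH x0 by blast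
      finally show ?thesis using d by (simp add: S_def powr_minus field_simps)
    qed
    have s\<Omega>: "cball y (4 * d) \<subseteq> \<Omega>" using sub4 R by blast
    have c1: "cball y d \<subseteq> \<Omega>" using s\<Omega> sub1 sub2 by blast
    have cu: "continuous_on (cball y d) (\<lambda>x. u x powr \<mu>)"
      using U.nonneg c1 \<mu> by (intro continuous_on_powr' continuous_on_subset[OF U.cont]
          continuous_intros) auto
    have ch: "continuous_on (cball y d) (\<lambda>x. norm x powr b * u x powr \<mu>)"
      using V.cont_h c1 by (rule continuous_on_subset)
    have integ: "integrable (lebesgue_on (cball y d)) f"
        if "continuous_on (cball y d) f" for f :: "real^'n \<Rightarrow> real"
    proof -
      have "integrable lborel (\<lambda>x. indicator (cball y d) x *\<^sub>R f x)"
        using that by (intro borel_integrable_compact) auto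
      then have "integrable lebesgue (\<lambda>x. indicator (cball y d) x *\<^sub>R f x)"
        by (subst integrable_completion) (auto dest: borel_measurable_integrable)
      then show ?thesis by (subst integrable_restrict_space) auto
    qed
    have mean: "cb * R powr b * (\<integral>x. u x powr \<mu> \<partial>lebesgue_on (cball y d))
        \<le> (\<integral>x. norm x powr b * u x powr \<mu> \<partial>lebesgue_on (cball y d))"
    proof -
      have "cb * R powr b * (\<integral>x. u x powr \<mu> \<partial>lebesgue_on (cball y d))
          = (\<integral>x. cb * R powr b * u x powr \<mu> \<partial>lebesgue_on (cball y d))" by simp
      also have "\<dots> \<le> (\<integral>x. norm x powr b * u x powr \<mu> \<partial>lebesgue_on (cball y d))"
      proof (rule integral_mono)
        fix x assume "x \<in> space (lebesgue_on (cball y d))"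
        then have "x \<in> cball x0 (norm x0 / 2)" using sub1 sub2 sub4 R by (auto simp: subset_eq)
        from half_norm_cball[OF this] have "cb * R powr b \<le> norm x powr b"
          unfolding cb_def using R by (intro powr_lower_bound_on_annulus) auto
        then show "cb * R powr b * u x powr \<mu> \<le> norm x powr b * u x powr \<mu>"
          by (rule mult_right_mono) simp
      qed (use integ[OF cu] integ[OF ch] in auto)
      finally show ?thesis .
    qed
    have "u y powr \<mu> * d ^ ?N \<le> C1 * (\<integral>x. u x powr \<mu> \<partial>lebesgue_on (cball y d))"
      using d ule sub1 s\<Omega> unfolding C1_def by (intro U.pointwise_bound_by_mean[OF \<Lambda> \<mu>, where ?d2.0
          = "4 * d"]) auto
    also have "\<dots> \<le> C1 * (1 / (cb * R powr b) * (C2 * S powr (q - 1) * d ^ ?N * d powr (- q)))"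
    proof (rule mult_left_mono)
      have "cb * R powr b * (\<integral>x. u x powr \<mu> \<partial>lebesgue_on (cball y d))
          \<le> C2 * S powr (q - 1) * d ^ ?N * d powr (- q)"
        using mean V.absorption_bound[OF d, where ?d2.0 = "4 * d" and S = S and y = y] d s\<Omega> S vle
        unfolding C2_def by fastforce
      moreover have "0 < cb * R powr b" using cb R by simp
      ultimately show "(\<integral>x. u x powr \<mu> \<partial>lebesgue_on (cball y d))
          \<le> 1 / (cb * R powr b) * (C2 * S powr (q - 1) * d ^ ?N * d powr (- q))"
        by (simp add: pos_le_divide_eq mult.commute)
    qed (use C1 in simp)
    also have "\<dots> = C1 * C2 / cb * R powr (- b) * S powr (q - 1) * d powr (- q) * d ^ ?N"
      by (simp add: powr_minus_divide)
    finally have uyb: "u y powr \<mu> \<le> C1 * C2 / cb * R powr (- b) * S powr (q - 1) * d powr (- q)"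
      using d by (simp only: mult_le_cancel_right_pos zero_less_power)
    have "(u y * (R - dist x0 y) powr \<alpha>) powr \<mu> = u y powr \<mu> * (4 powr (\<alpha> * \<mu>) * d powr (\<alpha> * \<mu>))"
      unfolding \<rho> by (simp add: powr_mult powr_powr)
    also have "\<dots> \<le> (C1 * C2 / cb * R powr (- b) * S powr (q
        - 1) * d powr (- q)) * (4 powr (\<alpha> * \<mu>) * d powr (\<alpha> * \<mu>))"
      using uyb by (rule mult_right_mono) simp
    also have "S powr (q - 1) = H powr (q - 1) * (2 powr (- \<beta>)) powr (q - 1) * d powr (- \<beta> * (q
        - 1))"
      by (simp add: S_def powr_mult powr_powr)
    also have "(C1 * C2 / cb * R powr (- b) * (H powr (q - 1) * (2 powr (- \<beta>)) powr (q
        - 1) * d powr (- \<beta> * (q - 1))) * d powr (- q)) * (4 powr (\<alpha> * \<mu>) * d powr (\<alpha> * \<mu>))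
      = C * R powr (- b) * H powr (q - 1) * (d powr (- \<beta> * (q
          - 1)) * d powr (- q) * d powr (\<alpha> * \<mu>))"
      unfolding C_eq by (simp only: mult_ac times_divide_eq_right times_divide_eq_left)
    \<comment> \<open>The relation \<open>scal\<close> states precisely that the powers of
      \<open>d\<close> cancel.\<close>
    also have "d powr (- \<beta> * (q - 1)) * d powr (- q) * d powr (\<alpha> * \<mu>) = d powr 0"
      unfolding powr_add[symmetric] scal by simp
    finally show ?thesis using d by simp
  qed
  then show ?thesis by (simp only: C_def)
qed

text \<open>The first inequality is raised to the power \<delta> and the second inserted;
  \<open>D\<close> is the excess of the exponent of \<open>G\<close> on the left over that on the
  right.\<close>

lemma coupled_power_bound:
  fixes G H P Q p q \<delta> \<mu> D :: real
  assumes pos: "0 < G" "0 < H" "0 < P" "0 < Q" and q: "1 < q" and \<delta>: "0 < \<delta>"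
    and D: "D = \<delta> * \<mu> - (p - 1) * (q - 1)" "0 < D"
    and G: "G powr \<mu> \<le> P * H powr (q - 1)" and H: "H powr \<delta> \<le> Q * G powr (p - 1)"
  shows "G \<le> (P powr \<delta> * Q powr (q - 1)) powr (1 / D)"
proof -
  have "G powr (\<mu> * \<delta>) = (G powr \<mu>) powr \<delta>" by (simp add: powr_powr)
  also have "\<dots> \<le> (P * H powr (q - 1)) powr \<delta>" using G \<delta> by (intro powr_mono2) auto
  also have "\<dots> = P powr \<delta> * (H powr \<delta>) powr (q - 1)"
    by (simp add: powr_mult powr_powr mult.commute)
  also have "\<dots> \<le> P powr \<delta> * (Q * G powr (p - 1)) powr (q - 1)"
    using H q by (intro mult_left_mono powr_mono2) auto
  also have "\<dots> = P powr \<delta> * Q powr (q - 1) * G powr ((p - 1) * (q - 1))"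
    by (simp add: powr_mult powr_powr)
  finally have "G powr (\<mu> * \<delta>) / G powr ((p - 1) * (q - 1)) \<le> P powr \<delta> * Q powr (q - 1)"
    using pos by (simp add: divide_le_eq)
  then have "G powr D \<le> P powr \<delta> * Q powr (q - 1)"
    using D by (simp add: mult.commute flip: powr_diff)
  then have "(G powr D) powr (1 / D) \<le> (P powr \<delta> * Q powr (q - 1)) powr (1 / D)"
    using D by (intro powr_mono2) auto
  then show ?thesis using D pos by (simp add: powr_powr)
qed

lemma weighted_continuous_attains_max:
  fixes w :: "real^'n \<Rightarrow> real"
  assumes "continuous_on (cball x0 R) w" "0 < R" "0 < \<alpha>"
  shows "\<exists>y\<in>cball x0 R. \<forall>x\<in>cball x0 R. w x * (R - dist x0 x) powr \<alpha> \<le> w y * (R - dist x0 y) powr \<alpha>"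
proof (rule continuous_attains_sup)
  show "continuous_on (cball x0 R) (\<lambda>x. w x * (R - dist x0 x) powr \<alpha>)"
    using assms by (intro continuous_intros continuous_on_powr') auto
qed (use assms in auto)

text \<open>The exponents \<alpha> and \<beta> solve the linear system \<open>s1\<close>,
  \<open>s2\<close>, whose determinant is \<open>D\<close>; these are the relations under which the
  weighted estimates for both unknowns are free of the distance d. At x0 the weight is R^\<alpha>,
  so a bound for the weighted maximum is one for u(x0).\<close>

lemma system_pointwise_bound:
  assumes su: "subsolution \<Omega> p K1p K2p A u (\<lambda>x. norm x powr a * v x powr \<delta>)"
    and sv: "subsolution \<Omega> q K1q K2q A' v (\<lambda>x. norm x powr b * u x powr \<mu>)"
    and \<delta>: "0 < \<delta>" and \<mu>: "0 < \<mu>" and D: "D = \<delta> * \<mu> - (p - 1) * (q - 1)" "0 < D"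
    and x0: "x0 \<noteq> 0" and sub: "cball x0 (norm x0 / 2) \<subseteq> \<Omega>"
    and \<alpha>_def: "\<alpha> = (q * \<delta> + p * (q - 1)) / D" and \<beta>_def: "\<beta> = (p * \<mu> + q * (p - 1)) / D"
    and \<gamma>: "\<gamma> = ((p + a) * (q - 1) + (q + b) * \<delta>) / D"
  shows "u x0 \<le> (system_const CARD('n) p K1p K2p q K1q K2q \<mu> b \<alpha> \<beta> powr \<delta> *
      system_const CARD('n) q K1q K2q p K1p K2p \<delta> a \<beta> \<alpha> powr (q - 1)) powr (1 / D) * 2 powr \<gamma> *
    norm (x0 :: real^'n) powr (- \<gamma>)"
proof -
  interpret U: subsolution \<Omega> p K1p K2p A u "\<lambda>x. norm x powr a * v x powr \<delta>" by (rule su)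
  interpret V: subsolution \<Omega> q K1q K2q A' v "\<lambda>x. norm x powr b * u x powr \<mu>" by (rule sv)
  have p: "1 < p" and q: "1 < q" by (rule U.p, rule V.p)
  have \<alpha>: "0 < \<alpha>" and \<beta>: "0 < \<beta>"
    using p q \<delta> \<mu> D(2) by (auto simp: \<alpha>_def \<beta>_def intro!: divide_pos_pos add_pos_pos)
  have s1: "\<alpha> * \<mu> = q + \<beta> * (q - 1)"
  proof -
    have "D * (\<alpha> * \<mu>) = D * (q + \<beta> * (q - 1))"
      using D(2) by (simp add: \<alpha>_def \<beta>_def distrib_left) (simp add: D(1) algebra_simps)
    then show ?thesis using D(2) by simp
  qed
  have s2: "\<beta> * \<delta> = p + \<alpha> * (p - 1)"
  proof -
    have "D * (\<beta> * \<delta>) = D * (p + \<alpha> * (p - 1))"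
      using D(2) by (simp add: \<alpha>_def \<beta>_def distrib_left) (simp add: D(1) algebra_simps)
    then show ?thesis using D(2) by simp
  qed
  define C1 where "C1 = system_const CARD('n) p K1p K2p q K1q K2q \<mu> b \<alpha> \<beta>"
  define C2 where "C2 = system_const CARD('n) q K1q K2q p K1p K2p \<delta> a \<beta> \<alpha>"
  have C1: "0 < C1" and C2: "0 < C2"
    unfolding C1_def C2_def using p q U.K_pos V.K_pos \<alpha> \<beta> by (auto intro!: system_const_pos)
  define C where "C = (C1 powr \<delta> * C2 powr (q - 1)) powr (1 / D) * 2 powr \<gamma>"
  have C: "0 < C" using C1 C2 by (simp add: C_def)
  define R where "R = norm x0 / 2"
  have R: "0 < R" using x0 by (simp add: R_def)
  have sR: "cball x0 R \<subseteq> \<Omega>" using sub by (simp add: R_def)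
  obtain y1 where y1: "y1 \<in> cball x0 R" "\<forall>x\<in>cball x0 R. u x * (R - dist x0 x) powr \<alpha>
      \<le> u y1 * (R - dist x0 y1) powr \<alpha>"
    using weighted_continuous_attains_max[OF continuous_on_subset[OF U.cont sR] R \<alpha>] by blast
  obtain y2 where y2: "y2 \<in> cball x0 R" "\<forall>x\<in>cball x0 R. v x * (R - dist x0 x) powr \<beta>
      \<le> v y2 * (R - dist x0 y2) powr \<beta>"
    using weighted_continuous_attains_max[OF continuous_on_subset[OF V.cont sR] R \<beta>] by blast
  define G where "G = u y1 * (R - dist x0 y1) powr \<alpha>"
  define H where "H = v y2 * (R - dist x0 y2) powr \<beta>"
  have G0: "0 \<le> G" and H0: "0 \<le> H"
    using U.nonneg V.nonneg y1 y2 sR by (auto simp: G_def H_def intro!: mult_nonneg_nonneg)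
  have u0: "u x0 * R powr \<alpha> \<le> G"
    using y1(2)[rule_format, of x0] R by (simp add: G_def)
  \<comment> \<open>Stated for every positive \<open>h\<close> above \<open>H\<close>, because
    \<open>H\<close> = 0 has not been excluded yet.\<close>
  have GH: "G powr \<mu> \<le> C1 * R powr (- b) * h powr (q - 1)" if "H \<le> h" "0 < h" for h
    unfolding G_def using y2(2) that
    by (intro weighted_maximum_bound[OF su sv \<mu> \<alpha> \<beta> s1 R_def R sR that(2) _ y1, folded C1_def])
        (auto simp: H_def intro: order_trans)
  have "u x0 \<le> C * norm x0 powr (- \<gamma>)"
  proof (cases "G = 0")
    case True
    then have "u x0 \<le> 0" using u0 R by (simp add: mult_le_0_iff)
    also have "0 \<le> C * norm x0 powr (- \<gamma>)" using C by simp
    finally show ?thesis .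
  next
    case False
    then have G: "0 < G" using G0 by simp
    have H: "0 < H"
    proof (rule ccontr)
      assume "\<not> 0 < H"
      then have "H = 0" using H0 by simp
      define X where "X = C1 * R powr (- b)"
      have X: "0 < X" using C1 R by (simp add: X_def)
      \<comment> \<open>Chosen so that, for \<open>H\<close> = 0, the bound \<open>GH\<close> at
        this value puts \<open>G powr \<mu>\<close> below its own half.\<close>
      define \<epsilon> where "\<epsilon> = (G powr \<mu> / (2 * X)) powr (1 / (q - 1))"
      have \<epsilon>: "0 < \<epsilon>" using G X by (simp add: \<epsilon>_def)
      have "\<epsilon> powr (q - 1) = G powr \<mu> / (2 * X)"
        using q G X by (simp add: \<epsilon>_def powr_powr)
      with GH[of \<epsilon>] \<epsilon> \<open>H = 0\<close> X have "G powr \<mu> \<le> G powr \<mu> / 2"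
        by (simp add: X_def[symmetric])
      moreover have "0 < G powr \<mu>" using G by simp
      ultimately show False by linarith
    qed
    have HG: "H powr \<delta> \<le> C2 * R powr (- a) * G powr (p - 1)"
      unfolding H_def using y1(2) G by (intro weighted_maximum_bound[OF sv su \<delta> \<beta> \<alpha> s2 R_def R sR G
          _ y2, folded C2_def]) (simp add: G_def)
    have "G \<le> ((C1 * R powr (- b)) powr \<delta> * (C2 * R powr (- a)) powr (q - 1)) powr (1 / D)"
      using C1 C2 R by (intro coupled_power_bound[OF G H _ _ q \<delta> D GH[OF order_refl H] HG]) auto
    also have "(C1 * R powr (- b)) powr \<delta> * (C2 * R powr (- a)) powr (q - 1)
        = (C1 powr \<delta> * C2 powr (q - 1)) * R powr (- b * \<delta> + - a * (q - 1))"
      by (simp only: powr_mult powr_powr powr_add) (simp only: mult_ac)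
    also have "(\<dots>) powr (1 / D) = (C1 powr \<delta> * C2 powr (q - 1)) powr (1 / D) * R powr ((- b * \<delta> +
        - a * (q - 1)) / D)"
      by (simp add: powr_mult powr_powr)
    finally have "u x0 * R powr \<alpha> \<le> (C1 powr \<delta> * C2 powr (q - 1)) powr (1 / D) * R powr ((- b * \<delta> +
        - a * (q - 1)) / D)"
      using u0 by simp
    then have "u x0 \<le> (C1 powr \<delta> * C2 powr (q - 1)) powr (1 / D) * R powr ((- b * \<delta> + - a * (q
        - 1)) / D) / R powr \<alpha>"
      using R by (simp add: pos_le_divide_eq)
    also have "\<dots> = (C1 powr \<delta> * C2 powr (q - 1)) powr (1 / D) * R powr ((- b * \<delta> + - a * (q
        - 1)) / D - \<alpha>)"
      by (simp add: powr_diff)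
    \<comment> \<open>The weight contributes \<alpha>, the exponent of the case a = b = 0; the
      factors |x|^a and |x|^b contribute the rest of \<gamma>.\<close>
    also have "(- b * \<delta> + - a * (q - 1)) / D - \<alpha> = - \<gamma>"
      unfolding \<gamma> \<alpha>_def using D(2) by (simp add: field_simps)
    also have "R powr (- \<gamma>) = 2 powr \<gamma> * norm x0 powr (- \<gamma>)"
      by (simp add: R_def powr_divide powr_minus field_simps)
    finally show ?thesis by (simp add: C_def)
  qed
  then show ?thesis by (simp only: C_def C1_def C2_def)
qed

text \<open>Away from the origin |x|^a is continuous for every real \<open>a\<close>, which makes
  the absorption term continuous on the punctured ball.\<close>

lemma subsolution_of_weakly_le:
  fixes u v :: "real^'n \<Rightarrow> real"
  assumes "1 < p" "strongly_coercive (punctured_ball 1) p K1 K2 A"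
    "W1p_loc (punctured_ball 1) p u" "continuous_on (punctured_ball 1) u"
        "continuous_on (punctured_ball 1) v"
    "\<forall>x\<in>punctured_ball 1. 0 \<le> u x \<and> 0 \<le> v x" "0 < \<delta>"
    "weakly_le (punctured_ball 1) p A u (\<lambda>x. - (norm x powr a * v x powr \<delta>))"
  shows "subsolution (punctured_ball 1) p K1 K2 A u (\<lambda>x. norm x powr a * v x powr \<delta>)"
proof
  have "continuous_on (punctured_ball 1) (\<lambda>x::real^'n. norm x powr a)"
    by (intro continuous_on_powr continuous_intros) (auto simp: punctured_ball_def)
  moreover have "continuous_on (punctured_ball 1) (\<lambda>x. v x powr \<delta>)"
    using assms by (intro continuous_on_powr' continuous_intros) auto
  ultimately show "continuous_on (punctured_ball 1) (\<lambda>x. norm x powr a * v x powr \<delta>)"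
    by (rule continuous_on_mult)
qed (use assms in \<open>auto simp: open_punctured_ball\<close>)

theorem theorem1p4:
  fixes p q \<delta> \<mu> a b K1p K2p K1q K2q D \<gamma> \<xi> :: real
  assumes "1 < p" "p < real CARD('n::finite)" "1 < q" "q < real CARD('n)"
    and "\<delta> > 0" "\<mu> > 0"
    and "D = \<delta> * \<mu> - (p - 1) * (q - 1)" "D > 0"
    and "a > - p" "b > - q"
    and "\<gamma> = ((p + a) * (q - 1) + (q + b) * \<delta>) / D"
    and "\<xi> = ((q + b) * (p - 1) + (p + a) * \<mu>) / D"
  shows "\<exists>C>0. \<forall>(Ap :: 'n flux) (Aq :: 'n flux) (u :: real^'n \<Rightarrow> real) (v :: real^'n \<Rightarrow> real).
      caratheodory (punctured_ball 1) Ap \<and> strongly_coercive (punctured_ball 1) p K1p K2p Ap \<and>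
      caratheodory (punctured_ball 1) Aq \<and> strongly_coercive (punctured_ball 1) q K1q K2q Aq \<and>
      W1p_loc (punctured_ball 1) p u \<and> continuous_on (punctured_ball 1) u \<and>
      W1p_loc (punctured_ball 1) q v \<and> continuous_on (punctured_ball 1) v \<and>
      (\<forall>x\<in>punctured_ball 1. 0 \<le> u x \<and> 0 \<le> v x) \<and>
      weakly_le (punctured_ball 1) p Ap u (\<lambda>x. - (norm x powr a * v x powr \<delta>)) \<and>
      weakly_le (punctured_ball 1) q Aq v (\<lambda>x. - (norm x powr b * u x powr \<mu>)) \<longrightarrow>
      (\<forall>x\<in>punctured_ball (1/2).
         u x \<le> C * norm x powr (- \<gamma>) \<and> v x \<le> C * norm x powr (- \<xi>))"
proof -
  define \<alpha> where "\<alpha> = (q * \<delta> + p * (q - 1)) / D"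
  define \<beta> where "\<beta> = (p * \<mu> + q * (p - 1)) / D"
  define c1 where "c1 = system_const CARD('n) p K1p K2p q K1q K2q \<mu> b \<alpha> \<beta>"
  define c2 where "c2 = system_const CARD('n) q K1q K2q p K1p K2p \<delta> a \<beta> \<alpha>"
  define C1 where "C1 = (c1 powr \<delta> * c2 powr (q - 1)) powr (1 / D) * 2 powr \<gamma>"
  define C2 where "C2 = (c2 powr \<mu> * c1 powr (p - 1)) powr (1 / D) * 2 powr \<xi>"
  have D': "D = \<mu> * \<delta> - (q - 1) * (p - 1)" using assms(7) by (simp add: mult.commute)
  \<comment> \<open>The constant is fixed before any operator is given, while positivity of the
    coercivity constants is known only once a coercive operator exists. The maximum with 1 makes it
    positive in every case.\<close>
  have "u x \<le> max 1 (max C1 C2) * norm x powr (- \<gamma>) \<and> v x \<le> max 1 (max C1 C2) * norm x powr (- \<xi>)"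
    if c: "strongly_coercive (punctured_ball 1) p K1p K2p Ap"
        "strongly_coercive (punctured_ball 1) q K1q K2q Aq"
      and w: "W1p_loc (punctured_ball 1) p u" "continuous_on (punctured_ball 1) u"
      "W1p_loc (punctured_ball 1) q v" "continuous_on (punctured_ball 1) v"
      and nn: "\<forall>x\<in>punctured_ball 1. 0 \<le> u x \<and> 0 \<le> v x"
      and wk: "weakly_le (punctured_ball 1) p Ap u (\<lambda>x. - (norm x powr a * v x powr \<delta>))"
      "weakly_le (punctured_ball 1) q Aq v (\<lambda>x. - (norm x powr b * u x powr \<mu>))"
      and x: "x \<in> punctured_ball (1/2)" for Ap Aq :: "'n flux" and u v x
  proof -
    have su: "subsolution (punctured_ball 1) p K1p K2p Ap u (\<lambda>x. norm x powr a * v x powr \<delta>)"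
      by (rule subsolution_of_weakly_le[OF assms(1) c(1) w(1,2,4) nn assms(5) wk(1)])
    have nn': "\<forall>x\<in>punctured_ball 1. 0 \<le> v x \<and> 0 \<le> u x" using nn by blast
    have sv: "subsolution (punctured_ball 1) q K1q K2q Aq v (\<lambda>x. norm x powr b * u x powr \<mu>)"
      by (rule subsolution_of_weakly_le[OF assms(3) c(2) w(3,4,2) nn' assms(6) wk(2)])
    have x0: "x \<noteq> 0" "norm x < 1 / 2" using x by (auto simp: punctured_ball_def)
    \<comment> \<open>The points of this ball have norm at least |x|/2 and at most 3|x|/2, which is
      below 3/4.\<close>
    have sub: "cball x (norm x / 2) \<subseteq> punctured_ball 1"
    proof
      fix t assume "t \<in> cball x (norm x / 2)"
      from half_norm_cball[OF this] x0 show "t \<in> punctured_ball 1"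
        by (auto simp: punctured_ball_def)
    qed
    have "u x \<le> C1 * norm x powr (- \<gamma>)"
      unfolding C1_def c1_def c2_def
      by (rule system_pointwise_bound[OF su sv assms(5-8) x0(1) sub \<alpha>_def \<beta>_def assms(11)])
    also have "\<dots> \<le> max 1 (max C1 C2) * norm x powr (- \<gamma>)" by (intro mult_right_mono) auto
    finally have "u x \<le> max 1 (max C1 C2) * norm x powr (- \<gamma>)" .
    \<comment> \<open>The hypotheses are symmetric under exchanging u, p, a, \<delta>, \<alpha> with
      v, q, b, \<mu>, \<beta>; \<open>D\<close> is invariant and \<gamma> becomes \<xi>.\<close>
    moreover have "v x \<le> C2 * norm x powr (- \<xi>)"
      unfolding C2_def c1_def c2_def
      by (rule system_pointwise_bound[OF sv su assms(6,5) D' assms(8) x0(1) sub \<beta>_def \<alpha>_def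
          assms(12)])
    then have "v x \<le> max 1 (max C1 C2) * norm x powr (- \<xi>)"
      by (rule order_trans) (intro mult_right_mono, auto)
    ultimately show ?thesis by blast
  qed
  then show ?thesis
    by (intro exI[of _ "max 1 (max C1 C2)"]) auto
qed

end
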